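(* Consider the prototype Riemannian interior point algorithm described in the context for solving the problem $\min_{x\in\mathcal{M}} f(x)$ s.t. $h(x)=0$, $g(x)\le 0$. Suppose that the following hold at some $w^*=(x^*,y^*,z^*,s^* )\in\mathcal{N}$: (A1) $w^*$ satisfies the Riemannian KKT conditions: $\operatorname{grad}_x\mathcal{L}(x^*,y^*,z^* )=0_{x^*}$, $h(x^* )=0$, $g(x^* )\le 0$, $z^*\ge 0$, $z^*_i g_i(x^* )=0$ for all $i=1,\dots,m$, with slack variables $s^*=-g(x^* )$; (A2) the set $\{\operatorname{grad} h_i(x^* )\}_{i=1}^l\cup\{\operatorname{grad} g_i(x^* )\}_{i\in\mathbb{A}(x^* )}$ is linearly independent in $T_{x^*}\mathcal{M}$, where $\mathbb{A}(x^* )=\{i: g_i(x^* )=0\}$; (A3) $z^*_i>0$ if $g_i(x^* )=0$, for all $i=1,\dots,m$; (A4) $\langle \operatorname{Hess}_x\mathcal{L}(w^* )[\xi],\xi\rangle>0$ for all nonzero $\xi\in T_{x^*}\mathcal{M}$ satisfying $\langle\xi,\operatorname{grad}h_i(x^* )\rangle=0$ for $i=1,\dots,l$ and $\langle \xi,\operatorname{grad} g_i(x^* )\rangle=0$ for $i\in\mathbb{A}(x^* )$. Choose the parameters $\mu_k,\gamma_k$ as in (1) or (2) below; then there exists a constant $\delta>0$ such that, for all $w_0=(x_0,y_0,z_0,s_0)\in\mathcal{N}$ (with $(z_0,s_0)>0$, as the algorithm requires) satisfying $\operatorname{dist}(w_0,w^* )<\delta$, the sequence $\{w_k\}$ is well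 defined. Furthermore, (1) if we choose $\mu_k=o(\|F(w_k)\|)$ and $\gamma_k\to 1$, then $w_k\to w^*$ superlinearly; (2) if we choose $\mu_k=O(\|F(w_k)\|^2)$ and $1-\gamma_k=O(\|F(w_k)\|)$, then $w_k\to w^*$ quadratically.
   Context: Setting. $\mathcal{M}$ is a connected, complete $d$-dimensional Riemannian manifold; $f:\mathcal{M}\to\mathbb{R}$, $h=(h_1,\dots,h_l):\mathcal{M}\to\mathbb{R}^l$, $g=(g_1,\dots,g_m):\mathcal{M}\to\mathbb{R}^m$ are smooth. $\operatorname{grad}$ and $\operatorname{Hess}$ are the Riemannian gradient and Hessian, and $\nabla$ is the Levi-Civita connection. The Lagrangian is $\mathcal{L}(x,y,z)=f(x)+\sum_i y_ih_i(x)+\sum_i z_ig_i(x)$; $\operatorname{grad}_x\mathcal{L}$ and $\operatorname{Hess}_x\mathcal{L}(w)$ are the Riemannian gradient and Hessian of $\mathcal{L}(\cdot,y,z)$ at $x$. Let $\mathcal{N}=\mathcal{M}\times\mathbb{R}^l\times\mathbb{R}^m\times\mathbb{R}^m$ be the product Riemannian manifold with Riemannian distance $\operatorname{dist}$, and write $w=(x,y,z,s)\in\mathcal{N}$. With $Z=\operatorname{diag}(z)$, $S=\operatorname{diag}(s)$ and $e$ the all-ones vector, the KKT vector field on $\mathcal{N}$ is $$F(w)=\big(\operatorname{grad}_x\mathcal{L}(x,y,z),\ h(x),\ g(x)+s,\ ZSe\big)\in T_w\mathcal{N}\cong T_x\mathcal{M}\times\mathbb{R}^l\times\mathbb{R}^m\times\mathbb{R}^m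 .$$ Its covariant derivative at $w$ is the linear operator on $T_w\mathcal{N}$ $$\nabla F(w)[\Delta w]=\big(\operatorname{Hess}_x\mathcal{L}(w)[\Delta x]+\mathcal{H}_x[\Delta y]+\mathcal{G}_x[\Delta z],\ \mathcal{H}_x^*[\Delta x],\ \mathcal{G}_x^*[\Delta x]+\Delta s,\ Z\Delta s+S\Delta z\big),$$ where $\Delta w=(\Delta x,\Delta y,\Delta z,\Delta s)$, $\mathcal{H}_x[v]=\sum_i v_i\operatorname{grad}h_i(x)$, $\mathcal{G}_x[u]=\sum_i u_i\operatorname{grad}g_i(x)$, and $\mathcal{H}_x^*,\mathcal{G}_x^*$ are the adjoint operators. Let $\hat e=\hat e(w)=(0_x,0,0,e)$. A retraction on $\mathcal{M}$ is a smooth map $\mathrm{R}:T\mathcal{M}\to\mathcal{M}$ whose restriction $\mathrm{R}_x$ to $T_x\mathcal{M}$ satisfies $\mathrm{R}_x(0_x)=x$ and $\mathcal{D}\mathrm{R}_x(0_x)=\mathrm{id}_{T_x\mathcal{M}}$. Given a retraction $\mathrm{R}$, set $\bar{\mathrm{R}}_w(\xi)=(\mathrm{R}_x(\xi_x),y+\xi_y,z+\xi_z,s+\xi_s)$. Prototype algorithm. Input: $w_0=(x_0,y_0,z_0,s_0)\in\mathcal{N}$ with $(z_0,s_0)>0$, a retraction $\mathrm{R}$ on $\mathcal{M}$, $\hat\gamma\in(0,1)$, $\mu_0>0$. For $k=0,1,2,\dots$, while a stopping criterion is not satisfied: 1. obtain $\Delta w_k=(\Delta x_k,\Delta y_k,\Delta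 z_k,\Delta s_k)\in T_{w_k}\mathcal{N}$ by solving $\nabla F(w_k)[\Delta w_k]=-F(w_k)+\mu_k\hat e$; 2. choose $\gamma_k\in[\hat\gamma,1]$ and set $$\alpha_k=\min\Big\{1,\ \gamma_k\min_i\Big\{-\tfrac{(s_k)_i}{(\Delta s_k)_i}: (\Delta s_k)_i<0\Big\},\ \gamma_k\min_i\Big\{-\tfrac{(z_k)_i}{(\Delta z_k)_i}:(\Delta z_k)_i<0\Big\}\Big\};$$ 3. set $w_{k+1}=\bar{\mathrm{R}}_{w_k}(\alpha_k\Delta w_k)$; 4. choose $0<\mu_{k+1}<\mu_k$. Notation. For nonnegative sequences $\{u_k\},\{v_k\}$: $u_k=O(v_k)$ means there is a constant $M>0$ with $u_k\le Mv_k$ for all sufficiently large $k$; $u_k=o(v_k)$ means $v_k>0$ and $u_k/v_k\to0$. Superlinear convergence means $w_k\to w^*$ and $\operatorname{dist}(w_{k+1},w^* )/\operatorname{dist}(w_k,w^* )\to0$; quadratic convergence means $w_k\to w^*$ and $\operatorname{dist}(w_{k+1},w^* )=O(\operatorname{dist}(w_k,w^* )^2)$.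
   Formalization: The choice of μ_k is read uniformly: σ_k→0 with μ_k≤σ_k‖F(w_k)‖, resp. C with μ_k≤C‖F(w_k)‖², for all k, is fixed before δ. With o and O only for large k, μ_0 is unrestricted and the claim fails. Also l,m≥1, and (A2) is independence of the family of gradients. *)

theory Defs
  imports "HOL-Analysis.Analysis"
begin

section \<open>Smooth functions on open subsets of Euclidean spaces\<close>

text \<open>Continuous differentiability of order \<open>n\<close> on an open set, by iterated directional
  derivatives.\<close>

primrec C_k_on ::
  "nat \<Rightarrow> 'e::euclidean_space set \<Rightarrow> ('e \<Rightarrow> 'f::real_normed_vector) \<Rightarrow> bool" where
  "C_k_on 0 S f \<longleftrightarrow> continuous_on S f"
| "C_k_on (Suc n) S f \<longleftrightarrow>
     (\<forall>x\<in>S. f differentiable (at x)) \<and>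
     (\<forall>v. C_k_on n S (\<lambda>x. frechet_derivative f (at x) v))"

definition smooth_on :: "'e::euclidean_space set \<Rightarrow> ('e \<Rightarrow> 'f::real_normed_vector) \<Rightarrow> bool" where
  "smooth_on S f \<longleftrightarrow> (\<forall>n. C_k_on n S f)"

section \<open>Manifolds\<close>

text \<open>A manifold is a set of points covered by an atlas. A chart is a pair \<open>(U, \<phi>)\<close>; only the values
  of \<open>\<phi>\<close> on \<open>U\<close> matter. The dimension is \<open>DIM('e)\<close>.

  The field \<open>chart_at\<close> selects for each point \<open>x\<close> one chart of the atlas around \<open>x\<close>. It serves only to
  represent tangent vectors: the tangent space at \<open>x\<close> is the type \<open>'e\<close>, the vector \<open>v\<close> standing for
  the tangent vector whose components in the chart \<open>chart_at M x\<close> are \<open>v\<close>. A vector field is hence a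
  function \<open>'a \<Rightarrow> 'e\<close>. Components in any other chart are given by \<open>tcoord\<close> below.

  The bilinear form \<open>rmetric M x\<close> is the Riemannian metric on the tangent space at \<open>x\<close>.\<close>

type_synonym ('a, 'e) chart = "'a set \<times> ('a \<Rightarrow> 'e)"

record ('a, 'e) rmanifold =
  charts :: "('a, 'e) chart set"
  chart_at :: "'a \<Rightarrow> ('a, 'e) chart"
  rmetric :: "'a \<Rightarrow> 'e \<Rightarrow> 'e \<Rightarrow> real"

definition chart_inv :: "('a, 'e) chart \<Rightarrow> 'e \<Rightarrow> 'a" where
  "chart_inv c = inv_into (fst c) (snd c)"

definition atlas_carrier :: "('a, 'e) chart set \<Rightarrow> 'a set" where
  "atlas_carrier A = \<Union> (fst ` A)"

definition atlas_topology :: "('a, 'e::euclidean_space) chart set \<Rightarrow> 'a topology" where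
  "atlas_topology A =
     topology (\<lambda>W. W \<subseteq> atlas_carrier A \<and> (\<forall>(U, \<phi>)\<in>A. open (\<phi> ` (W \<inter> U))))"

lemma openin_atlas_topology:
  assumes "\<And>U \<phi>. (U, \<phi>) \<in> A \<Longrightarrow> inj_on \<phi> U"
  shows "openin (atlas_topology A) W \<longleftrightarrow>
    W \<subseteq> atlas_carrier A \<and> (\<forall>(U, \<phi>)\<in>A. open (\<phi> ` (W \<inter> U)))"
proof -
  have "istopology (\<lambda>W. W \<subseteq> atlas_carrier A \<and> (\<forall>(U, \<phi>)\<in>A. open (\<phi> ` (W \<inter> U))))"
    unfolding istopology_def
  proof (intro conjI allI impI)
    fix S T :: "'a set"
    assume S: "S \<subseteq> atlas_carrier A \<and> (\<forall>(U, \<phi>)\<in>A. open (\<phi> ` (S \<inter> U)))"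
      and T: "T \<subseteq> atlas_carrier A \<and> (\<forall>(U, \<phi>)\<in>A. open (\<phi> ` (T \<inter> U)))"
    show "S \<inter> T \<subseteq> atlas_carrier A" using S by blast
    show "\<forall>(U, \<phi>)\<in>A. open (\<phi> ` (S \<inter> T \<inter> U))"
    proof (clarify)
      fix U \<phi> assume c: "(U, \<phi>) \<in> A"
      have "\<phi> ` (S \<inter> T \<inter> U) = \<phi> ` (S \<inter> U) \<inter> \<phi> ` (T \<inter> U)"
        using assms[OF c] by (auto simp: inj_on_def)
      then show "open (\<phi> ` (S \<inter> T \<inter> U))" using S T c by auto
    qed
  next
    fix K :: "'a set set"
    assume K: "\<forall>S\<in>K. S \<subseteq> atlas_carrier A \<and> (\<forall>(U, \<phi>)\<in>A. open (\<phi> ` (S \<inter> U)))"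
    show "\<Union> K \<subseteq> atlas_carrier A" using K by blast
    show "\<forall>(U, \<phi>)\<in>A. open (\<phi> ` (\<Union> K \<inter> U))"
    proof (clarify)
      fix U \<phi> assume c: "(U, \<phi>) \<in> A"
      have "\<phi> ` (\<Union> K \<inter> U) = (\<Union>S\<in>K. \<phi> ` (S \<inter> U))" by auto
      then show "open (\<phi> ` (\<Union> K \<inter> U))" using K c by (auto intro!: open_UN)
    qed
  qed
  then show ?thesis by (simp add: atlas_topology_def topology_inverse')
qed

definition smooth_atlas :: "('a, 'e::euclidean_space) chart set \<Rightarrow> bool" where
  "smooth_atlas A \<longleftrightarrow>
     (\<forall>(U, \<phi>)\<in>A. inj_on \<phi> U \<and> open (\<phi> ` U)) \<and>
     (\<forall>(U, \<phi>)\<in>A. \<forall>(V, \<psi>)\<in>A.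
        open (\<phi> ` (U \<inter> V)) \<and> smooth_on (\<phi> ` (U \<inter> V)) (\<psi> \<circ> chart_inv (U, \<phi>))) \<and>
     Hausdorff_space (atlas_topology A) \<and> second_countable (atlas_topology A)"

definition smooth_map ::
  "('a, 'e::euclidean_space) chart set \<Rightarrow> ('b, 'f::euclidean_space) chart set \<Rightarrow> ('a \<Rightarrow> 'b) \<Rightarrow> bool" where
  "smooth_map A B F \<longleftrightarrow>
     F \<in> atlas_carrier A \<rightarrow> atlas_carrier B \<and>
     (\<forall>(U, \<phi>)\<in>A. \<forall>(V, \<psi>)\<in>B.
        open (\<phi> ` (U \<inter> F -` V)) \<and>
        smooth_on (\<phi> ` (U \<inter> F -` V)) (\<psi> \<circ> F \<circ> chart_inv (U, \<phi>)))"

abbreviation points :: "('a, 'e) rmanifold \<Rightarrow> 'a set" where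
  "points M \<equiv> atlas_carrier (charts M)"

abbreviation manifold_topology :: "('a, 'e::euclidean_space) rmanifold \<Rightarrow> 'a topology" where
  "manifold_topology M \<equiv> atlas_topology (charts M)"

subsection \<open>Tangent vectors\<close>

text \<open>\<open>tcoord M c x v\<close> are the components in the chart \<open>c\<close> of the tangent vector \<open>v\<close> at \<open>x\<close>;
  \<open>tvec M c x u\<close> is the tangent vector at \<open>x\<close> with components \<open>u\<close> in the chart \<open>c\<close>.\<close>

definition tcoord ::
  "('a, 'e::euclidean_space) rmanifold \<Rightarrow> ('a, 'e) chart \<Rightarrow> 'a \<Rightarrow> 'e \<Rightarrow> 'e" where
  "tcoord M c x v =
     frechet_derivative (snd c \<circ> chart_inv (chart_at M x)) (at (snd (chart_at M x) x)) v"

definition tvec ::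
  "('a, 'e::euclidean_space) rmanifold \<Rightarrow> ('a, 'e) chart \<Rightarrow> 'a \<Rightarrow> 'e \<Rightarrow> 'e" where
  "tvec M c x u = frechet_derivative (snd (chart_at M x) \<circ> chart_inv c) (at (snd c x)) u"

definition tangent_charts ::
  "('a, 'e::euclidean_space) rmanifold \<Rightarrow> ('a \<times> 'e, 'e \<times> 'e) chart set" where
  "tangent_charts M =
     (\<lambda>(U, \<phi>). (U \<times> UNIV, \<lambda>(x, v). (\<phi> x, tcoord M (U, \<phi>) x v))) ` charts M"

definition smooth_fun_on ::
  "('a, 'e::euclidean_space) rmanifold \<Rightarrow> 'a set \<Rightarrow> ('a \<Rightarrow> 'f::real_normed_vector) \<Rightarrow> bool" where
  "smooth_fun_on M W f \<longleftrightarrow>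
     (\<forall>(U, \<phi>)\<in>charts M. smooth_on (\<phi> ` (W \<inter> U)) (f \<circ> chart_inv (U, \<phi>)))"

definition smooth_field_on ::
  "('a, 'e::euclidean_space) rmanifold \<Rightarrow> 'a set \<Rightarrow> ('a \<Rightarrow> 'e) \<Rightarrow> bool" where
  "smooth_field_on M W X \<longleftrightarrow>
     (\<forall>(U, \<phi>)\<in>charts M.
        smooth_on (\<phi> ` (W \<inter> U))
          (\<lambda>p. let x = chart_inv (U, \<phi>) p in tcoord M (U, \<phi>) x (X x)))"

text \<open>Differential of \<open>f\<close> at \<open>x\<close>, applied to the tangent vector \<open>v\<close>.\<close>

definition differential ::
  "('a, 'e::euclidean_space) rmanifold \<Rightarrow> ('a \<Rightarrow> 'f::real_normed_vector) \<Rightarrow> 'a \<Rightarrow> 'e \<Rightarrow> 'f" where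
  "differential M f x v =
     frechet_derivative (f \<circ> chart_inv (chart_at M x)) (at (snd (chart_at M x) x)) v"

subsection \<open>Riemannian manifolds\<close>

definition riemannian_manifold :: "('a, 'e::euclidean_space) rmanifold \<Rightarrow> bool" where
  "riemannian_manifold M \<longleftrightarrow>
     smooth_atlas (charts M) \<and>
     (\<forall>x\<in>points M. chart_at M x \<in> charts M \<and> x \<in> fst (chart_at M x)) \<and>
     (\<forall>x\<in>points M.
        bilinear (rmetric M x) \<and>
        (\<forall>u v. rmetric M x u v = rmetric M x v u) \<and>
        (\<forall>v. v \<noteq> 0 \<longrightarrow> 0 < rmetric M x v v)) \<and>
     (\<forall>(U, \<phi>)\<in>charts M. \<forall>u v.
        smooth_on (\<phi> ` U)
          (\<lambda>p. let x = chart_inv (U, \<phi>) p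
                in rmetric M x (tvec M (U, \<phi>) x u) (tvec M (U, \<phi>) x v)))"

definition tnorm :: "('a, 'e) rmanifold \<Rightarrow> 'a \<Rightarrow> 'e \<Rightarrow> real" where
  "tnorm M x v = sqrt (rmetric M x v v)"

text \<open>The product of a Riemannian manifold with a Euclidean space, with the product metric.\<close>

definition times_euclidean ::
  "('a, 'e::euclidean_space) rmanifold \<Rightarrow> ('a \<times> 'v::euclidean_space, 'e \<times> 'v) rmanifold" where
  "times_euclidean M =
     \<lparr> charts = (\<lambda>(U, \<phi>). (U \<times> UNIV, map_prod \<phi> id)) ` charts M,
       chart_at = (\<lambda>(x, _). (fst (chart_at M x) \<times> UNIV, map_prod (snd (chart_at M x)) id)),
       rmetric = (\<lambda>(x, _) (\<xi>, a) (\<eta>, b). rmetric M x \<xi> \<eta> + a \<bullet> b) \<rparr>"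

subsection \<open>Riemannian distance\<close>

definition C1_segment ::
  "('a, 'e::euclidean_space) rmanifold \<Rightarrow> (real \<Rightarrow> 'a) \<Rightarrow> real \<Rightarrow> real \<Rightarrow> bool" where
  "C1_segment M c a b \<longleftrightarrow>
     continuous_map (top_of_set {a..b}) (manifold_topology M) c \<and>
     (\<forall>(U, \<phi>)\<in>charts M. \<exists>D.
        (\<forall>t\<in>{a..b}. c t \<in> U \<longrightarrow> ((\<phi> \<circ> c) has_vector_derivative D t) (at t within {a..b})) \<and>
        continuous_on {t\<in>{a..b}. c t \<in> U} D)"

text \<open>Piecewise continuously differentiable curves on \<open>{0..1}\<close>; \<open>P\<close> is the set of break points.\<close>

definition piecewise_C1_curve ::
  "('a, 'e::euclidean_space) rmanifold \<Rightarrow> (real \<Rightarrow> 'a) \<Rightarrow> bool" where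
  "piecewise_C1_curve M c \<longleftrightarrow>
     (\<exists>P. finite P \<and> {0, 1} \<subseteq> P \<and> P \<subseteq> {0..1} \<and>
        (\<forall>a\<in>P. \<forall>b\<in>P. a < b \<and> P \<inter> {a<..<b} = {} \<longrightarrow> C1_segment M c a b))"

text \<open>The velocity is taken in the chart \<open>chart_at M (c t)\<close>, so it is an element of the tangent space
  at \<open>c t\<close>; its values at the finitely many break points do not affect the length.\<close>

definition velocity :: "('a, 'e::euclidean_space) rmanifold \<Rightarrow> (real \<Rightarrow> 'a) \<Rightarrow> real \<Rightarrow> 'e" where
  "velocity M c t = vector_derivative (snd (chart_at M (c t)) \<circ> c) (at t)"

definition curve_length :: "('a, 'e::euclidean_space) rmanifold \<Rightarrow> (real \<Rightarrow> 'a) \<Rightarrow> real" where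
  "curve_length M c = integral {0..1} (\<lambda>t. tnorm M (c t) (velocity M c t))"

definition riemannian_dist :: "('a, 'e::euclidean_space) rmanifold \<Rightarrow> 'a \<Rightarrow> 'a \<Rightarrow> real" where
  "riemannian_dist M p q =
     Inf (curve_length M ` {c. piecewise_C1_curve M c \<and> c 0 = p \<and> c 1 = q})"

definition complete_manifold :: "('a, 'e::euclidean_space) rmanifold \<Rightarrow> bool" where
  "complete_manifold M \<longleftrightarrow> Metric_space.mcomplete (points M) (riemannian_dist M)"

subsection \<open>Gradient, Levi-Civita connection and Hessian\<close>

definition grad :: "('a, 'e::euclidean_space) rmanifold \<Rightarrow> ('a \<Rightarrow> real) \<Rightarrow> 'a \<Rightarrow> 'e" where
  "grad M f x = (THE v. \<forall>\<xi>. rmetric M x v \<xi> = differential M f x \<xi>)"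

text \<open>\<open>conn x u Y\<close> is the covariant derivative of the vector field \<open>Y\<close> at \<open>x\<close> in the direction \<open>u\<close>.
  The axioms are imposed for vector fields and functions on arbitrary open sets \<open>W\<close>, so \<open>conn\<close> also
  acts on locally defined fields. Covariant derivatives being local, this is the same notion as a
  connection acting on globally defined fields.\<close>

type_synonym ('a, 'e) connection = "'a \<Rightarrow> 'e \<Rightarrow> ('a \<Rightarrow> 'e) \<Rightarrow> 'e"

definition affine_connection ::
  "('a, 'e::euclidean_space) rmanifold \<Rightarrow> ('a, 'e) connection \<Rightarrow> bool" where
  "affine_connection M conn \<longleftrightarrow>
     (\<forall>W. openin (manifold_topology M) W \<longrightarrow>
       (\<forall>X Y. smooth_field_on M W X \<and> smooth_field_on M W Y \<longrightarrow>
          smooth_field_on M W (\<lambda>x. conn x (X x) Y)) \<and>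
       (\<forall>Y. smooth_field_on M W Y \<longrightarrow> (\<forall>x\<in>W. linear (\<lambda>u. conn x u Y))) \<and>
       (\<forall>Y Z. smooth_field_on M W Y \<and> smooth_field_on M W Z \<longrightarrow>
          (\<forall>x\<in>W. \<forall>u a b. conn x u (\<lambda>p. a *\<^sub>R Y p + b *\<^sub>R Z p) = a *\<^sub>R conn x u Y + b *\<^sub>R conn x u Z)) \<and>
       (\<forall>\<phi> Y. smooth_fun_on M W \<phi> \<and> smooth_field_on M W Y \<longrightarrow>
          (\<forall>x\<in>W. \<forall>u. conn x u (\<lambda>p. \<phi> p *\<^sub>R Y p) =
             differential M \<phi> x u *\<^sub>R Y x + \<phi> x *\<^sub>R conn x u Y)))"

text \<open>Besides the affine connection axioms: vanishing torsion, where the Lie bracket acts on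
  functions by \<open>[X, Y] \<phi> = X (Y \<phi>) - Y (X \<phi>)\<close>, and compatibility with the metric.\<close>

definition levi_civita ::
  "('a, 'e::euclidean_space) rmanifold \<Rightarrow> ('a, 'e) connection \<Rightarrow> bool" where
  "levi_civita M conn \<longleftrightarrow>
     affine_connection M conn \<and>
     (\<forall>W. openin (manifold_topology M) W \<longrightarrow>
       (\<forall>X Y (\<phi> :: 'a \<Rightarrow> real). smooth_field_on M W X \<and> smooth_field_on M W Y \<and> smooth_fun_on M W \<phi> \<longrightarrow>
          (\<forall>x\<in>W. differential M \<phi> x (conn x (X x) Y - conn x (Y x) X) =
             differential M (\<lambda>p. differential M \<phi> p (Y p)) x (X x) -
             differential M (\<lambda>p. differential M \<phi> p (X p)) x (Y x))) \<and>
       (\<forall>Y Z. smooth_field_on M W Y \<and> smooth_field_on M W Z \<longrightarrow>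
          (\<forall>x\<in>W. \<forall>u. differential M (\<lambda>p. rmetric M p (Y p) (Z p)) x u =
             rmetric M x (conn x u Y) (Z x) + rmetric M x (Y x) (conn x u Z))))"

definition hess ::
  "('a, 'e::euclidean_space) rmanifold \<Rightarrow> ('a, 'e) connection \<Rightarrow> ('a \<Rightarrow> real) \<Rightarrow> 'a \<Rightarrow> 'e \<Rightarrow> 'e" where
  "hess M conn f x \<xi> = conn x \<xi> (grad M f)"

subsection \<open>Retractions\<close>

text \<open>\<open>R x v\<close> is the retraction applied to the tangent vector \<open>v\<close> at \<open>x\<close>. In the chart \<open>chart_at M x\<close>
  the condition on the differential at \<open>0\<close> literally says that the derivative is the identity.\<close>

definition manifold_retraction ::
  "('a, 'e::euclidean_space) rmanifold \<Rightarrow> ('a \<Rightarrow> 'e \<Rightarrow> 'a) \<Rightarrow> bool" where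
  "manifold_retraction M R \<longleftrightarrow>
     smooth_map (tangent_charts M) (charts M) (\<lambda>(x, v). R x v) \<and>
     (\<forall>x\<in>points M. R x 0 = x \<and>
        ((\<lambda>v. snd (chart_at M x) (R x v)) has_derivative id) (at 0))"

section \<open>The constrained problem and its KKT vector field\<close>

type_synonym ('a, 'l, 'm) kkt_point = "'a \<times> (real ^ 'l) \<times> (real ^ 'm) \<times> (real ^ 'm)"

definition lagrangian ::
  "('a \<Rightarrow> real) \<Rightarrow> ('a \<Rightarrow> real ^ 'l) \<Rightarrow> ('a \<Rightarrow> real ^ 'm) \<Rightarrow> real ^ 'l \<Rightarrow> real ^ 'm \<Rightarrow> 'a \<Rightarrow> real" where
  "lagrangian f h g y z x = f x + (\<Sum>i\<in>UNIV. y $ i * h x $ i) + (\<Sum>i\<in>UNIV. z $ i * g x $ i)"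

definition kkt_manifold ::
  "('a, 'e::euclidean_space) rmanifold \<Rightarrow>
     (('a, 'l::finite, 'm::finite) kkt_point, ('e, 'l::finite, 'm::finite) kkt_point) rmanifold" where
  "kkt_manifold M = times_euclidean M"

definition kkt_field ::
  "('a, 'e::euclidean_space) rmanifold \<Rightarrow> ('a \<Rightarrow> real) \<Rightarrow> ('a \<Rightarrow> real ^ 'l) \<Rightarrow> ('a \<Rightarrow> real ^ 'm) \<Rightarrow>
     ('a, 'l::finite, 'm::finite) kkt_point \<Rightarrow> ('e, 'l::finite, 'm::finite) kkt_point" where
  "kkt_field M f h g = (\<lambda>(x, y, z, s).
     (grad M (lagrangian f h g y z) x, h x, g x + s, \<chi> i. z $ i * s $ i))"

text \<open>\<open>grad_comb M c x\<close> is the operator \<open>v \<mapsto> \<Sum>\<^sub>i v\<^sub>i grad c\<^sub>i(x)\<close> from \<open>real ^ 'n\<close> to the tangent space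
  at \<open>x\<close>, and \<open>tadjoint\<close> the adjoint of such an operator, for the Riemannian metric at \<open>x\<close>.\<close>

definition grad_comb ::
  "('a, 'e::euclidean_space) rmanifold \<Rightarrow> ('a \<Rightarrow> real ^ 'n) \<Rightarrow> 'a \<Rightarrow> real ^ 'n \<Rightarrow> 'e" where
  "grad_comb M c x v = (\<Sum>i\<in>UNIV. v $ i *\<^sub>R grad M (\<lambda>p. c p $ i) x)"

definition tadjoint ::
  "('a, 'e::euclidean_space) rmanifold \<Rightarrow> 'a \<Rightarrow> (real ^ 'n \<Rightarrow> 'e) \<Rightarrow> 'e \<Rightarrow> real ^ 'n" where
  "tadjoint M x T \<xi> = (THE u. \<forall>v. v \<bullet> u = rmetric M x (T v) \<xi>)"

definition kkt_deriv ::
  "('a, 'e::euclidean_space) rmanifold \<Rightarrow> ('a, 'e) connection \<Rightarrow>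
     ('a \<Rightarrow> real) \<Rightarrow> ('a \<Rightarrow> real ^ 'l) \<Rightarrow> ('a \<Rightarrow> real ^ 'm) \<Rightarrow>
     ('a, 'l::finite, 'm::finite) kkt_point \<Rightarrow> ('e, 'l::finite, 'm::finite) kkt_point \<Rightarrow> ('e, 'l::finite, 'm::finite) kkt_point" where
  "kkt_deriv M conn f h g = (\<lambda>(x, y, z, s) (dx, dy, dz, ds).
     (hess M conn (lagrangian f h g y z) x dx + grad_comb M h x dy + grad_comb M g x dz,
      tadjoint M x (grad_comb M h x) dx,
      tadjoint M x (grad_comb M g x) dx + ds,
      \<chi> i. z $ i * ds $ i + s $ i * dz $ i))"

definition kkt_norm ::
  "('a, 'e::euclidean_space) rmanifold \<Rightarrow> ('a \<Rightarrow> real) \<Rightarrow> ('a \<Rightarrow> real ^ 'l) \<Rightarrow> ('a \<Rightarrow> real ^ 'm) \<Rightarrow>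
     ('a, 'l::finite, 'm::finite) kkt_point \<Rightarrow> real" where
  "kkt_norm M f h g w = tnorm (kkt_manifold M) w (kkt_field M f h g w)"

definition ehat :: "('e::euclidean_space, 'l::finite, 'm::finite) kkt_point" where
  "ehat = (0, 0, 0, \<chi> i. 1)"

section \<open>Conditions at a solution\<close>

definition kkt_conditions ::
  "('a, 'e::euclidean_space) rmanifold \<Rightarrow> ('a \<Rightarrow> real) \<Rightarrow> ('a \<Rightarrow> real ^ 'l) \<Rightarrow> ('a \<Rightarrow> real ^ 'm) \<Rightarrow>
     ('a, 'l::finite, 'm::finite) kkt_point \<Rightarrow> bool" where
  "kkt_conditions M f h g = (\<lambda>(x, y, z, s).
     grad M (lagrangian f h g y z) x = 0 \<and> h x = 0 \<and>
     (\<forall>i. g x $ i \<le> 0) \<and> (\<forall>i. 0 \<le> z $ i) \<and> (\<forall>i. z $ i * g x $ i = 0) \<and>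
     s = - g x)"

definition active_set :: "('a \<Rightarrow> real ^ 'm) \<Rightarrow> 'a \<Rightarrow> 'm set" where
  "active_set g x = {i. g x $ i = 0}"

text \<open>Linear independence is understood for the family, so coinciding gradients count as dependent.\<close>

definition licq ::
  "('a, 'e::euclidean_space) rmanifold \<Rightarrow> ('a \<Rightarrow> real ^ 'l) \<Rightarrow> ('a \<Rightarrow> real ^ 'm) \<Rightarrow> 'a \<Rightarrow> bool" where
  "licq M h g x \<longleftrightarrow>
     (let I = range Inl \<union> Inr ` active_set g x;
          v = case_sum (\<lambda>i. grad M (\<lambda>p. h p $ i) x) (\<lambda>i. grad M (\<lambda>p. g p $ i) x)
      in inj_on v I \<and> independent (v ` I))"

definition strict_complementarity :: "('a \<Rightarrow> real ^ 'm) \<Rightarrow> ('a, 'l::finite, 'm::finite) kkt_point \<Rightarrow> bool" where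
  "strict_complementarity g = (\<lambda>(x, y, z, s). \<forall>i. g x $ i = 0 \<longrightarrow> 0 < z $ i)"

definition second_order_sufficient ::
  "('a, 'e::euclidean_space) rmanifold \<Rightarrow> ('a, 'e) connection \<Rightarrow>
     ('a \<Rightarrow> real) \<Rightarrow> ('a \<Rightarrow> real ^ 'l) \<Rightarrow> ('a \<Rightarrow> real ^ 'm) \<Rightarrow> ('a, 'l::finite, 'm::finite) kkt_point \<Rightarrow> bool" where
  "second_order_sufficient M conn f h g = (\<lambda>(x, y, z, s).
     \<forall>\<xi>. \<xi> \<noteq> 0 \<and>
       (\<forall>i. rmetric M x \<xi> (grad M (\<lambda>p. h p $ i) x) = 0) \<and>
       (\<forall>i\<in>active_set g x. rmetric M x \<xi> (grad M (\<lambda>p. g p $ i) x) = 0)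
       \<longrightarrow> 0 < rmetric M x (hess M conn (lagrangian f h g y z) x \<xi>) \<xi>)"

section \<open>The interior point algorithm\<close>

definition positive_zs :: "('a, 'l::finite, 'm::finite) kkt_point \<Rightarrow> bool" where
  "positive_zs = (\<lambda>(x, y, z, s). (\<forall>i. 0 < z $ i) \<and> (\<forall>i. 0 < s $ i))"

definition newton_direction ::
  "('a, 'e::euclidean_space) rmanifold \<Rightarrow> ('a, 'e) connection \<Rightarrow>
     ('a \<Rightarrow> real) \<Rightarrow> ('a \<Rightarrow> real ^ 'l) \<Rightarrow> ('a \<Rightarrow> real ^ 'm) \<Rightarrow>
     ('a, 'l::finite, 'm::finite) kkt_point \<Rightarrow> real \<Rightarrow> ('e, 'l::finite, 'm::finite) kkt_point \<Rightarrow> bool" where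
  "newton_direction M conn f h g w \<mu> \<Delta> \<longleftrightarrow>
     kkt_deriv M conn f h g w \<Delta> = - kkt_field M f h g w + \<mu> *\<^sub>R ehat"

text \<open>The factor \<open>\<gamma> > 0\<close> is moved inside the minima; a minimum over an empty index set
  imposes no restriction.\<close>

definition step_size ::
  "('a, 'l::finite, 'm::finite) kkt_point \<Rightarrow> ('e, 'l::finite, 'm::finite) kkt_point \<Rightarrow> real \<Rightarrow> real" where
  "step_size = (\<lambda>(x, y, z, s) (dx, dy, dz, ds) \<gamma>.
     Min ({1} \<union> {\<gamma> * (- s $ i / ds $ i) | i. ds $ i < 0} \<union> {\<gamma> * (- z $ i / dz $ i) | i. dz $ i < 0}))"

definition kkt_retraction ::
  "('a \<Rightarrow> 'e \<Rightarrow> 'a) \<Rightarrow> ('a, 'l::finite, 'm::finite) kkt_point \<Rightarrow> ('e, 'l::finite, 'm::finite) kkt_point \<Rightarrow> ('a, 'l::finite, 'm::finite) kkt_point" where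
  "kkt_retraction R = (\<lambda>(x, y, z, s) (dx, dy, dz, ds). (R x dx, y + dy, z + dz, s + ds))"

text \<open>\<open>rip_steps M conn f h g R \<gamma>\<^sub>0 n w \<mu> \<gamma>\<close>: the iterates \<open>w 0, \<dots>, w n\<close> arise from \<open>n\<close> steps of
  the algorithm with the parameters \<open>\<mu> 0, \<dots>, \<mu> n\<close> and \<open>\<gamma> 0, \<dots>, \<gamma> (n - 1)\<close>, where \<open>\<gamma>\<^sub>0\<close> is the
  lower bound for the latter. The later values of the three sequences are irrelevant.\<close>

definition rip_steps ::
  "('a, 'e::euclidean_space) rmanifold \<Rightarrow> ('a, 'e) connection \<Rightarrow>
     ('a \<Rightarrow> real) \<Rightarrow> ('a \<Rightarrow> real ^ 'l) \<Rightarrow> ('a \<Rightarrow> real ^ 'm) \<Rightarrow> ('a \<Rightarrow> 'e \<Rightarrow> 'a) \<Rightarrow> real \<Rightarrow>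
     nat \<Rightarrow> (nat \<Rightarrow> ('a, 'l::finite, 'm::finite) kkt_point) \<Rightarrow> (nat \<Rightarrow> real) \<Rightarrow> (nat \<Rightarrow> real) \<Rightarrow> bool" where
  "rip_steps M conn f h g R \<gamma>\<^sub>0 n w \<mu> \<gamma> \<longleftrightarrow>
     w 0 \<in> points (kkt_manifold M) \<and> positive_zs (w 0) \<and> 0 < \<mu> 0 \<and>
     (\<forall>k<n. \<gamma> k \<in> {\<gamma>\<^sub>0..1} \<and> 0 < \<mu> (Suc k) \<and> \<mu> (Suc k) < \<mu> k \<and>
        (\<exists>\<Delta>. newton_direction M conn f h g (w k) (\<mu> k) \<Delta> \<and>
             w (Suc k) = kkt_retraction R (w k) (step_size (w k) \<Delta> (\<gamma> k) *\<^sub>R \<Delta>)))"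

definition rip_run ::
  "('a, 'e::euclidean_space) rmanifold \<Rightarrow> ('a, 'e) connection \<Rightarrow>
     ('a \<Rightarrow> real) \<Rightarrow> ('a \<Rightarrow> real ^ 'l) \<Rightarrow> ('a \<Rightarrow> real ^ 'm) \<Rightarrow> ('a \<Rightarrow> 'e \<Rightarrow> 'a) \<Rightarrow> real \<Rightarrow>
     (nat \<Rightarrow> ('a, 'l::finite, 'm::finite) kkt_point) \<Rightarrow> (nat \<Rightarrow> real) \<Rightarrow> (nat \<Rightarrow> real) \<Rightarrow> bool" where
  "rip_run M conn f h g R \<gamma>\<^sub>0 w \<mu> \<gamma> \<longleftrightarrow> (\<forall>n. rip_steps M conn f h g R \<gamma>\<^sub>0 n w \<mu> \<gamma>)"

section \<open>Asymptotic notation and rates of convergence\<close>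

definition big_O :: "(nat \<Rightarrow> real) \<Rightarrow> (nat \<Rightarrow> real) \<Rightarrow> bool" where
  "big_O u v \<longleftrightarrow> (\<exists>C>0. \<forall>\<^sub>F k in sequentially. u k \<le> C * v k)"

definition little_o :: "(nat \<Rightarrow> real) \<Rightarrow> (nat \<Rightarrow> real) \<Rightarrow> bool" where
  "little_o u v \<longleftrightarrow> (\<forall>k. 0 < v k) \<and> (\<lambda>k. u k / v k) \<longlonglongrightarrow> 0"

text \<open>For positive \<open>v\<close> the two notions amount to a bound valid for all indices. The convergence
  theorem uses these forms for the barrier parameters: their witnesses \<open>\<sigma>\<close> and \<open>C\<close> are part of the
  parameter choice, hence fixed before the neighbourhood of the solution.\<close>

lemma little_o_iff:
  assumes "\<And>k. 0 \<le> u k"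
  shows "little_o u v \<longleftrightarrow> (\<forall>k. 0 < v k) \<and> (\<exists>\<sigma>. \<sigma> \<longlonglongrightarrow> 0 \<and> (\<forall>k. u k \<le> \<sigma> k * v k))"
proof
  assume "little_o u v"
  then have v: "\<forall>k. 0 < v k" and lim: "(\<lambda>k. u k / v k) \<longlonglongrightarrow> 0"
    by (auto simp: little_o_def)
  have "u k \<le> u k / v k * v k" for k
    using v by (simp add: less_imp_neq[symmetric])
  with v lim show "(\<forall>k. 0 < v k) \<and> (\<exists>\<sigma>. \<sigma> \<longlonglongrightarrow> 0 \<and> (\<forall>k. u k \<le> \<sigma> k * v k))"
    by (metis (mono_tags, lifting))
next
  assume "(\<forall>k. 0 < v k) \<and> (\<exists>\<sigma>. \<sigma> \<longlonglongrightarrow> 0 \<and> (\<forall>k. u k \<le> \<sigma> k * v k))"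
  then obtain \<sigma> where v: "\<forall>k. 0 < v k" and lim: "\<sigma> \<longlonglongrightarrow> 0" and le: "\<forall>k. u k \<le> \<sigma> k * v k"
    by auto
  have "(\<lambda>k. u k / v k) \<longlonglongrightarrow> 0"
  proof (rule tendsto_sandwich[OF _ _ tendsto_const lim])
    show "\<forall>\<^sub>F k in sequentially. 0 \<le> u k / v k"
      using assms v by (simp add: less_imp_le)
    show "\<forall>\<^sub>F k in sequentially. u k / v k \<le> \<sigma> k"
      using le v by (simp add: pos_divide_le_eq)
  qed
  with v show "little_o u v" by (simp add: little_o_def)
qed

lemma big_O_iff:
  assumes "\<And>k. 0 < v k"
  shows "big_O u v \<longleftrightarrow> (\<exists>C>0. \<forall>k. u k \<le> C * v k)"
proof
  assume "big_O u v"
  then obtain C N where C: "C > 0" "\<And>k. k \<ge> N \<Longrightarrow> u k \<le> C * v k"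
    by (auto simp: big_O_def eventually_sequentially)
  define B where "B = C + (\<Sum>k<N. \<bar>u k\<bar> / v k)"
  have nonneg: "0 \<le> (\<Sum>k<N. \<bar>u k\<bar> / v k)"
    using assms by (simp add: sum_nonneg less_imp_le)
  have "u k \<le> B * v k" for k
  proof (cases "k < N")
    case True
    have "\<bar>u k\<bar> / v k \<le> (\<Sum>k<N. \<bar>u k\<bar> / v k)"
      using True assms by (intro member_le_sum) (auto simp: less_imp_le)
    then have "\<bar>u k\<bar> / v k \<le> B" using C by (simp add: B_def)
    then have "\<bar>u k\<bar> \<le> B * v k" using assms by (simp add: pos_divide_le_eq)
    then show ?thesis by linarith
  next
    case False
    then have "u k \<le> C * v k" using C by simp
    also have "\<dots> \<le> B * v k"
      using nonneg assms[of k] by (intro mult_right_mono) (auto simp: B_def)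
    finally show ?thesis .
  qed
  moreover have "B > 0" using C nonneg by (simp add: B_def)
  ultimately show "\<exists>C>0. \<forall>k. u k \<le> C * v k" by blast
qed (auto simp: big_O_def)

definition superlinear_convergence ::
  "('a, 'e::euclidean_space) rmanifold \<Rightarrow> (nat \<Rightarrow> 'a) \<Rightarrow> 'a \<Rightarrow> bool" where
  "superlinear_convergence N w w' \<longleftrightarrow>
     (\<lambda>k. riemannian_dist N (w k) w') \<longlonglongrightarrow> 0 \<and>
     little_o (\<lambda>k. riemannian_dist N (w (Suc k)) w') (\<lambda>k. riemannian_dist N (w k) w')"

definition quadratic_convergence ::
  "('a, 'e::euclidean_space) rmanifold \<Rightarrow> (nat \<Rightarrow> 'a) \<Rightarrow> 'a \<Rightarrow> bool" where
  "quadratic_convergence N w w' \<longleftrightarrow>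
     (\<lambda>k. riemannian_dist N (w k) w') \<longlonglongrightarrow> 0 \<and>
     big_O (\<lambda>k. riemannian_dist N (w (Suc k)) w') (\<lambda>k. (riemannian_dist N (w k) w')\<^sup>2)"

end

theory Submission
  imports Defs
begin

text \<open>In a chart around the solution the KKT field becomes a \<open>C\<^sup>2\<close> map \<open>F\<close> between Euclidean spaces, and
  the covariant derivative differs from the derivative of \<open>F\<close> by a Christoffel term that is linear in
  the gradient component of \<open>F\<close>, hence \<open>O(\<parallel>F\<parallel>)\<close>. At the solution this term vanishes and the
  assumptions make the derivative injective. With \<open>e\<close> the coordinate error of \<open>w\<close>, Newton directions
  \<open>\<Delta>\<close> near the solution therefore exist, are unique and satisfy \<open>\<Delta> = - e + O(\<parallel>e\<parallel>\<^sup>2 + \<mu>)\<close>. Strict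
  complementarity gives \<open>1 - \<alpha> \<le> 1 - \<gamma> + O(\<parallel>\<Delta>\<parallel>)\<close> for the step size \<open>\<alpha>\<close>, and a retraction agrees
  with addition to second order, so that
  \<open>\<parallel>e\<^sub>k\<^sub>+\<^sub>1\<parallel> \<le> (1 - \<gamma>\<^sub>k) \<parallel>e\<^sub>k\<parallel> + K (\<parallel>e\<^sub>k\<parallel>\<^sup>2 + \<mu>\<^sub>k)\<close>.
  The error may grow by a bounded factor in the finitely many steps in which \<open>\<mu>\<^sub>k / \<parallel>F\<parallel>\<close> is not yet
  small, which the choice of \<open>\<delta>\<close> absorbs; afterwards it contracts, and both rates can be read off,
  because near the solution the Riemannian distance is comparable to the coordinate norm.\<close>

section \<open>Calculus of smooth functions\<close>

text \<open>The definitions are pointwise and global where the analysis is local. Components of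
  tangent vectors refer to \<open>chart_at M x\<close>, which may change arbitrarily from point to
  point, so raw components need not vary continuously with the point; every object is first
  rewritten in one fixed chart around the solution. Gradients are given by a definite description;
  their smoothness comes from the linear system that the metric imposes on their components. The
  Riemannian distance is an infimum over all curves, including those that leave the chart, so its
  lower bound rests on the last entry of a curve into a chart ball. Finally, the neighbourhood has
  to be fixed before the run, while the KKT norm is bounded by the error only near the solution; the
  bound on \<mu> therefore enters the induction along a run conditionally on the iterate being
  near.\<close>

lemma frechet_derivative_eqI: "(f has_derivative f') (at x) \<Longrightarrow> frechet_derivative f (at x) = f'"
  using frechet_derivative_at by metis

lemma differentiable_has_frechet_derivative: "f differentiable (at x) \<Longrightarrow> (f has_derivative frechet_derivative f (at x)) (at x)"
  using frechet_derivative_works by blast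

lemma has_derivative_cong_open:
  assumes "open S" "x \<in> S" "\<And>y. y \<in> S \<Longrightarrow> f y = g y"
  shows "(f has_derivative D) (at x) \<longleftrightarrow> (g has_derivative D) (at x)"
  using has_derivative_transform_within_open[OF _ assms(1,2), of f D UNIV g]
    has_derivative_transform_within_open[OF _ assms(1,2), of g D UNIV f] assms(3) by auto

lemma frechet_derivative_cong_open:
  assumes "open S" "x \<in> S" "\<And>y. y \<in> S \<Longrightarrow> f y = g y"
  shows "frechet_derivative f (at x) = frechet_derivative g (at x)"
  unfolding frechet_derivative_def using has_derivative_cong_open[OF assms] by simp

lemma differentiable_cong_open:
  assumes "open S" "x \<in> S" "\<And>y. y \<in> S \<Longrightarrow> f y = g y"
  shows "f differentiable (at x) \<longleftrightarrow> g differentiable (at x)"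
  unfolding differentiable_def using has_derivative_cong_open[OF assms] by simp

section \<open>Closure properties of continuously differentiable functions\<close>

text \<open>A derivative at a point of an open set sees only nearby values, so the behaviour off the
  set is irrelevant. This matters because chart representations are arbitrary off the chart
  image.\<close>

lemma C_k_on_cong:
  assumes "open S" "\<And>x. x \<in> S \<Longrightarrow> f x = g x"
  shows "C_k_on n S f \<longleftrightarrow> C_k_on n S g"
  using assms(2)
proof (induction n arbitrary: f g)
  case 0
  then show ?case by (simp cong: continuous_on_cong)
next
  case (Suc n)
  have "frechet_derivative f (at x) v = frechet_derivative g (at x) v" if "x \<in> S" for x v
    using frechet_derivative_cong_open[OF assms(1) that Suc.prems] by simp
  then have "C_k_on n S (\<lambda>x. frechet_derivative f (at x) v) \<longleftrightarrow>
      C_k_on n S (\<lambda>x. frechet_derivative g (at x) v)" for v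
    by (rule Suc.IH)
  then show ?case
    using differentiable_cong_open[OF assms(1) _ Suc.prems] by auto
qed

lemma C_k_on_subset: "C_k_on n S f \<Longrightarrow> T \<subseteq> S \<Longrightarrow> C_k_on n T f"
  by (induction n arbitrary: f) (auto intro: continuous_on_subset)

lemma C_k_on_continuous: "C_k_on n S f \<Longrightarrow> continuous_on S f"
  by (cases n) (auto intro!: continuous_at_imp_continuous_on differentiable_imp_continuous_within)

lemma C_k_on_Suc_D: "C_k_on (Suc n) S f \<Longrightarrow> C_k_on n S f"
proof (induction n arbitrary: f)
  case 0
  then show ?case using C_k_on_continuous[of 1] by simp
next
  case (Suc n)
  then show ?case by (metis C_k_on.simps(2))
qed

lemma C_k_on_mono: "C_k_on n S f \<Longrightarrow> m \<le> n \<Longrightarrow> C_k_on m S f"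
  by (induction n) (auto simp: le_Suc_eq intro: C_k_on_Suc_D simp del: C_k_on.simps)

lemma C_k_on_has_derivative:
  "C_k_on (Suc n) S f \<Longrightarrow> x \<in> S \<Longrightarrow> (f has_derivative frechet_derivative f (at x)) (at x)"
  by (simp add: differentiable_has_frechet_derivative)

lemma C_k_on_derivative: "C_k_on (Suc n) S f \<Longrightarrow> C_k_on n S (\<lambda>x. frechet_derivative f (at x) v)"
  by simp

text \<open>\<open>C_k_on\<close> refers to \<open>frechet_derivative\<close>, a choice operator;
  this rule accepts any explicit formula for the derivative, and the closure rules below rest on
  it.\<close>

lemma C_k_on_Suc_I:
  assumes "open S" "\<And>x. x \<in> S \<Longrightarrow> (f has_derivative f' x) (at x)"
    and "\<And>v. C_k_on n S (\<lambda>x. f' x v)"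
  shows "C_k_on (Suc n) S f"
proof -
  have "frechet_derivative f (at x) = f' x" if "x \<in> S" for x
    using assms(2)[OF that] by (rule frechet_derivative_eqI)
  then have "C_k_on n S (\<lambda>x. frechet_derivative f (at x) v)" for v
    using assms(3) C_k_on_cong[OF assms(1), of "\<lambda>x. frechet_derivative f (at x) v" "\<lambda>x. f' x v"]
    by simp
  then show ?thesis using assms(2) by (auto simp: differentiable_def)
qed

lemma C_k_on_const: "C_k_on n S (\<lambda>x. c)"
  by (induction n arbitrary: c) auto

lemma C_k_on_linear_fun:
  assumes "open S" "bounded_linear L"
  shows "C_k_on n S L"
proof (cases n)
  case 0
  then show ?thesis using linear_continuous_on[OF assms(2)] by simp
next
  case (Suc m)
  have "C_k_on (Suc m) S L"
    using assms(1) bounded_linear_imp_has_derivative[OF assms(2)] C_k_on_const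
    by (rule C_k_on_Suc_I)
  then show ?thesis using Suc by simp
qed

lemma C_k_on_bounded_linear:
  assumes L: "bounded_linear L" and S: "open S" and "C_k_on n S f"
  shows "C_k_on n S (\<lambda>x. L (f x))"
  using assms(3)
proof (induction n arbitrary: f)
  case 0
  then show ?case using bounded_linear.continuous_on[OF L] by simp
next
  case (Suc n)
  show ?case
  proof (rule C_k_on_Suc_I[OF S])
    show "((\<lambda>x. L (f x)) has_derivative (\<lambda>v. L (frechet_derivative f (at x) v))) (at x)"
      if "x \<in> S" for x
      using Suc.prems that differentiable_has_frechet_derivative by (intro bounded_linear.has_derivative[OF L]) auto
    show "C_k_on n S (\<lambda>x. L (frechet_derivative f (at x) v))" for v
      using Suc by simp
  qed
qed

lemma C_k_on_add:
  assumes S: "open S" and "C_k_on n S f" "C_k_on n S g"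
  shows "C_k_on n S (\<lambda>x. f x + g x)"
  using assms(2,3)
proof (induction n arbitrary: f g)
  case 0
  then show ?case by (auto intro: continuous_on_add)
next
  case (Suc n)
  show ?case
  proof (rule C_k_on_Suc_I[OF S])
    show "((\<lambda>x. f x + g x) has_derivative
        (\<lambda>v. frechet_derivative f (at x) v + frechet_derivative g (at x) v)) (at x)"
      if "x \<in> S" for x
      using Suc.prems that by (intro has_derivative_add C_k_on_has_derivative)
    show "C_k_on n S (\<lambda>x. frechet_derivative f (at x) v + frechet_derivative g (at x) v)" for v
      using Suc by simp
  qed
qed

lemma C_k_on_sum:
  assumes "open S" "\<And>i. i \<in> I \<Longrightarrow> C_k_on n S (f i)"
  shows "C_k_on n S (\<lambda>x. \<Sum>i\<in>I. f i x)"
  using assms(2)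
  by (induction I rule: infinite_finite_induct)
     (auto intro!: C_k_on_add C_k_on_const assms(1) simp del: C_k_on.simps)

lemma C_k_on_bilinear:
  assumes B: "bounded_bilinear B" and S: "open S" and "C_k_on n S f" "C_k_on n S g"
  shows "C_k_on n S (\<lambda>x. B (f x) (g x))"
  using assms(3,4)
proof (induction n arbitrary: f g)
  case 0
  then show ?case using bounded_bilinear.continuous_on[OF B] by simp
next
  case (Suc n)
  show ?case
  proof (rule C_k_on_Suc_I[OF S])
    show "((\<lambda>x. B (f x) (g x)) has_derivative
        (\<lambda>v. B (f x) (frechet_derivative g (at x) v) + B (frechet_derivative f (at x) v) (g x))) (at x)"
      if "x \<in> S" for x
      using Suc.prems that by (intro bounded_bilinear.FDERIV[OF B] C_k_on_has_derivative)
    show "C_k_on n S (\<lambda>x. B (f x) (frechet_derivative g (at x) v) +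
        B (frechet_derivative f (at x) v) (g x))" for v
      using Suc.prems C_k_on_Suc_D[OF Suc.prems(1)] C_k_on_Suc_D[OF Suc.prems(2)]
      by (intro C_k_on_add[OF S] Suc.IH) auto
  qed
qed

lemmas C_k_on_scaleR = C_k_on_bilinear[OF bounded_bilinear_scaleR]
lemmas C_k_on_mult = C_k_on_bilinear[OF bounded_bilinear_mult]

lemma C_k_on_diff:
  assumes S: "open S" and "C_k_on n S f" "C_k_on n S g"
  shows "C_k_on n S (\<lambda>x. f x - g x)"
  using C_k_on_add[OF S assms(2) C_k_on_bounded_linear[OF bounded_linear_minus[OF bounded_linear_ident] S assms(3)]]
  by simp

lemma C_k_on_Pair:
  assumes S: "open S" and "C_k_on n S f" "C_k_on n S g"
  shows "C_k_on n S (\<lambda>x. (f x, g x))"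
  using assms(2,3)
proof (induction n arbitrary: f g)
  case 0
  then show ?case by (auto intro: continuous_on_Pair)
next
  case (Suc n)
  show ?case
  proof (rule C_k_on_Suc_I[OF S])
    show "((\<lambda>x. (f x, g x)) has_derivative
        (\<lambda>v. (frechet_derivative f (at x) v, frechet_derivative g (at x) v))) (at x)"
      if "x \<in> S" for x
      using Suc.prems that by (intro has_derivative_Pair C_k_on_has_derivative)
    show "C_k_on n S (\<lambda>x. (frechet_derivative f (at x) v, frechet_derivative g (at x) v))" for v
      using Suc by simp
  qed
qed

lemma C_k_on_compose:
  fixes f :: "'f::euclidean_space \<Rightarrow> 'g::real_normed_vector" and g :: "'e::euclidean_space \<Rightarrow> 'f"
  assumes S: "open S" and T: "open T" and "C_k_on n S g" "C_k_on n T f" "g ` S \<subseteq> T"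
  shows "C_k_on n S (\<lambda>x. f (g x))"
  using assms(3-5)
proof (induction n arbitrary: f)
  case 0
  then show ?case by (auto intro: continuous_on_compose2)
next
  case (Suc n)
  let ?f' = "\<lambda>x. frechet_derivative f (at x)" and ?g' = "\<lambda>x. frechet_derivative g (at x)"
  have gn: "C_k_on n S g" using Suc.prems(1) by (rule C_k_on_Suc_D)
  show ?case
  proof (rule C_k_on_Suc_I[OF S])
    fix x assume x: "x \<in> S"
    have f': "(f has_derivative ?f' (g x)) (at (g x))" using Suc.prems x by (intro differentiable_has_frechet_derivative) auto
    have "(g has_derivative ?g' x) (at x)" using Suc.prems x by (intro differentiable_has_frechet_derivative) auto
    from diff_chain_at[OF this f']
    have "((\<lambda>x. f (g x)) has_derivative (\<lambda>v. ?f' (g x) (?g' x v))) (at x)"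
      by (simp add: o_def)
    \<comment> \<open>The direction \<open>?g' x v\<close> varies with \<open>x\<close>, but
      \<open>C_k_on\<close> controls derivatives in fixed directions only. Expanding in the basis
      leaves fixed directions \<open>b\<close>, with coefficients that are themselves
      \<open>C_k_on n\<close>.\<close>
    moreover have "?f' (g x) (?g' x v) = (\<Sum>b\<in>Basis. (?g' x v \<bullet> b) *\<^sub>R ?f' (g x) b)" for v
    proof -
      interpret linear "?f' (g x)" using f' by (rule has_derivative_linear)
      show ?thesis
        by (subst euclidean_representation[of "?g' x v", symmetric]) (simp add: sum scaleR)
    qed
    ultimately show "((\<lambda>x. f (g x)) has_derivative
        (\<lambda>v. \<Sum>b\<in>Basis. (?g' x v \<bullet> b) *\<^sub>R ?f' (g x) b)) (at x)" by simp
  next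
    fix v
    show "C_k_on n S (\<lambda>x. \<Sum>b\<in>Basis. (?g' x v \<bullet> b) *\<^sub>R ?f' (g x) b)"
    proof (intro C_k_on_sum[OF S] C_k_on_scaleR[OF S])
      fix b :: 'f
      show "C_k_on n S (\<lambda>x. ?g' x v \<bullet> b)"
        using Suc.prems(1) by (intro C_k_on_bounded_linear[OF bounded_linear_inner_left S]) simp
      show "C_k_on n S (\<lambda>x. ?f' (g x) b)"
        using Suc.prems gn by (intro Suc.IH) auto
    qed
  qed
qed

section \<open>Linear systems whose coefficients depend on a point\<close>

lemma linear_comb_Basis:
  fixes T :: "'f::euclidean_space \<Rightarrow> 'g::real_vector"
  assumes "linear T"
  shows "(\<Sum>b\<in>Basis. (w \<bullet> b) *\<^sub>R T b) = T w"
proof -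
  interpret linear T by fact
  show ?thesis
    by (subst (2) euclidean_representation[of w, symmetric]) (simp add: sum scaleR del: euclidean_representation)
qed

text \<open>Injectivity at \<open>x0\<close> gives a lower bound \<open>B\<close>; as long as the
  columns move by less than \<open>B / 2\<close> in total, half of it survives. The bound is uniform
  near \<open>x0\<close>, which is what limits of solutions need.\<close>

lemma linear_system_bounded_below:
  fixes A :: "'f::euclidean_space \<Rightarrow> 'e::t2_space \<Rightarrow> 'g::euclidean_space"
  assumes A: "\<And>b. b \<in> Basis \<Longrightarrow> isCont (A b) x0"
    and inj: "\<And>w. (\<Sum>b\<in>Basis. (w \<bullet> b) *\<^sub>R A b x0) = 0 \<Longrightarrow> w = 0"
  obtains m where "m > 0"
    "\<forall>\<^sub>F x in nhds x0. \<forall>w. m * norm w \<le> norm (\<Sum>b\<in>Basis. (w \<bullet> b) *\<^sub>R A b x)"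
proof -
  define M where "M x w = (\<Sum>b\<in>Basis. (w \<bullet> b) *\<^sub>R A b x)" for x w
  have lin: "linear (M x)" for x
    unfolding M_def by (intro linearI) (simp_all add: inner_add_left scaleR_add_left sum.distrib scaleR_sum_right)
  have "inj (M x0)"
    using inj by (simp add: linear_injective_0[OF lin]) (simp add: M_def)
  with lin obtain B where B: "B > 0" "\<And>w. B * norm w \<le> norm (M x0 w)"
    using linear_inj_bounded_below_pos by blast
  have "((\<lambda>x. \<Sum>b\<in>Basis. norm (A b x - A b x0)) \<longlongrightarrow> (\<Sum>b\<in>Basis. norm (A b x0 - A b x0))) (nhds x0)"
    using A by (intro tendsto_intros) (auto simp: continuous_at tendsto_at_iff_tendsto_nhds)
  then have "\<forall>\<^sub>F x in nhds x0. (\<Sum>b\<in>Basis. norm (A b x - A b x0)) < B / 2"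
    using B by (intro order_tendstoD(2)) auto
  then have "\<forall>\<^sub>F x in nhds x0. \<forall>w. B / 2 * norm w \<le> norm (M x w)"
  proof (rule eventually_mono)
    fix x assume less: "(\<Sum>b\<in>Basis. norm (A b x - A b x0)) < B / 2"
    show "\<forall>w. B / 2 * norm w \<le> norm (M x w)"
    proof
      fix w
      have "M x w - M x0 w = (\<Sum>b\<in>Basis. (w \<bullet> b) *\<^sub>R (A b x - A b x0))"
        by (simp add: M_def sum_subtractf scaleR_diff_right)
      also have "norm \<dots> \<le> (\<Sum>b\<in>Basis. norm w * norm (A b x - A b x0))"
        by (intro sum_norm_le) (auto intro!: mult_right_mono Basis_le_norm)
      also have "\<dots> \<le> norm w * (B / 2)"
        unfolding sum_distrib_left[symmetric] using less by (intro mult_left_mono) auto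
      finally have "norm (M x0 w) - norm (M x w) \<le> norm w * (B / 2)"
        by (smt (verit) norm_triangle_ineq2 norm_minus_commute)
      then show "B / 2 * norm w \<le> norm (M x w)" using B(2)[of w] by (simp add: algebra_simps)
    qed
  qed
  then show ?thesis using that[of "B / 2"] B by (simp add: M_def)
qed

text \<open>Differentiating the system gives a system with the same matrix for the derivative of the
  solution, so smoothness of the data passes to the solution without inverting the matrix.\<close>

lemma C_k_on_linear_system:
  fixes u :: "'e::euclidean_space \<Rightarrow> 'f::euclidean_space" and A :: "'f \<Rightarrow> 'e \<Rightarrow> 'f"
  assumes S: "open S" and A: "\<And>b. b \<in> Basis \<Longrightarrow> C_k_on n S (A b)" and r: "C_k_on n S r"
    and eq: "\<And>x. x \<in> S \<Longrightarrow> (\<Sum>b\<in>Basis. (u x \<bullet> b) *\<^sub>R A b x) = r x"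
    and inj: "\<And>x w. x \<in> S \<Longrightarrow> (\<Sum>b\<in>Basis. (w \<bullet> b) *\<^sub>R A b x) = 0 \<Longrightarrow> w = 0"
  shows "C_k_on n S u"
proof -
  define M where "M x w = (\<Sum>b\<in>Basis. (w \<bullet> b) *\<^sub>R A b x)" for x w
  have lin: "linear (M x)" for x
    unfolding M_def by (intro linearI) (simp_all add: inner_add_left scaleR_add_left sum.distrib scaleR_sum_right)
  have below: "\<exists>m>0. \<forall>\<^sub>F x in nhds x0. \<forall>w. m * norm w \<le> norm (M x w)" if x0: "x0 \<in> S" for x0
  proof -
    have "isCont (A b) x0" if "b \<in> Basis" for b
      using C_k_on_continuous[OF A[OF that]] x0 S by (simp add: continuous_on_eq_continuous_at)
    then show ?thesis
      using linear_system_bounded_below[where A = A, OF _ inj[OF x0]] unfolding M_def by blast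
  qed
  \<comment> \<open>An injective square system is surjective; the right inverse will supply the
    candidate for the derivative of \<open>u\<close>.\<close>
  have surj: "\<exists>Z. linear Z \<and> (\<forall>w. M x (Z w) = w)" if "x \<in> S" for x
  proof -
    have "inj (M x)" using inj[OF that] by (simp add: linear_injective_0[OF lin]) (simp add: M_def)
    then have "surj (M x)" using lin linear_injective_imp_surjective by blast
    then show ?thesis using linear_surjective_right_inverse[OF lin] by (metis comp_apply id_apply)
  qed
  show ?thesis using A r eq unfolding M_def[symmetric]
  proof (induction n arbitrary: u r)
    case 0
    have "(u \<longlongrightarrow> u x0) (at x0)" if x0: "x0 \<in> S" for x0
    proof -
      obtain m where m: "m > 0" "\<forall>\<^sub>F x in nhds x0. \<forall>w. m * norm w \<le> norm (M x w)"
        using below[OF x0] by blast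
      have cA: "isCont (A b) x0" if "b \<in> Basis" for b
        using 0(1)[OF that] x0 S by (simp add: continuous_on_eq_continuous_at)
      have cr: "isCont r x0"
        using 0(2) x0 S by (simp add: continuous_on_eq_continuous_at)
      \<comment> \<open>The function equals \<open>M x (u x - u x0)\<close> on \<open>S\<close>. It
        tends to 0, and the uniform lower bound transfers the limit to \<open>u\<close>.\<close>
      have "((\<lambda>x. r x - M x (u x0)) \<longlongrightarrow> r x0 - M x0 (u x0)) (at x0)"
        unfolding M_def using cA cr by (intro tendsto_intros) (auto simp: continuous_at)
      then have lim: "((\<lambda>x. norm (r x - M x (u x0)) / m) \<longlongrightarrow> 0) (at x0)"
        using 0(3)[OF x0] by (auto intro!: tendsto_divide_zero tendsto_norm_zero)
      have "\<forall>\<^sub>F x in at x0. x \<in> S"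
        using S x0 by (simp add: eventually_at_in_open')
      moreover have "\<forall>\<^sub>F x in at x0. \<forall>w. m * norm w \<le> norm (M x w)"
        using m(2) by (simp add: eventually_nhds_conv_at)
      ultimately have "\<forall>\<^sub>F x in at x0. norm (u x - u x0) \<le> norm (r x - M x (u x0)) / m"
      proof eventually_elim
        case (elim x)
        have "M x (u x - u x0) = r x - M x (u x0)"
          using 0(3)[OF elim(1)] by (simp add: linear_diff[OF lin])
        then have "m * norm (u x - u x0) \<le> norm (r x - M x (u x0))"
          using elim(2) by metis
        then show ?case using m(1) by (simp add: pos_le_divide_eq mult.commute)
      qed
      then have "((\<lambda>x. u x - u x0) \<longlongrightarrow> 0) (at x0)"
        by (rule Lim_null_comparison[OF _ lim])
      then show ?thesis by (simp add: LIM_zero_iff)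
    qed
    then show ?case using S by (simp add: continuous_on_eq_continuous_at continuous_at)
  next
    case (Suc n)
    let ?A' = "\<lambda>b x. frechet_derivative (A b) (at x)" and ?r' = "\<lambda>x. frechet_derivative r (at x)"
    \<comment> \<open>Differentiating \<open>M x (u x) = r x\<close> in direction \<open>v\<close>
      leaves \<open>M x (u' v) = \<rho> x v\<close>.\<close>
    define \<rho> where "\<rho> x v = ?r' x v - (\<Sum>b\<in>Basis. (u x \<bullet> b) *\<^sub>R ?A' b x v)" for x v
    \<comment> \<open>\<open>Z\<close> is a mere pointwise choice. That
      \<open>Z x (\<rho> x v)\<close> is \<open>C_k_on n\<close> comes from the induction
      hypothesis, since it solves the same system.\<close>
    have "\<forall>x\<in>S. \<exists>Z. linear Z \<and> (\<forall>w. M x (Z w) = w)" using surj by blast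
    then obtain Z where "\<forall>x\<in>S. linear (Z x) \<and> (\<forall>w. M x (Z x w) = w)"
      by (rule bchoice[THEN exE])
    then have Z: "\<And>x. x \<in> S \<Longrightarrow> linear (Z x)" "\<And>x w. x \<in> S \<Longrightarrow> M x (Z x w) = w"
      by blast+
    have un: "C_k_on n S u"
      by (rule Suc.IH[OF C_k_on_Suc_D[OF Suc.prems(1)] C_k_on_Suc_D[OF Suc.prems(2)] Suc.prems(3)])
    show ?case
    proof (rule C_k_on_Suc_I[OF S])
      fix x0 assume x0: "x0 \<in> S"
      let ?D = "\<lambda>v. Z x0 (\<rho> x0 v)"
      have dA: "(A b has_derivative ?A' b x0) (at x0)" if "b \<in> Basis" for b
        using Suc.prems(1)[OF that] x0 by (rule C_k_on_has_derivative)
      have dr: "(r has_derivative ?r' x0) (at x0)"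
        using Suc.prems(2) x0 by (rule C_k_on_has_derivative)
      have "bounded_linear (\<rho> x0)"
        unfolding \<rho>_def using dA dr
        by (intro bounded_linear_sub bounded_linear_sum bounded_linear_const_scaleR)
           (auto dest: has_derivative_bounded_linear)
      then have D: "bounded_linear ?D"
        using bounded_linear_compose Z(1)[OF x0] linear_conv_bounded_linear by blast
      \<comment> \<open>Residual of the first-order candidate. It vanishes to first order at
        \<open>x0\<close> and equals \<open>M x\<close> applied to the error of the candidate, so
        the lower bound makes that error \<open>o(norm (x - x0))\<close>.\<close>
      define q where "q x = r x - M x (u x0 + ?D (x - x0))" for x
      have "(q has_derivative (\<lambda>v. ?r' x0 v - (\<Sum>b\<in>Basis. ((u x0 + ?D (x0 - x0)) \<bullet> b) *\<^sub>R ?A' b x0 v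
            + (?D v \<bullet> b) *\<^sub>R A b x0))) (at x0)"
        unfolding q_def M_def
        apply (intro has_derivative_diff dr has_derivative_sum has_derivative_scaleR dA
            has_derivative_inner_left)
         apply (auto intro!: derivative_eq_intros bounded_linear.has_derivative[OF D])
        done
      moreover have "?r' x0 v - (\<Sum>b\<in>Basis. ((u x0 + ?D (x0 - x0)) \<bullet> b) *\<^sub>R ?A' b x0 v
            + (?D v \<bullet> b) *\<^sub>R A b x0) = 0" for v
      proof -
        have "?D (x0 - x0) = 0" using linear_0[OF bounded_linear.linear[OF D]] by simp
        moreover have "(\<Sum>b\<in>Basis. (?D v \<bullet> b) *\<^sub>R A b x0) = \<rho> x0 v"
          using Z(2)[OF x0] by (simp add: M_def)
        ultimately show ?thesis by (simp add: sum.distrib \<rho>_def)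
      qed
      ultimately have q': "(q has_derivative (\<lambda>v. 0)) (at x0)" by simp
      have q0: "q x0 = 0"
        using Suc.prems(3)[OF x0] linear_0[OF bounded_linear.linear[OF D]] by (simp add: q_def)
      obtain m where m: "m > 0" "\<forall>\<^sub>F x in nhds x0. \<forall>w. m * norm w \<le> norm (M x w)"
        using below[OF x0] by blast
      have "\<forall>\<^sub>F x in nhds x0. x \<in> S"
        using S x0 by (simp add: eventually_nhds_in_open)
      then have "\<forall>\<^sub>F x in nhds x0. m * norm (u x - u x0 - ?D (x - x0)) \<le> norm (q x)"
        using m(2)
      proof eventually_elim
        case (elim x)
        have "M x (u x - (u x0 + ?D (x - x0))) = q x"
          using Suc.prems(3)[OF elim(1)] by (simp only: linear_diff[OF lin] q_def)
        then show ?case using elim(2)[rule_format, of "u x - (u x0 + ?D (x - x0))"]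
          by (simp add: algebra_simps)
      qed
      then obtain d1 where d1: "d1 > 0"
        "\<And>x. dist x x0 < d1 \<Longrightarrow> m * norm (u x - u x0 - ?D (x - x0)) \<le> norm (q x)"
        by (auto simp: eventually_nhds_metric)
      show "(u has_derivative ?D) (at x0)"
        unfolding has_derivative_at_alt
      proof (intro conjI allI impI D)
        fix e :: real assume e: "e > 0"
        then have "e * m > 0" using m by simp
        with q' obtain d2 where d2: "d2 > 0"
          "\<And>x. norm (x - x0) < d2 \<Longrightarrow> norm (q x - q x0 - 0) \<le> e * m * norm (x - x0)"
          unfolding has_derivative_at_alt by blast
        show "\<exists>d>0. \<forall>y. norm (y - x0) < d \<longrightarrow> norm (u y - u x0 - ?D (y - x0)) \<le> e * norm (y - x0)"
        proof (intro exI[of _ "min d1 d2"] conjI allI impI)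
          fix y assume "norm (y - x0) < min d1 d2"
          then have "m * norm (u y - u x0 - ?D (y - x0)) \<le> m * (e * norm (y - x0))"
            using d1(2)[of y] d2(2)[of y] q0 by (auto simp: dist_norm mult_ac)
          then show "norm (u y - u x0 - ?D (y - x0)) \<le> e * norm (y - x0)"
            using m(1) by simp
        qed (use d1 d2 in auto)
      qed
    next
      fix v
      have \<rho>n: "C_k_on n S (\<lambda>x. \<rho> x v)"
        unfolding \<rho>_def using Suc.prems un
        by (intro C_k_on_diff[OF S] C_k_on_sum[OF S] C_k_on_scaleR[OF S] C_k_on_derivative
            C_k_on_bounded_linear[OF bounded_linear_inner_left S]) auto
      show "C_k_on n S (\<lambda>x. Z x (\<rho> x v))"
        by (rule Suc.IH[OF C_k_on_Suc_D[OF Suc.prems(1)] \<rho>n Z(2)])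
    qed
  qed
qed

section \<open>Lipschitz and Taylor bounds\<close>

text \<open>On a compact ball the continuous directional derivatives of first and second order are
  bounded. By the mean value theorem \<open>F\<close> and its derivative are Lipschitz there, and a
  Lipschitz derivative gives the quadratic remainder. One constant \<open>L\<close> serves all three
  bounds.\<close>

lemma C2_estimates:
  fixes F :: "'e::euclidean_space \<Rightarrow> 'f::real_normed_vector"
  assumes T: "open T" and F: "C_k_on 2 T F" and w: "w \<in> T"
  obtains r L where "r > 0" "L > 0" "cball w r \<subseteq> T"
    "\<And>x y. x \<in> cball w r \<Longrightarrow> y \<in> cball w r \<Longrightarrow> norm (F y - F x) \<le> L * norm (y - x)"
    "\<And>x y v. x \<in> cball w r \<Longrightarrow> y \<in> cball w r \<Longrightarrow>
        norm (frechet_derivative F (at y) v - frechet_derivative F (at x) v) \<le> L * norm (y - x) * norm v"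
    "\<And>x y. x \<in> cball w r \<Longrightarrow> y \<in> cball w r \<Longrightarrow>
        norm (F y - F x - frechet_derivative F (at x) (y - x)) \<le> L * (norm (y - x))\<^sup>2"
proof -
  obtain r where r: "r > 0" "cball w r \<subseteq> T"
    using T w open_contains_cball by blast
  let ?B = "cball w r"
  let ?F' = "\<lambda>x. frechet_derivative F (at x)"
  have F': "(F has_derivative ?F' x) (at x)" if "x \<in> T" for x
    using F that by (auto simp: numeral_2_eq_2 differentiable_has_frechet_derivative)
  have lin: "linear (?F' x)" if "x \<in> T" for x
    using F'[OF that] by (rule has_derivative_linear)
  have lip: "\<exists>L>0. (\<forall>x\<in>?B. onorm (frechet_derivative G (at x)) \<le> L) \<and>
      (\<forall>x\<in>?B. \<forall>y\<in>?B. norm (G y - G x) \<le> L * norm (y - x))"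
    if G: "C_k_on 1 T G" for G :: "'e \<Rightarrow> 'f"
  proof -
    let ?G' = "\<lambda>x. frechet_derivative G (at x)"
    have G': "(G has_derivative ?G' x) (at x)" if "x \<in> T" for x
      using G that by (simp add: differentiable_has_frechet_derivative)
    have "\<exists>K. \<forall>x\<in>?B. norm (?G' x b) \<le> K" for b
    proof -
      have "continuous_on ?B (\<lambda>x. ?G' x b)"
        using G r by (auto intro: continuous_on_subset)
      then have "bounded ((\<lambda>x. ?G' x b) ` ?B)"
        by (intro compact_imp_bounded compact_continuous_image) auto
      then show ?thesis by (auto simp: bounded_iff)
    qed
    then obtain K where K: "\<And>b x. x \<in> ?B \<Longrightarrow> norm (?G' x b) \<le> K b" by metis
    define L where "L = (\<Sum>b\<in>Basis. \<bar>K b\<bar>) + 1"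
    have L: "L > 0" by (auto simp: L_def intro!: add_nonneg_pos sum_nonneg)
    have "norm (?G' x v) \<le> L * norm v" if x: "x \<in> ?B" for x v
    proof -
      have "norm (?G' x v) = norm (\<Sum>b\<in>Basis. (v \<bullet> b) *\<^sub>R ?G' x b)"
        using linear_comb_Basis[OF has_derivative_linear[OF G'[of x]]] x r by auto
      also have "\<dots> \<le> (\<Sum>b\<in>Basis. norm v * \<bar>K b\<bar>)"
        using K[OF x] by (intro sum_norm_le) (auto intro!: mult_mono Basis_le_norm order_trans[OF _ abs_ge_self])
      also have "\<dots> \<le> L * norm v" by (simp add: sum_distrib_left[symmetric] L_def algebra_simps)
      finally show ?thesis .
    qed
    then have on: "onorm (?G' x) \<le> L" if "x \<in> ?B" for x
      using that by (intro onorm_le) auto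
    moreover have "norm (G y - G x) \<le> L * norm (y - x)" if "x \<in> ?B" "y \<in> ?B" for x y
    proof (rule differentiable_bound[of ?B G ?G'])
      show "(G has_derivative ?G' z) (at z within ?B)" if "z \<in> ?B" for z
        using G' r that by (blast intro: has_derivative_at_withinI)
    qed (use that on in auto)
    ultimately show ?thesis using L by blast
  qed
  obtain L0 where L0: "L0 > 0" "\<And>x y. x \<in> ?B \<Longrightarrow> y \<in> ?B \<Longrightarrow> norm (F y - F x) \<le> L0 * norm (y - x)"
    using lip[of F] C_k_on_mono[OF F, of 1] by auto
  have "\<exists>L>0. \<forall>x\<in>?B. \<forall>y\<in>?B. norm (?F' y b - ?F' x b) \<le> L * norm (y - x)" for b
    using lip[of "\<lambda>x. ?F' x b"] F by (auto simp: numeral_2_eq_2)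
  then obtain K where K: "\<And>b. K b > 0"
    "\<And>b x y. x \<in> ?B \<Longrightarrow> y \<in> ?B \<Longrightarrow> norm (?F' y b - ?F' x b) \<le> K b * norm (y - x)" by metis
  define L where "L = L0 + (\<Sum>b\<in>Basis. K b)"
  have sumK: "(\<Sum>b\<in>(Basis::'e set). K b) \<ge> 0" using K(1) by (intro sum_nonneg) (auto intro: less_imp_le)
  have D: "norm (?F' y v - ?F' x v) \<le> L * norm (y - x) * norm v"
    if "x \<in> ?B" "y \<in> ?B" for x y v
  proof -
    have "linear (\<lambda>v. ?F' y v - ?F' x v)"
      using lin that r by (intro linear_compose_sub) auto
    from linear_comb_Basis[OF this, of v]
    have "norm (?F' y v - ?F' x v) = norm (\<Sum>b\<in>Basis. (v \<bullet> b) *\<^sub>R (?F' y b - ?F' x b))" by simp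
    also have "\<dots> \<le> (\<Sum>b\<in>Basis. norm v * (K b * norm (y - x)))"
      using K(2)[OF that] by (intro sum_norm_le) (auto intro!: mult_mono Basis_le_norm)
    also have "\<dots> = (\<Sum>b\<in>Basis. K b) * (norm (y - x) * norm v)"
      by (simp add: sum_distrib_left sum_distrib_right mult_ac)
    also have "\<dots> \<le> L * (norm (y - x) * norm v)"
      using L0 by (intro mult_right_mono) (auto simp: L_def)
    finally show ?thesis by (simp add: mult.assoc)
  qed
  have Q: "norm (F y - F x - ?F' x (y - x)) \<le> L * (norm (y - x))\<^sup>2" if xy: "x \<in> ?B" "y \<in> ?B" for x y
  proof -
    let ?S = "closed_segment x y"
    have S: "?S \<subseteq> ?B" using xy by (intro closed_segment_subset) auto
    have "norm (F y - F x - ?F' x (y - x)) \<le> norm (y - x) * (L * norm (y - x))"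
    proof (rule differentiable_bound_linearization[of x y ?S])
      show "x + t *\<^sub>R (y - x) \<in> ?S" if "t \<in> {0..1}" for t
        using that by (auto simp: closed_segment_def algebra_simps intro!: exI[of _ t])
      show "(F has_derivative ?F' z) (at z within ?S)" if "z \<in> ?S" for z
        using F' S r that by (blast intro: has_derivative_at_withinI)
      show "onorm (?F' z - ?F' x) \<le> L * norm (y - x)" if z: "z \<in> ?S" for z
      proof (rule onorm_le)
        fix v
        have "norm (?F' z v - ?F' x v) \<le> L * norm (z - x) * norm v" using D xy S z by blast
        also have "\<dots> \<le> L * norm (y - x) * norm v"
          using segment_bound(1)[OF z] L0(1) sumK
          by (intro mult_right_mono mult_left_mono) (auto simp: L_def)
        finally show "norm ((?F' z - ?F' x) v) \<le> L * norm (y - x) * norm v" by simp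
      qed
    qed auto
    then show ?thesis by (simp add: power2_eq_square mult_ac)
  qed
  have "norm (F y - F x) \<le> L * norm (y - x)" if "x \<in> ?B" "y \<in> ?B" for x y
    using L0(2)[OF that] mult_right_mono[OF sumK norm_ge_zero[of "y - x"]]
    by (simp add: L_def distrib_right)
  moreover have "L > 0" using L0 sumK by (simp add: L_def)
  ultimately show thesis using that[of r L] r D Q by blast
qed

section \<open>Charts, tangent vectors and gradients\<close>

lemma smooth_on_C_k: "smooth_on S f \<Longrightarrow> C_k_on n S f"
  by (simp add: smooth_on_def)

lemma smooth_on_differentiable: "smooth_on S f \<Longrightarrow> x \<in> S \<Longrightarrow> f differentiable (at x)"
  using smooth_on_C_k[of S f 1] by simp

text \<open>Unlike \<open>riemannian_manifold\<close>, the locale does not demand second countability, so that the product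
  with a Euclidean space is an instance without further topology.\<close>

locale riemannian =
  fixes M :: "('a, 'e::euclidean_space) rmanifold"
  assumes inj_chart: "c \<in> charts M \<Longrightarrow> inj_on (snd c) (fst c)"
    and open_overlap: "c \<in> charts M \<Longrightarrow> d \<in> charts M \<Longrightarrow> open (snd c ` (fst c \<inter> fst d))"
    and smooth_transition: "c \<in> charts M \<Longrightarrow> d \<in> charts M \<Longrightarrow>
        smooth_on (snd c ` (fst c \<inter> fst d)) (\<lambda>p. snd d (chart_inv c p))"
    and Hausdorff: "Hausdorff_space (manifold_topology M)"
    and chart_at: "x \<in> points M \<Longrightarrow> chart_at M x \<in> charts M" "x \<in> points M \<Longrightarrow> x \<in> fst (chart_at M x)"
    and metric_bilinear: "x \<in> points M \<Longrightarrow> bilinear (rmetric M x)"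
    and metric_sym: "x \<in> points M \<Longrightarrow> rmetric M x u v = rmetric M x v u"
    and metric_pos: "x \<in> points M \<Longrightarrow> v \<noteq> 0 \<Longrightarrow> 0 < rmetric M x v v"
    and smooth_metric: "c \<in> charts M \<Longrightarrow> smooth_on (snd c ` fst c)
        (\<lambda>p. rmetric M (chart_inv c p) (tvec M c (chart_inv c p) u) (tvec M c (chart_inv c p) v))"

lemma riemannian_manifold_imp_riemannian:
  assumes "riemannian_manifold M"
  shows "riemannian M"
proof -
  have A: "smooth_atlas (charts M)"
    and at: "\<forall>x\<in>points M. chart_at M x \<in> charts M \<and> x \<in> fst (chart_at M x)"
    and met: "\<forall>x\<in>points M. bilinear (rmetric M x) \<and> (\<forall>u v. rmetric M x u v = rmetric M x v u) \<and>
        (\<forall>v. v \<noteq> 0 \<longrightarrow> 0 < rmetric M x v v)"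
    and sm: "\<forall>(U, \<phi>)\<in>charts M. \<forall>u v. smooth_on (\<phi> ` U)
          (\<lambda>p. let x = chart_inv (U, \<phi>) p
                in rmetric M x (tvec M (U, \<phi>) x u) (tvec M (U, \<phi>) x v))"
    using assms[unfolded riemannian_manifold_def, THEN conjunct1]
      assms[unfolded riemannian_manifold_def, THEN conjunct2, THEN conjunct1]
      assms[unfolded riemannian_manifold_def, THEN conjunct2, THEN conjunct2, THEN conjunct1]
      assms[unfolded riemannian_manifold_def, THEN conjunct2, THEN conjunct2, THEN conjunct2]
    by - assumption+
  have at1: "\<forall>c\<in>charts M. inj_on (snd c) (fst c)"
    and at2: "\<forall>c\<in>charts M. \<forall>d\<in>charts M. open (snd c ` (fst c \<inter> fst d)) \<and>
        smooth_on (snd c ` (fst c \<inter> fst d)) (snd d \<circ> chart_inv c)"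
    and at3: "Hausdorff_space (manifold_topology M)"
    using A unfolding smooth_atlas_def by (fastforce simp: case_prod_unfold)+
  show ?thesis
  proof (unfold_locales, goal_cases)
    case 1 then show ?case using at1 by blast
  next
    case 2 then show ?case using at2 by blast
  next
    case 3 then show ?case using at2 by (simp add: o_def)
  next
    case 4 then show ?case using at3 .
  next
    case 5 then show ?case using at by blast
  next
    case 6 then show ?case using at by blast
  next
    case 7 then show ?case using met by blast
  next
    case 8 then show ?case using met by blast
  next
    case 9 then show ?case using met by blast
  next
    case (10 c u v) then show ?case using sm by (cases c) (auto simp: Let_def)
  qed
qed

lemma bilinear_linear_left: "bilinear B \<Longrightarrow> linear (\<lambda>u. B u v)"
  and bilinear_linear_right: "bilinear B \<Longrightarrow> linear (B u)"
  by (auto simp: bilinear_def)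

lemma bilinear_comb:
  fixes B :: "'e::euclidean_space \<Rightarrow> 'e \<Rightarrow> real"
  assumes "bilinear B"
  shows "B u v = (\<Sum>b\<in>Basis. \<Sum>b'\<in>Basis. (u \<bullet> b) * (v \<bullet> b') * B b b')"
proof -
  have "B u v = (\<Sum>b\<in>Basis. (u \<bullet> b) *\<^sub>R B b v)"
    using linear_comb_Basis[OF bilinear_linear_left[OF assms], of u v] by simp
  also have "\<dots> = (\<Sum>b\<in>Basis. (u \<bullet> b) *\<^sub>R (\<Sum>b'\<in>Basis. (v \<bullet> b') *\<^sub>R B b b'))"
    using linear_comb_Basis[OF bilinear_linear_right[OF assms], of v] by simp
  finally show ?thesis by (simp add: sum_distrib_left mult.assoc)
qed

text \<open>\<open>T\<close> lists the values of the functional \<open>B v\<close> on the basis.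
  Positive definiteness makes it injective, hence surjective in finite dimension, so every linear
  functional is represented exactly once.\<close>

lemma Riesz_bilinear:
  fixes B :: "'e::euclidean_space \<Rightarrow> 'e \<Rightarrow> real"
  assumes B: "bilinear B" and pos: "\<And>v. v \<noteq> 0 \<Longrightarrow> 0 < B v v" and l: "linear l"
  shows "\<exists>!v. \<forall>\<xi>. B v \<xi> = l \<xi>"
proof -
  define T where "T v = (\<Sum>b\<in>Basis. B v b *\<^sub>R b)" for v
  have linT: "linear T"
    unfolding T_def using bilinear_ladd[OF B] bilinear_lmul[OF B]
    by (intro linearI) (auto simp: scaleR_add_left sum.distrib scaleR_sum_right)
  have T: "T v \<bullet> b = B v b" if "b \<in> Basis" for v b
    using that by (simp add: T_def inner_sum_left inner_Basis if_distrib cong: if_cong)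
  have B0: "B v \<xi> = l' \<xi>" if "\<And>b. b \<in> Basis \<Longrightarrow> B v b = l' b" "linear l'" for v \<xi> l'
    using linear_comb_Basis[OF bilinear_linear_right[OF B], of \<xi> v] linear_comb_Basis[OF that(2), of \<xi>] that(1)
    by simp
  have inj: "inj T"
    unfolding linear_injective_0[OF linT]
  proof safe
    fix v assume "T v = 0"
    then have "B v b = 0" if "b \<in> Basis" for b using T[OF that, of v] by simp
    then have "B v v = 0" using B0[of v "\<lambda>_. 0" v] by (simp add: linear_zero)
    then show "v = 0" using pos[of v] by auto
  qed
  then have "surj T" using linT linear_injective_imp_surjective by blast
  then obtain v where v: "T v = (\<Sum>b\<in>Basis. l b *\<^sub>R b)" by (metis surjD)
  have "B v b = l b" if "b \<in> Basis" for b
    using T[OF that, of v] that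
    by (simp add: v inner_sum_left inner_Basis if_distrib cong: if_cong)
  then have "\<forall>\<xi>. B v \<xi> = l \<xi>" using B0[of v l] l by blast
  moreover have "w = v" if "\<forall>\<xi>. B w \<xi> = l \<xi>" for w
    using inj that \<open>\<forall>\<xi>. B v \<xi> = l \<xi>\<close> by (simp add: T_def inj_def)
  ultimately show ?thesis by blast
qed

section \<open>Atlas topology and transition maps\<close>

context riemannian
begin

lemma open_chart_image: "c \<in> charts M \<Longrightarrow> open (snd c ` fst c)"
  using open_overlap[of c c] by simp

lemma chart_inv_snd [simp]: "c \<in> charts M \<Longrightarrow> x \<in> fst c \<Longrightarrow> chart_inv c (snd c x) = x"
  by (simp add: chart_inv_def inj_chart)

lemma chart_inv_in: "p \<in> snd c ` fst c \<Longrightarrow> chart_inv c p \<in> fst c"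
  by (simp add: chart_inv_def inv_into_into)

lemma snd_chart_inv [simp]: "p \<in> snd c ` fst c \<Longrightarrow> snd c (chart_inv c p) = p"
  by (simp add: chart_inv_def f_inv_into_f)

lemma chart_points: "c \<in> charts M \<Longrightarrow> x \<in> fst c \<Longrightarrow> x \<in> points M"
  by (auto simp: atlas_carrier_def)

lemma openin_manifold:
  "openin (manifold_topology M) W \<longleftrightarrow> W \<subseteq> points M \<and> (\<forall>c\<in>charts M. open (snd c ` (W \<inter> fst c)))"
proof -
  have "inj_on \<phi> U" if "(U, \<phi>) \<in> charts M" for U \<phi>
    using inj_chart[OF that] by simp
  from openin_atlas_topology[OF this] show ?thesis by (simp add: case_prod_unfold)
qed

lemma overlap_image:
  assumes "c \<in> charts M"
  shows "snd c ` (W \<inter> fst c) = {p \<in> snd c ` fst c. chart_inv c p \<in> W}"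
  using assms by (auto simp: image_iff)

lemma continuous_on_transition:
  "c \<in> charts M \<Longrightarrow> d \<in> charts M \<Longrightarrow> continuous_on (snd c ` (fst c \<inter> fst d)) (\<lambda>p. snd d (chart_inv c p))"
  using C_k_on_continuous[OF smooth_on_C_k[OF smooth_transition]] by blast

text \<open>Seen in a second chart this set is the preimage of \<open>Q\<close> under a transition
  map; continuity of transitions thus makes charts continuous for the atlas topology.\<close>

lemma openin_chart:
  assumes c: "c \<in> charts M" and Q: "open Q"
  shows "openin (manifold_topology M) {x \<in> fst c. snd c x \<in> Q}"
  unfolding openin_manifold
proof (intro conjI ballI)
  show "{x \<in> fst c. snd c x \<in> Q} \<subseteq> points M" using c chart_points by blast
  fix d assume d: "d \<in> charts M"
  have "snd d ` ({x \<in> fst c. snd c x \<in> Q} \<inter> fst d) =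
      snd d ` (fst d \<inter> fst c) \<inter> (\<lambda>p. snd c (chart_inv d p)) -` Q"
    using d by auto
  then show "open (snd d ` ({x \<in> fst c. snd c x \<in> Q} \<inter> fst d))"
    using continuous_open_preimage[OF continuous_on_transition[OF d c] open_overlap[OF d c] Q] by simp
qed

lemma openin_chart_domain: "c \<in> charts M \<Longrightarrow> openin (manifold_topology M) (fst c)"
  using openin_chart[of c UNIV] by simp

lemma openin_points: "openin (manifold_topology M) (points M)"
proof -
  have "points M = \<Union> (fst ` charts M)" by (simp add: atlas_carrier_def)
  then show ?thesis using openin_chart_domain by auto
qed

lemma topspace_manifold [simp]: "topspace (manifold_topology M) = points M"
  using openin_points openin_manifold openin_subset topspace_def
  by (metis openin_topspace subset_antisym)

lemma open_chart_overlap: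
  "openin (manifold_topology M) W \<Longrightarrow> c \<in> charts M \<Longrightarrow> open (snd c ` (W \<inter> fst c))"
  by (simp add: openin_manifold)

lemma transition_has_derivative:
  assumes "c \<in> charts M" "d \<in> charts M" "x \<in> fst c" "x \<in> fst d"
  shows "((\<lambda>p. snd d (chart_inv c p)) has_derivative
      frechet_derivative (snd d \<circ> chart_inv c) (at (snd c x))) (at (snd c x))"
  using smooth_on_differentiable[OF smooth_transition[OF assms(1,2)], of "snd c x"] assms(3,4)
  by (auto simp: o_def differentiable_has_frechet_derivative)

text \<open>Chain rule on the triple overlap. With \<open>chart_at M x\<close> as the middle chart
  it makes \<open>tvec\<close> followed by \<open>tcoord\<close> independent of that choice.\<close>

lemma transition_compose:
  assumes "c \<in> charts M" "d \<in> charts M" "e \<in> charts M" "x \<in> fst c" "x \<in> fst d" "x \<in> fst e"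
  shows "frechet_derivative (snd e \<circ> chart_inv d) (at (snd d x))
      (frechet_derivative (snd d \<circ> chart_inv c) (at (snd c x)) u) =
    frechet_derivative (snd e \<circ> chart_inv c) (at (snd c x)) u"
proof -
  let ?S = "snd c ` (fst c \<inter> fst d)"
  have "((\<lambda>p. snd e (chart_inv d p)) \<circ> (\<lambda>p. snd d (chart_inv c p)) has_derivative
      frechet_derivative (snd e \<circ> chart_inv d) (at (snd d x)) \<circ>
      frechet_derivative (snd d \<circ> chart_inv c) (at (snd c x))) (at (snd c x))"
    using transition_has_derivative[of c d x] transition_has_derivative[of d e x] assms
    by (intro diff_chain_at) auto
  then have "((\<lambda>p. snd e (chart_inv c p)) has_derivative
      frechet_derivative (snd e \<circ> chart_inv d) (at (snd d x)) \<circ>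
      frechet_derivative (snd d \<circ> chart_inv c) (at (snd c x))) (at (snd c x))"
    by (subst (asm) has_derivative_cong_open[of ?S]) (use assms open_overlap in auto)
  from frechet_derivative_eqI[OF this] show ?thesis by (simp add: o_def)
qed

lemma transition_self:
  assumes "c \<in> charts M" "x \<in> fst c"
  shows "frechet_derivative (snd c \<circ> chart_inv c) (at (snd c x)) u = u"
proof -
  have "((\<lambda>p. snd c (chart_inv c p)) has_derivative id) (at (snd c x))"
    by (subst has_derivative_cong_open[of "snd c ` fst c" _ _ id])
       (use assms open_chart_image in \<open>auto simp: has_derivative_id\<close>)
  from frechet_derivative_eqI[OF this] show ?thesis by (simp add: o_def)
qed

section \<open>Tangent vectors and differentials in an arbitrary chart\<close>

lemma tcoord_tvec:
  assumes "c \<in> charts M" "d \<in> charts M" "x \<in> fst c" "x \<in> fst d"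
  shows "tcoord M d x (tvec M c x u) = frechet_derivative (snd d \<circ> chart_inv c) (at (snd c x)) u"
  unfolding tcoord_def tvec_def
  using assms chart_points chart_at by (intro transition_compose) auto

lemma tcoord_tvec_same [simp]:
  assumes "c \<in> charts M" "x \<in> fst c"
  shows "tcoord M c x (tvec M c x u) = u"
  using tcoord_tvec[of c c x u] transition_self[of c x u] assms by simp

lemma tvec_tcoord [simp]:
  assumes "c \<in> charts M" "x \<in> fst c"
  shows "tvec M c x (tcoord M c x v) = v"
  unfolding tcoord_def tvec_def
  using assms chart_points chart_at transition_self by (subst transition_compose) auto

lemma linear_tcoord: "c \<in> charts M \<Longrightarrow> x \<in> fst c \<Longrightarrow> linear (tcoord M c x)"
  using has_derivative_linear[OF transition_has_derivative[of "chart_at M x" c x]] chart_points chart_at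
  by (auto simp: tcoord_def[abs_def] o_def)

lemma linear_tvec: "c \<in> charts M \<Longrightarrow> x \<in> fst c \<Longrightarrow> linear (tvec M c x)"
  using has_derivative_linear[OF transition_has_derivative[of c "chart_at M x" x]] chart_points chart_at
  by (auto simp: tvec_def[abs_def] o_def)

text \<open>\<open>differential\<close> is defined through \<open>chart_at M x\<close>, which may
  jump with \<open>x\<close>; in a single chart \<open>c\<close> its dependence on \<open>x\<close>
  can be studied.\<close>

lemma differential_chart:
  assumes c: "c \<in> charts M" "x \<in> fst c" and d: "(\<lambda>p. f (chart_inv c p)) differentiable (at (snd c x))"
  shows "differential M f x v = frechet_derivative (\<lambda>p. f (chart_inv c p)) (at (snd c x)) (tcoord M c x v)"
proof -
  let ?a = "chart_at M x"
  have a: "?a \<in> charts M" "x \<in> fst ?a" using c chart_points chart_at by auto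
  let ?S = "snd ?a ` (fst ?a \<inter> fst c)"
  have "((\<lambda>p. f (chart_inv c p)) \<circ> (\<lambda>p. snd c (chart_inv ?a p)) has_derivative
      frechet_derivative (\<lambda>p. f (chart_inv c p)) (at (snd c x)) \<circ>
      frechet_derivative (snd c \<circ> chart_inv ?a) (at (snd ?a x))) (at (snd ?a x))"
    using transition_has_derivative[of ?a c x] a c differentiable_has_frechet_derivative[OF d] by (intro diff_chain_at) auto
  then have "((f \<circ> chart_inv ?a) has_derivative
      frechet_derivative (\<lambda>p. f (chart_inv c p)) (at (snd c x)) \<circ>
      frechet_derivative (snd c \<circ> chart_inv ?a) (at (snd ?a x))) (at (snd ?a x))"
    by (subst (asm) has_derivative_cong_open[of ?S]) (use a c open_overlap in auto)
  from frechet_derivative_eqI[OF this] show ?thesis by (simp add: differential_def tcoord_def)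
qed

lemma smooth_fun_on_chart:
  "smooth_fun_on M W f \<Longrightarrow> c \<in> charts M \<Longrightarrow> smooth_on (snd c ` (W \<inter> fst c)) (\<lambda>p. f (chart_inv c p))"
  by (cases c) (auto simp: smooth_fun_on_def o_def)

lemma smooth_fun_on_differentiable:
  "smooth_fun_on M W f \<Longrightarrow> c \<in> charts M \<Longrightarrow> x \<in> fst c \<Longrightarrow> x \<in> W \<Longrightarrow>
    (\<lambda>p. f (chart_inv c p)) differentiable (at (snd c x))"
  using smooth_on_differentiable[OF smooth_fun_on_chart] by blast

lemma linear_differential:
  assumes "smooth_fun_on M W f" "x \<in> W" "x \<in> points M"
  shows "linear (differential M f x)"
proof -
  have "linear (frechet_derivative (\<lambda>p. f (chart_inv (chart_at M x) p)) (at (snd (chart_at M x) x)))"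
    using smooth_fun_on_differentiable[OF assms(1) chart_at(1)] chart_at(2) assms
    by (intro linear_frechet_derivative) auto
  then show ?thesis by (simp add: differential_def[abs_def] o_def)
qed

section \<open>Gradients and the metric in a chart\<close>

lemma grad_unique:
  assumes "x \<in> points M" "linear (differential M f x)"
  shows "(\<forall>\<xi>. rmetric M x v \<xi> = differential M f x \<xi>) \<longleftrightarrow> v = grad M f x"
proof -
  have ex: "\<exists>!v. \<forall>\<xi>. rmetric M x v \<xi> = differential M f x \<xi>"
    using Riesz_bilinear[OF metric_bilinear metric_pos assms(2)] assms(1) by blast
  have "\<forall>\<xi>. rmetric M x (grad M f x) \<xi> = differential M f x \<xi>"
    unfolding grad_def by (rule theI'[OF ex])
  then show ?thesis using ex by blast
qed

lemma metric_grad: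
  assumes "smooth_fun_on M W f" "x \<in> W" "x \<in> points M"
  shows "rmetric M x (grad M f x) \<xi> = differential M f x \<xi>"
  using grad_unique[OF assms(3) linear_differential[OF assms]] by blast

definition metric_coord :: "('a, 'e) chart \<Rightarrow> 'e \<Rightarrow> 'e \<Rightarrow> 'e \<Rightarrow> real" where
  "metric_coord c p u v =
     rmetric M (chart_inv c p) (tvec M c (chart_inv c p) u) (tvec M c (chart_inv c p) v)"

lemma metric_coord_eq:
  "c \<in> charts M \<Longrightarrow> x \<in> fst c \<Longrightarrow>
    rmetric M x u v = metric_coord c (snd c x) (tcoord M c x u) (tcoord M c x v)"
  by (simp add: metric_coord_def)

lemma bilinear_metric_coord:
  assumes "c \<in> charts M" "p \<in> snd c ` fst c"
  shows "bilinear (metric_coord c p)"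
proof -
  let ?x = "chart_inv c p"
  have x: "?x \<in> fst c" "?x \<in> points M"
    using chart_inv_in[OF assms(2)] chart_points[OF assms(1)] by simp_all
  have B: "bilinear (rmetric M ?x)" using x metric_bilinear by blast
  have T: "linear (tvec M c ?x)" using linear_tvec[OF assms(1) x(1)] .
  show ?thesis
    unfolding bilinear_def metric_coord_def
    using linear_compose[OF T bilinear_linear_left[OF B], unfolded o_def]
      linear_compose[OF T bilinear_linear_right[OF B], unfolded o_def] by blast
qed

lemma metric_coord_pos:
  assumes "c \<in> charts M" "p \<in> snd c ` fst c" "u \<noteq> 0"
  shows "0 < metric_coord c p u u"
proof -
  let ?x = "chart_inv c p"
  have x: "?x \<in> fst c" "?x \<in> points M"
    using chart_inv_in[OF assms(2)] chart_points[OF assms(1)] by simp_all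
  have "tvec M c ?x u \<noteq> 0"
    using tcoord_tvec_same[OF assms(1) x(1), of u] linear_0[OF linear_tcoord[OF assms(1) x(1)]] assms(3)
    by auto
  then show ?thesis using x metric_pos by (simp add: metric_coord_def)
qed

lemma smooth_metric_coord: "c \<in> charts M \<Longrightarrow> smooth_on (snd c ` fst c) (\<lambda>p. metric_coord c p u v)"
  unfolding metric_coord_def by (rule smooth_metric)

lemma C_k_on_metric_coord:
  "c \<in> charts M \<Longrightarrow> T \<subseteq> snd c ` fst c \<Longrightarrow> C_k_on n T (\<lambda>p. metric_coord c p u v)"
  using C_k_on_subset[OF smooth_on_C_k[OF smooth_metric_coord]] .

definition grad_coord :: "('a, 'e) chart \<Rightarrow> ('a \<Rightarrow> real) \<Rightarrow> 'e \<Rightarrow> 'e" where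
  "grad_coord c f p = tcoord M c (chart_inv c p) (grad M f (chart_inv c p))"

lemma metric_grad_coord:
  assumes f: "smooth_fun_on M W f" and c: "c \<in> charts M" and p: "p \<in> snd c ` (W \<inter> fst c)"
  shows "metric_coord c p (grad_coord c f p) u = frechet_derivative (\<lambda>p. f (chart_inv c p)) (at p) u"
proof -
  obtain x where x: "x \<in> fst c" "x \<in> W" "p = snd c x" "x \<in> points M" using p c chart_points by auto
  have "metric_coord c p (grad_coord c f p) u = rmetric M x (grad M f x) (tvec M c x u)"
    using x c by (simp add: metric_coord_def grad_coord_def)
  also have "\<dots> = differential M f x (tvec M c x u)"
    using metric_grad[OF f] x by blast
  also have "\<dots> = frechet_derivative (\<lambda>p. f (chart_inv c p)) (at p) u"
    using differential_chart[OF c _ smooth_fun_on_differentiable[OF f c]] x c by simp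
  finally show ?thesis .
qed

text \<open>The components of the gradient solve a linear system: the matrix holds the metric in the
  chart, the right-hand side the partial derivatives of \<open>f\<close>. Positive definiteness
  makes the system injective, so \<open>C_k_on_linear_system\<close> applies.\<close>

lemma C_k_on_grad_coord:
  assumes W: "openin (manifold_topology M) W" and f: "smooth_fun_on M W f" and c: "c \<in> charts M"
  shows "C_k_on n (snd c ` (W \<inter> fst c)) (grad_coord c f)"
proof (rule C_k_on_linear_system)
  let ?S = "snd c ` (W \<inter> fst c)" and ?f' = "\<lambda>p. frechet_derivative (\<lambda>p. f (chart_inv c p)) (at p)"
  let ?A = "\<lambda>b p. \<Sum>b'\<in>Basis. metric_coord c p b b' *\<^sub>R b'"
  show S: "open ?S" using W c by (rule open_chart_overlap)
  have inS: "p \<in> snd c ` fst c" if "p \<in> ?S" for p using that by auto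
  show "C_k_on n ?S (?A b)" for b
    by (intro C_k_on_sum[OF S] C_k_on_scaleR[OF S] C_k_on_const C_k_on_metric_coord[OF c]) auto
  show "C_k_on n ?S (\<lambda>p. \<Sum>b'\<in>Basis. ?f' p b' *\<^sub>R b')"
    using smooth_on_C_k[OF smooth_fun_on_chart[OF f c]]
    by (intro C_k_on_sum[OF S] C_k_on_scaleR[OF S] C_k_on_const C_k_on_derivative)
  have comb: "(\<Sum>b\<in>Basis. (w \<bullet> b) *\<^sub>R ?A b p) = (\<Sum>b'\<in>Basis. metric_coord c p w b' *\<^sub>R b')"
    if "p \<in> ?S" for p w
  proof -
    have "(\<Sum>b\<in>Basis. (w \<bullet> b) *\<^sub>R metric_coord c p b b') = metric_coord c p w b'" for b'
      using bilinear_metric_coord[OF c inS[OF that]]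
      by (intro linear_comb_Basis bilinear_linear_left)
    then have "(\<Sum>b'\<in>Basis. metric_coord c p w b' *\<^sub>R b') =
        (\<Sum>b'\<in>Basis. (\<Sum>b\<in>Basis. (w \<bullet> b) *\<^sub>R metric_coord c p b b') *\<^sub>R b')" by simp
    also have "\<dots> = (\<Sum>b\<in>Basis. (w \<bullet> b) *\<^sub>R ?A b p)"
      by (simp add: scaleR_sum_left scaleR_sum_right) (rule sum.swap)
    finally show ?thesis by simp
  qed
  show "(\<Sum>b\<in>Basis. (grad_coord c f p \<bullet> b) *\<^sub>R ?A b p) = (\<Sum>b'\<in>Basis. ?f' p b' *\<^sub>R b')"
    if "p \<in> ?S" for p
    using comb[OF that] metric_grad_coord[OF f c that] by simp
  show "w = 0" if p: "p \<in> ?S" and 0: "(\<Sum>b\<in>Basis. (w \<bullet> b) *\<^sub>R ?A b p) = 0" for p w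
  proof (rule ccontr)
    assume "w \<noteq> 0"
    then have "0 < metric_coord c p w w" using metric_coord_pos[OF c inS[OF p]] by blast
    \<comment> \<open>Pairing the vanishing combination with \<open>w\<close> itself recovers the
      quadratic form.\<close>
    also have "metric_coord c p w w = (\<Sum>b'\<in>Basis. metric_coord c p w b' *\<^sub>R b') \<bullet> w"
      using linear_comb_Basis[OF bilinear_linear_right[OF bilinear_metric_coord[OF c inS[OF p]]], of w w]
      by (simp add: inner_sum_left inner_sum_right inner_commute mult.commute)
    also have "\<dots> = 0" using 0 comb[OF p] by simp
    finally show False by simp
  qed
qed

lemma smooth_field_on_grad:
  assumes "openin (manifold_topology M) W" "smooth_fun_on M W f"
  shows "smooth_field_on M W (grad M f)"
  using C_k_on_grad_coord[OF assms]
  by (auto simp: smooth_field_on_def smooth_on_def Let_def grad_coord_def[abs_def])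

end

section \<open>Connections and retractions in a chart\<close>

context riemannian
begin

section \<open>Smooth functions and vector fields\<close>

lemma smooth_field_on_iff:
  "smooth_field_on M W Y \<longleftrightarrow> (\<forall>d\<in>charts M.
    smooth_on (snd d ` (W \<inter> fst d)) (\<lambda>p. tcoord M d (chart_inv d p) (Y (chart_inv d p))))"
  by (auto simp: smooth_field_on_def Let_def)

lemma smooth_fun_on_iff:
  "smooth_fun_on M W f \<longleftrightarrow> (\<forall>d\<in>charts M. smooth_on (snd d ` (W \<inter> fst d)) (\<lambda>p. f (chart_inv d p)))"
  by (auto simp: smooth_fun_on_def o_def)

lemma smooth_on_cong: "open S \<Longrightarrow> (\<And>x. x \<in> S \<Longrightarrow> f x = g x) \<Longrightarrow> smooth_on S f \<longleftrightarrow> smooth_on S g"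
  unfolding smooth_on_def using C_k_on_cong by blast

lemma smooth_fun_on_cong:
  assumes "openin (manifold_topology M) W" "\<And>x. x \<in> W \<Longrightarrow> f x = g x"
  shows "smooth_fun_on M W f \<longleftrightarrow> smooth_fun_on M W g"
proof -
  have "smooth_on (snd d ` (W \<inter> fst d)) (\<lambda>p. f (chart_inv d p)) \<longleftrightarrow>
      smooth_on (snd d ` (W \<inter> fst d)) (\<lambda>p. g (chart_inv d p))" if "d \<in> charts M" for d
    using that assms by (intro smooth_on_cong open_chart_overlap) auto
  then show ?thesis by (simp add: smooth_fun_on_iff)
qed

lemma smooth_field_on_cong:
  assumes "openin (manifold_topology M) W" "\<And>x. x \<in> W \<Longrightarrow> Y x = Z x"
  shows "smooth_field_on M W Y \<longleftrightarrow> smooth_field_on M W Z"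
proof -
  have "smooth_on (snd d ` (W \<inter> fst d)) (\<lambda>p. tcoord M d (chart_inv d p) (Y (chart_inv d p))) \<longleftrightarrow>
      smooth_on (snd d ` (W \<inter> fst d)) (\<lambda>p. tcoord M d (chart_inv d p) (Z (chart_inv d p)))"
    if "d \<in> charts M" for d
    using that assms by (intro smooth_on_cong open_chart_overlap) auto
  then show ?thesis by (simp add: smooth_field_on_iff)
qed

lemma smooth_field_on_subset: "smooth_field_on M W Y \<Longrightarrow> V \<subseteq> W \<Longrightarrow> smooth_field_on M V Y"
  unfolding smooth_field_on_iff smooth_on_def
  by (meson C_k_on_subset Int_mono image_mono order_refl)

lemma smooth_field_on_zero:
  assumes W: "openin (manifold_topology M) W"
  shows "smooth_field_on M W (\<lambda>x. 0)"
proof -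
  have "smooth_on (snd d ` (W \<inter> fst d)) (\<lambda>p. tcoord M d (chart_inv d p) 0)"
    if d: "d \<in> charts M" for d
  proof -
    have "smooth_on (snd d ` (W \<inter> fst d)) (\<lambda>p. 0 :: 'e)"
      by (simp add: smooth_on_def C_k_on_const)
    then show ?thesis
      by (rule iffD1[OF smooth_on_cong, rotated 2])
         (use W d linear_0[OF linear_tcoord[OF d]] in \<open>auto intro: open_chart_overlap\<close>)
  qed
  then show ?thesis by (simp add: smooth_field_on_iff)
qed

lemma smooth_field_on_add:
  assumes W: "openin (manifold_topology M) W" and "smooth_field_on M W Y" "smooth_field_on M W Z"
  shows "smooth_field_on M W (\<lambda>x. Y x + Z x)"
proof -
  have "smooth_on (snd d ` (W \<inter> fst d)) (\<lambda>p. tcoord M d (chart_inv d p) (Y (chart_inv d p) + Z (chart_inv d p)))"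
    if d: "d \<in> charts M" for d
  proof -
    have S: "open (snd d ` (W \<inter> fst d))" using W d by (rule open_chart_overlap)
    have "smooth_on (snd d ` (W \<inter> fst d)) (\<lambda>p. tcoord M d (chart_inv d p) (Y (chart_inv d p)) +
        tcoord M d (chart_inv d p) (Z (chart_inv d p)))"
      using assms(2,3) d unfolding smooth_field_on_iff smooth_on_def by (auto intro!: C_k_on_add[OF S])
    then show ?thesis
      by (rule iffD1[OF smooth_on_cong, rotated 2])
         (use S d linear_add[OF linear_tcoord[OF d]] in auto)
  qed
  then show ?thesis by (simp add: smooth_field_on_iff)
qed

lemma smooth_field_on_scaleR:
  assumes W: "openin (manifold_topology M) W" and "smooth_fun_on M W f" "smooth_field_on M W Y"
  shows "smooth_field_on M W (\<lambda>x. f x *\<^sub>R Y x)"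
proof -
  have "smooth_on (snd d ` (W \<inter> fst d)) (\<lambda>p. tcoord M d (chart_inv d p) (f (chart_inv d p) *\<^sub>R Y (chart_inv d p)))"
    if d: "d \<in> charts M" for d
  proof -
    have S: "open (snd d ` (W \<inter> fst d))" using W d by (rule open_chart_overlap)
    have "smooth_on (snd d ` (W \<inter> fst d)) (\<lambda>p. f (chart_inv d p) *\<^sub>R
        tcoord M d (chart_inv d p) (Y (chart_inv d p)))"
      using assms(2,3) d unfolding smooth_field_on_iff smooth_fun_on_iff smooth_on_def
      by (auto intro!: C_k_on_scaleR[OF S])
    then show ?thesis
      by (rule iffD1[OF smooth_on_cong, rotated 2])
         (use S d linear_scale[OF linear_tcoord[OF d]] in auto)
  qed
  then show ?thesis by (simp add: smooth_field_on_iff)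
qed

lemma smooth_field_on_sum:
  assumes W: "openin (manifold_topology M) W" and "\<And>i. i \<in> I \<Longrightarrow> smooth_field_on M W (Y i)"
  shows "smooth_field_on M W (\<lambda>x. \<Sum>i\<in>I. Y i x)"
  using assms(2)
  by (induction I rule: infinite_finite_induct)
     (auto intro!: smooth_field_on_add[OF W] smooth_field_on_zero[OF W])

lemma C_k_on_transition_compose:
  fixes F :: "'e \<Rightarrow> 'g::real_normed_vector"
  assumes c: "c \<in> charts M" and d: "d \<in> charts M" and F: "C_k_on n (snd c ` (fst c \<inter> fst d)) F"
  shows "C_k_on n (snd d ` (fst c \<inter> fst d)) (\<lambda>p. F (snd c (chart_inv d p)))"
proof (rule C_k_on_compose[OF _ open_overlap[OF c d] _ F])
  show "open (snd d ` (fst c \<inter> fst d))" using open_overlap[OF d c] by (simp add: Int_commute)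
  show "C_k_on n (snd d ` (fst c \<inter> fst d)) (\<lambda>p. snd c (chart_inv d p))"
    using smooth_on_C_k[OF smooth_transition[OF d c]] by (simp add: Int_commute)
  show "(\<lambda>p. snd c (chart_inv d p)) ` (snd d ` (fst c \<inter> fst d)) \<subseteq> snd c ` (fst c \<inter> fst d)"
    using d by auto
qed

lemma smooth_fun_on_chart_domain:
  fixes F :: "'e \<Rightarrow> 'g::real_normed_vector"
  assumes c: "c \<in> charts M" and F: "smooth_on (snd c ` fst c) F"
  shows "smooth_fun_on M (fst c) (\<lambda>x. F (snd c x))"
  unfolding smooth_fun_on_iff smooth_on_def
proof (intro ballI allI)
  fix d n assume d: "d \<in> charts M"
  show "C_k_on n (snd d ` (fst c \<inter> fst d)) (\<lambda>p. F (snd c (chart_inv d p)))"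
    using C_k_on_subset[OF smooth_on_C_k[OF F]]
    by (intro C_k_on_transition_compose c d) (simp add: image_mono)
qed

text \<open>In another chart \<open>d\<close> the components of this field are the derivative of the
  transition map in direction \<open>u\<close>.\<close>

lemma smooth_coordinate_field:
  assumes c: "c \<in> charts M"
  shows "smooth_field_on M (fst c) (\<lambda>x. tvec M c x u)"
  unfolding smooth_field_on_iff
proof
  fix d assume d: "d \<in> charts M"
  let ?F = "\<lambda>p. frechet_derivative (\<lambda>p. snd d (chart_inv c p)) (at p) u"
  have S: "open (snd d ` (fst c \<inter> fst d))" using open_overlap[OF d c] by (simp add: Int_commute)
  have "smooth_on (snd d ` (fst c \<inter> fst d)) (\<lambda>p. ?F (snd c (chart_inv d p)))"
    using C_k_on_derivative[OF smooth_on_C_k[OF smooth_transition[OF c d]]]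
    by (auto simp: smooth_on_def intro!: C_k_on_transition_compose c d)
  then show "smooth_on (snd d ` (fst c \<inter> fst d)) (\<lambda>p. tcoord M d (chart_inv d p) (tvec M c (chart_inv d p) u))"
    by (rule iffD1[OF smooth_on_cong, rotated 2])
       (use S c d tcoord_tvec[OF c d] in \<open>auto simp: o_def\<close>)
qed

definition field_coord :: "('a, 'e) chart \<Rightarrow> ('a \<Rightarrow> 'e) \<Rightarrow> 'e \<Rightarrow> 'e" where
  "field_coord c Y p = tcoord M c (chart_inv c p) (Y (chart_inv c p))"

lemma smooth_field_coord:
  "smooth_field_on M W Y \<Longrightarrow> c \<in> charts M \<Longrightarrow> smooth_on (snd c ` (W \<inter> fst c)) (field_coord c Y)"
  by (auto simp: smooth_field_on_iff field_coord_def[abs_def])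

section \<open>Retractions in a chart\<close>

text \<open>Let \<open>G\<close> be the retraction written in the tangent chart over
  \<open>c\<close>. It is smooth, \<open>G (p, 0) = p\<close>, and its partial derivative in the
  second argument at \<open>(p, 0)\<close> is the identity; the Taylor bound between
  \<open>(p, 0)\<close> and \<open>(p, u)\<close> is the claim. The constants come from one ball
  around \<open>(snd c x0, 0)\<close>, hence hold uniformly in \<open>x\<close>.\<close>

lemma retraction_chart_estimate:
  assumes R: "manifold_retraction M R" and c: "c \<in> charts M" and x0: "x0 \<in> fst c"
  obtains r L where "r > 0" "L > 0" "cball (snd c x0) r \<subseteq> snd c ` fst c"
    "\<And>x v. x \<in> fst c \<Longrightarrow> snd c x \<in> cball (snd c x0) r \<Longrightarrow> norm (tcoord M c x v) \<le> r \<Longrightarrow>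
      R x v \<in> fst c \<and> norm (snd c (R x v) - snd c x - tcoord M c x v) \<le> L * (norm (tcoord M c x v))\<^sup>2"
proof -
  let ?T = "\<lambda>(x, v). (snd c x, tcoord M c x v)"
  let ?c = "(fst c \<times> (UNIV :: 'e set), ?T)"
  let ?F = "\<lambda>(x, v). R x v"
  have tc: "?c \<in> tangent_charts M"
    using c unfolding tangent_charts_def by (auto simp: image_iff case_prod_unfold intro!: bexI[of _ c])
  have smap: "smooth_map (tangent_charts M) (charts M) ?F"
    and R0: "\<And>x. x \<in> points M \<Longrightarrow> R x 0 = x"
    and DR: "\<And>x. x \<in> points M \<Longrightarrow> ((\<lambda>v. snd (chart_at M x) (R x v)) has_derivative id) (at 0)"
    using R by (auto simp: manifold_retraction_def)
  \<comment> \<open>\<open>P d\<close> is the part of the tangent chart whose vectors are retracted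
    into the chart \<open>d\<close>; on it the retraction can be read in \<open>d\<close>.\<close>
  define P where "P d = ?T ` (fst ?c \<inter> ?F -` fst d)" for d :: "('a, 'e) chart"
  have P: "open (P d)" "smooth_on (P d) (snd d \<circ> ?F \<circ> chart_inv ?c)" if "d \<in> charts M" for d
  proof -
    have "\<forall>c\<in>tangent_charts M. \<forall>d\<in>charts M. open (snd c ` (fst c \<inter> ?F -` fst d)) \<and>
        smooth_on (snd c ` (fst c \<inter> ?F -` fst d)) (snd d \<circ> ?F \<circ> chart_inv c)"
      using smap unfolding smooth_map_def by (simp add: case_prod_unfold)
    from this[rule_format, OF tc that] show "open (P d)" "smooth_on (P d) (snd d \<circ> ?F \<circ> chart_inv ?c)"
      by (simp_all add: P_def)
  qed
  have injT: "inj_on ?T (fst ?c)"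
  proof (rule inj_onI, clarsimp)
    fix x v y w assume xy: "x \<in> fst c" "y \<in> fst c" "snd c x = snd c y" "tcoord M c x v = tcoord M c y w"
    have "x = y" using inj_onD[OF inj_chart[OF c] xy(3,1,2)] .
    moreover have "v = w"
      using arg_cong[OF xy(4), of "tvec M c x"] tvec_tcoord[OF c xy(1)] \<open>x = y\<close> by simp
    ultimately show "x = y \<and> v = w" by simp
  qed
  have invT: "chart_inv ?c (snd c x, u) = (x, tvec M c x u)" if "x \<in> fst c" for x u
  proof -
    have "(snd c x, u) = ?T (x, tvec M c x u)" using c that by simp
    then show ?thesis using inv_into_f_f[OF injT, of "(x, tvec M c x u)"] that
      by (simp add: chart_inv_def)
  qed
  have inP: "(snd c x, u) \<in> P d \<longleftrightarrow> R x (tvec M c x u) \<in> fst d" if x: "x \<in> fst c" for x u d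
  proof
    assume "(snd c x, u) \<in> P d"
    then obtain y w where yw: "y \<in> fst c" "R y w \<in> fst d" "snd c x = snd c y" "u = tcoord M c y w"
      by (auto simp: P_def)
    then have "x = y" using inj_onD[OF inj_chart[OF c]] x by auto
    then show "R x (tvec M c x u) \<in> fst d" using yw c by simp
  next
    assume "R x (tvec M c x u) \<in> fst d"
    then have "(x, tvec M c x u) \<in> fst ?c \<inter> ?F -` fst d" using x by simp
    from imageI[OF this, of ?T] show "(snd c x, u) \<in> P d" using c x by (simp add: P_def)
  qed
  define G where "G q = snd c (?F (chart_inv ?c q))" for q
  have G: "G (snd c x, u) = snd c (R x (tvec M c x u))" if "x \<in> fst c" for x u
    using invT[OF that] by (simp add: G_def)
  have tvec0: "tvec M c x 0 = 0" if "x \<in> fst c" for x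
    using linear_0[OF linear_tvec[OF c that]] .
  have G0: "G (snd c x, 0) = snd c x" "(snd c x, 0) \<in> P c" if x: "x \<in> fst c" for x
    using G[OF x] inP[OF x] R0 chart_points[OF c x] tvec0[OF x] x by auto
  have smG: "smooth_on (P c) G"
    using P(2)[OF c] by (simp add: o_def G_def[abs_def])
  have G': "frechet_derivative G (at (snd c x, 0)) (0, u) = u" if x: "x \<in> fst c" for x u
  proof -
    let ?a = "chart_at M x"
    have xp: "x \<in> points M" using chart_points[OF c x] .
    have a: "?a \<in> charts M" "x \<in> fst ?a" using xp chart_at by auto
    have dG: "(G has_derivative frechet_derivative G (at (snd c x, 0))) (at (snd c x, 0))"
      using smG G0(2)[OF x] by (intro differentiable_has_frechet_derivative smooth_on_differentiable)
    have "((\<lambda>u. (snd c x, u)) has_derivative (\<lambda>u. (0, u))) (at 0)"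
      by (auto intro!: derivative_eq_intros)
    from diff_chain_at[OF this] dG
    have d1: "((\<lambda>u. G (snd c x, u)) has_derivative (\<lambda>u. frechet_derivative G (at (snd c x, 0)) (0, u))) (at 0)"
      by (simp add: o_def)
    \<comment> \<open>The condition on the retraction is stated in \<open>chart_at M x\<close>. The
      chain rule with the transition to \<open>c\<close> converts it, and the two changes of chart
      cancel.\<close>
    have "((\<lambda>v. snd ?a (R x v)) has_derivative id) (at (tvec M c x 0))"
      using DR[OF xp] tvec0[OF x] by simp
    from diff_chain_at[OF linear_imp_has_derivative[OF linear_tvec[OF c x]] this]
    have "((\<lambda>u. snd ?a (R x (tvec M c x u))) has_derivative tvec M c x) (at 0)"
      by (simp add: o_def)
    moreover have "((\<lambda>p. snd c (chart_inv ?a p)) has_derivative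
        frechet_derivative (snd c \<circ> chart_inv ?a) (at (snd ?a x))) (at (snd ?a (R x (tvec M c x 0))))"
      using transition_has_derivative[OF a(1) c a(2) x] R0[OF xp] tvec0[OF x] by simp
    ultimately have d2: "((\<lambda>u. snd c (chart_inv ?a (snd ?a (R x (tvec M c x u))))) has_derivative
        (\<lambda>u. tcoord M c x (tvec M c x u))) (at 0)"
      using diff_chain_at[of "\<lambda>u. snd ?a (R x (tvec M c x u))" "tvec M c x" 0 "\<lambda>p. snd c (chart_inv ?a p)"
          "frechet_derivative (snd c \<circ> chart_inv ?a) (at (snd ?a x))"]
      by (simp add: o_def tcoord_def)
    \<comment> \<open>The detour through the chart \<open>?a\<close> is legitimate only for vectors
      retracted into \<open>fst ?a\<close>; these form an open set containing 0.\<close>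
    let ?Q = "(\<lambda>u. (snd c x, u)) -` P ?a"
    have Q: "open ?Q" using P(1)[OF a(1)]
      by (intro open_vimage) (auto intro!: continuous_intros)
    have "0 \<in> ?Q" using inP[OF x, of 0 ?a] R0[OF xp] tvec0[OF x] a by simp
    moreover have "snd c (chart_inv ?a (snd ?a (R x (tvec M c x u)))) = G (snd c x, u)" if "u \<in> ?Q" for u
      using that inP[OF x, of u ?a] a G[OF x] by simp
    ultimately have "((\<lambda>u. G (snd c x, u)) has_derivative (\<lambda>u. tcoord M c x (tvec M c x u))) (at 0)"
      using d2 has_derivative_cong_open[OF Q, of 0 "\<lambda>u. snd c (chart_inv ?a (snd ?a (R x (tvec M c x u))))"
          "\<lambda>u. G (snd c x, u)"] by simp
    from has_derivative_unique[OF d1 this] show ?thesis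
      using c x by (metis tcoord_tvec_same)
  qed
  obtain r L where r: "r > 0" "L > 0" "cball (snd c x0, 0) r \<subseteq> P c"
    "\<And>q q'. q \<in> cball (snd c x0, 0) r \<Longrightarrow> q' \<in> cball (snd c x0, 0) r \<Longrightarrow>
        norm (G q' - G q - frechet_derivative G (at q) (q' - q)) \<le> L * (norm (q' - q))\<^sup>2"
    using C2_estimates[OF P(1)[OF c] smooth_on_C_k[OF smG] G0(2)[OF x0]] by metis
  obtain r1 where r1: "r1 > 0" "cball (snd c x0) r1 \<subseteq> snd c ` fst c"
    using open_chart_image[OF c] x0 open_contains_cball by blast
  show thesis
  \<comment> \<open>Base point and vector each get half of \<open>r\<close>, so that the pair stays
    in the ball of radius \<open>r\<close> of the product space.\<close>
  proof (rule that[of "min r1 (r / 2)" L])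
    fix x v assume x: "x \<in> fst c" "snd c x \<in> cball (snd c x0) (min r1 (r / 2))"
      and v: "norm (tcoord M c x v) \<le> min r1 (r / 2)"
    let ?u = "tcoord M c x v"
    have "dist (snd c x0, 0) (snd c x, ?u) \<le> dist (snd c x0) (snd c x) + norm ?u"
      by (simp add: dist_Pair_Pair sqrt_sum_squares_le_sum)
    then have q': "(snd c x, ?u) \<in> cball (snd c x0, 0) r" using x v by auto
    have q: "(snd c x, 0) \<in> cball (snd c x0, 0) r" using x r(1) by (auto simp: dist_Pair_Pair)
    have "norm (G (snd c x, ?u) - snd c x - ?u) \<le> L * (norm ?u)\<^sup>2"
      using r(4)[OF q q'] G0(1)[OF x(1)] G'[OF x(1)] by (simp add: norm_Pair)
    moreover have "R x v \<in> fst c" using inP[OF x(1), of ?u c] q' r(3) c x by auto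
    ultimately show "R x v \<in> fst c \<and> norm (snd c (R x v) - snd c x - ?u) \<le> L * (norm ?u)\<^sup>2"
      using G[OF x(1), of ?u] c x by simp
  qed (use r r1 in auto)
qed

end

section \<open>Affine connections in a chart\<close>

locale riemannian_connection = riemannian M for M :: "('a, 'e::euclidean_space) rmanifold" +
  fixes conn :: "('a, 'e) connection"
  assumes affine: "affine_connection M conn"
begin

lemma smooth_conn:
  "openin (manifold_topology M) W \<Longrightarrow> smooth_field_on M W X \<Longrightarrow> smooth_field_on M W Y \<Longrightarrow>
    smooth_field_on M W (\<lambda>x. conn x (X x) Y)"
  using affine[unfolded affine_connection_def, rule_format, THEN conjunct1] by simp

lemma linear_conn:
  "openin (manifold_topology M) W \<Longrightarrow> smooth_field_on M W Y \<Longrightarrow> x \<in> W \<Longrightarrow> linear (\<lambda>u. conn x u Y)"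
  using affine[unfolded affine_connection_def, rule_format, THEN conjunct2, THEN conjunct1] by simp

lemma conn_lincomb:
  "openin (manifold_topology M) W \<Longrightarrow> smooth_field_on M W Y \<Longrightarrow> smooth_field_on M W Z \<Longrightarrow> x \<in> W \<Longrightarrow>
    conn x u (\<lambda>p. a *\<^sub>R Y p + b *\<^sub>R Z p) = a *\<^sub>R conn x u Y + b *\<^sub>R conn x u Z"
  using affine[unfolded affine_connection_def, rule_format, THEN conjunct2, THEN conjunct2, THEN conjunct1] by simp

lemma conn_Leibniz:
  "openin (manifold_topology M) W \<Longrightarrow> smooth_fun_on M W \<phi> \<Longrightarrow> smooth_field_on M W Y \<Longrightarrow> x \<in> W \<Longrightarrow>
    conn x u (\<lambda>p. \<phi> p *\<^sub>R Y p) = differential M \<phi> x u *\<^sub>R Y x + \<phi> x *\<^sub>R conn x u Y"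
  using affine[unfolded affine_connection_def, rule_format, THEN conjunct2, THEN conjunct2, THEN conjunct2] by simp

text \<open>The indicator of the complement of \<open>W\<close> is smooth on \<open>W\<close> and reproduces every field that
  vanishes on \<open>W\<close>; no bump function is needed.\<close>

lemma conn_local:
  assumes W: "openin (manifold_topology M) W" and Y: "smooth_field_on M W Y" and Z: "smooth_field_on M W Z"
    and eq: "\<And>p. p \<in> W \<Longrightarrow> Y p = Z p" and x: "x \<in> W"
  shows "conn x u Y = conn x u Z"
proof -
  define D where "D p = 1 *\<^sub>R Y p + (- 1) *\<^sub>R Z p" for p
  define \<phi> :: "'a \<Rightarrow> real" where "\<phi> p = (if p \<in> W then 0 else 1)" for p
  have D0: "D p = 0" if "p \<in> W" for p using eq[OF that] by (simp add: D_def)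
  have "smooth_field_on M W D"
    using smooth_field_on_cong[OF W, of D "\<lambda>_. 0"] D0 smooth_field_on_zero[OF W] by simp
  moreover have "smooth_fun_on M W \<phi>"
    using smooth_fun_on_cong[OF W, of \<phi> "\<lambda>_. 0"]
    by (simp add: \<phi>_def) (simp add: smooth_fun_on_iff smooth_on_def C_k_on_const)
  ultimately have "conn x u (\<lambda>p. \<phi> p *\<^sub>R D p) = 0"
    using conn_Leibniz[OF W, of \<phi> D x u] x D0[OF x] by (simp add: \<phi>_def)
  moreover have "(\<lambda>p. \<phi> p *\<^sub>R D p) = (\<lambda>p. 1 *\<^sub>R Y p + (- 1) *\<^sub>R Z p)"
    using D0 by (auto simp: \<phi>_def D_def fun_eq_iff)
  ultimately show ?thesis using conn_lincomb[OF W Y Z x, of u 1 "- 1"] by simp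
qed

lemma conn_zero:
  assumes "openin (manifold_topology M) W" "x \<in> W"
  shows "conn x u (\<lambda>_. 0) = 0"
  using conn_lincomb[OF assms(1) smooth_field_on_zero[OF assms(1)] smooth_field_on_zero[OF assms(1)] assms(2),
      of u 0 0] by simp

lemma conn_sum:
  assumes W: "openin (manifold_topology M) W" and "\<And>i. i \<in> I \<Longrightarrow> smooth_field_on M W (Y i)"
    and x: "x \<in> W"
  shows "conn x u (\<lambda>p. \<Sum>i\<in>I. Y i p) = (\<Sum>i\<in>I. conn x u (Y i))"
  using assms(2)
proof (induction I rule: infinite_finite_induct)
  case (insert i I)
  have "conn x u (\<lambda>p. 1 *\<^sub>R Y i p + 1 *\<^sub>R (\<Sum>i\<in>I. Y i p)) =
      1 *\<^sub>R conn x u (Y i) + 1 *\<^sub>R conn x u (\<lambda>p. \<Sum>i\<in>I. Y i p)"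
    using insert by (intro conn_lincomb[OF W] smooth_field_on_sum[OF W] x) auto
  with insert show ?case by simp
qed (simp_all add: conn_zero[OF W x])

definition christoffel :: "('a, 'e) chart \<Rightarrow> 'e \<Rightarrow> 'e \<Rightarrow> 'e \<Rightarrow> 'e" where
  "christoffel c b b' = field_coord c (\<lambda>x. conn x (tvec M c x b) (\<lambda>q. tvec M c q b'))"

lemma continuous_on_christoffel:
  assumes c: "c \<in> charts M"
  shows "continuous_on (snd c ` fst c) (christoffel c b b')"
proof -
  have "smooth_field_on M (fst c) (\<lambda>x. conn x (tvec M c x b) (\<lambda>q. tvec M c q b'))"
    using openin_chart_domain[OF c] smooth_coordinate_field[OF c] smooth_coordinate_field[OF c]
    by (rule smooth_conn)
  from C_k_on_continuous[OF smooth_on_C_k[OF smooth_field_coord[OF this c]]]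
  show ?thesis by (simp add: christoffel_def)
qed

text \<open>Locality replaces \<open>Y\<close> by its expansion in the coordinate frame, which holds
  only on the chart domain. The Leibniz rule then separates the derivative of the components from
  the covariant derivatives of the frame, the Christoffel symbols.\<close>

lemma conn_coord:
  assumes c: "c \<in> charts M" and Y: "smooth_field_on M (fst c) Y" and x: "x \<in> fst c"
  shows "tcoord M c x (conn x u Y) =
    frechet_derivative (field_coord c Y) (at (snd c x)) (tcoord M c x u) +
    (\<Sum>b\<in>Basis. \<Sum>b'\<in>Basis. ((tcoord M c x u \<bullet> b) * (tcoord M c x (Y x) \<bullet> b')) *\<^sub>R
        christoffel c b b' (snd c x))"
proof -
  let ?U = "fst c" and ?E = "\<lambda>b q. tvec M c q b"
  let ?y = "\<lambda>b q. field_coord c Y (snd c q) \<bullet> b"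
  have U: "openin (manifold_topology M) ?U" using c by (rule openin_chart_domain)
  have sm: "smooth_on (snd c ` ?U) (field_coord c Y)" using smooth_field_coord[OF Y c] by simp
  have y: "smooth_fun_on M ?U (?y b)" for b
    using smooth_fun_on_chart_domain[OF c, of "\<lambda>p. field_coord c Y p \<bullet> b"] sm
    by (auto simp: smooth_on_def intro!: C_k_on_bounded_linear[OF bounded_linear_inner_left open_chart_image[OF c]])
  have E: "smooth_field_on M ?U (?E b)" for b using c by (rule smooth_coordinate_field)
  have yE: "smooth_field_on M ?U (\<lambda>p. ?y b p *\<^sub>R ?E b p)" for b
    using U y E by (rule smooth_field_on_scaleR)
  have Yeq: "Y p = (\<Sum>b\<in>Basis. ?y b p *\<^sub>R ?E b p)" if "p \<in> ?U" for p
    using linear_comb_Basis[OF linear_tvec[OF c that], of "tcoord M c p (Y p)"] that c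
    by (simp add: field_coord_def)
  have "conn x u Y = conn x u (\<lambda>p. \<Sum>b\<in>Basis. ?y b p *\<^sub>R ?E b p)"
    using conn_local[OF U Y smooth_field_on_sum[OF U yE] Yeq x] .
  also have "\<dots> = (\<Sum>b\<in>Basis. conn x u (\<lambda>p. ?y b p *\<^sub>R ?E b p))"
    using conn_sum[OF U yE x] .
  also have "\<dots> = (\<Sum>b\<in>Basis. differential M (?y b) x u *\<^sub>R ?E b x + ?y b x *\<^sub>R conn x u (?E b))"
    using conn_Leibniz[OF U y E x] by simp
  finally have *: "conn x u Y = \<dots>" .
  have dY: "(field_coord c Y has_derivative frechet_derivative (field_coord c Y) (at (snd c x))) (at (snd c x))"
    using x sm by (intro differentiable_has_frechet_derivative smooth_on_differentiable) auto
  have d: "differential M (?y b) x u =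
      frechet_derivative (field_coord c Y) (at (snd c x)) (tcoord M c x u) \<bullet> b" for b
  proof -
    have "((\<lambda>p. ?y b (chart_inv c p)) has_derivative
        (\<lambda>v. frechet_derivative (field_coord c Y) (at (snd c x)) v \<bullet> b)) (at (snd c x))"
      using has_derivative_inner_left[OF dY]
      by (subst has_derivative_cong_open[of "snd c ` ?U"])
         (use c x open_chart_image in auto)
    then show ?thesis
      using differential_chart[OF c x, of "?y b"] frechet_derivative_eqI by (force simp: differentiable_def)
  qed
  have cE: "tcoord M c x (conn x u (?E b')) =
      (\<Sum>b\<in>Basis. (tcoord M c x u \<bullet> b) *\<^sub>R christoffel c b b' (snd c x))" for b'
  proof -
    have "linear (\<lambda>v. tcoord M c x (conn x (tvec M c x v) (?E b')))"
      using linear_compose[OF linear_compose[OF linear_tvec[OF c x] linear_conn[OF U E[of b'] x]]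
          linear_tcoord[OF c x]] by (simp add: o_def)
    from linear_comb_Basis[OF this, of "tcoord M c x u"] show ?thesis
      using c x by (simp add: christoffel_def field_coord_def)
  qed
  note lin = linear_tcoord[OF c x]
  have fc: "field_coord c Y (snd c x) = tcoord M c x (Y x)" using c x by (simp add: field_coord_def)
  have "tcoord M c x (conn x u Y) =
      (\<Sum>b\<in>Basis. (frechet_derivative (field_coord c Y) (at (snd c x)) (tcoord M c x u) \<bullet> b) *\<^sub>R b) +
      (\<Sum>b'\<in>Basis. (tcoord M c x (Y x) \<bullet> b') *\<^sub>R
        (\<Sum>b\<in>Basis. (tcoord M c x u \<bullet> b) *\<^sub>R christoffel c b b' (snd c x)))"
    unfolding * using c x
    by (simp add: linear_sum[OF lin] linear_add[OF lin] linear_scale[OF lin] d cE sum.distrib fc)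
  also have "(\<Sum>b'\<in>Basis. (tcoord M c x (Y x) \<bullet> b') *\<^sub>R
        (\<Sum>b\<in>Basis. (tcoord M c x u \<bullet> b) *\<^sub>R christoffel c b b' (snd c x))) =
      (\<Sum>b\<in>Basis. \<Sum>b'\<in>Basis. ((tcoord M c x u \<bullet> b) * (tcoord M c x (Y x) \<bullet> b')) *\<^sub>R
        christoffel c b b' (snd c x))"
    by (subst sum.swap) (simp add: scaleR_sum_right mult.commute)
  finally show ?thesis by (simp add: euclidean_representation)
qed

end

section \<open>Products with a Euclidean space\<close>

definition prod_chart :: "('a, 'e) chart \<Rightarrow> ('a \<times> 'v, 'e \<times> 'v) chart" where
  "prod_chart c = (fst c \<times> UNIV, map_prod (snd c) id)"

lemma fst_prod_chart [simp]: "fst (prod_chart c) = fst c \<times> UNIV"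
  and snd_prod_chart [simp]: "snd (prod_chart c) = map_prod (snd c) id"
  by (simp_all add: prod_chart_def)

lemma charts_times_euclidean: "charts (times_euclidean M) = prod_chart ` charts M"
  by (simp add: times_euclidean_def prod_chart_def case_prod_unfold)

lemma points_times_euclidean: "points (times_euclidean M) = points M \<times> UNIV"
  by (auto simp: charts_times_euclidean atlas_carrier_def)

lemma chart_at_times_euclidean: "chart_at (times_euclidean M) w = prod_chart (chart_at M (fst w))"
  by (simp add: times_euclidean_def prod_chart_def case_prod_unfold)

lemma rmetric_times_euclidean:
  "rmetric (times_euclidean M) w u v = rmetric M (fst w) (fst u) (fst v) + snd u \<bullet> snd v"
  by (simp add: times_euclidean_def case_prod_unfold)

context riemannian
begin

lemma inj_on_prod_chart: "c \<in> charts M \<Longrightarrow> inj_on (map_prod (snd c) id) (fst c \<times> (UNIV :: 'v set))"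
  using inj_chart by (auto simp: inj_on_def)

lemma image_prod_chart: "map_prod f id ` (A \<times> UNIV) = f ` A \<times> UNIV"
  by (auto simp: image_iff)

lemma chart_inv_prod_chart:
  assumes "c \<in> charts M" "p \<in> snd c ` fst c"
  shows "chart_inv (prod_chart c) (p, u) = (chart_inv c p, u)"
proof -
  have "map_prod (snd c) id (chart_inv c p, u) = (p, u)" using assms by simp
  moreover have "(chart_inv c p, u) \<in> fst c \<times> UNIV" using chart_inv_in[OF assms(2)] by simp
  ultimately show ?thesis
    using inv_into_f_f[OF inj_on_prod_chart[OF assms(1)], of "(chart_inv c p, u)"]
    unfolding chart_inv_def[of "prod_chart c"] by simp
qed

lemma chart_inv_prod_chart_snd:
  "c \<in> charts M \<Longrightarrow> x \<in> fst c \<Longrightarrow> chart_inv (prod_chart c) (snd c x, u) = (x, u)"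
  using chart_inv_prod_chart[of c "snd c x" u] by simp

lemma prod_transition_derivative:
  assumes c: "c \<in> charts M" and d: "d \<in> charts M" and x: "x \<in> fst c" "x \<in> fst d"
  shows "frechet_derivative (snd (prod_chart d) \<circ> chart_inv (prod_chart c)) (at (snd (prod_chart c) (x, u)))
      (\<xi>, a :: 'v::euclidean_space) =
    (frechet_derivative (snd d \<circ> chart_inv c) (at (snd c x)) \<xi>, a)"
proof -
  let ?D = "frechet_derivative (snd d \<circ> chart_inv c) (at (snd c x))"
  let ?S = "snd c ` (fst c \<inter> fst d) \<times> (UNIV :: 'v set)"
  have "((\<lambda>p. snd d (chart_inv c p)) has_derivative ?D) (at (fst (snd c x, u)))"
    using transition_has_derivative[OF c d x] by simp
  from diff_chain_at[OF has_derivative_fst[OF has_derivative_ident] this]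
  have "((\<lambda>q. snd d (chart_inv c (fst q))) has_derivative (\<lambda>v. ?D (fst v))) (at (snd c x, u))"
    by (simp add: o_def)
  from has_derivative_Pair[OF this has_derivative_snd[OF has_derivative_ident]]
  have "((\<lambda>q. (snd d (chart_inv c (fst q)), snd q)) has_derivative (\<lambda>v. (?D (fst v), snd v))) (at (snd c x, u))" .
  then have "((snd (prod_chart d) \<circ> chart_inv (prod_chart c)) has_derivative (\<lambda>v. (?D (fst v), snd v))) (at (snd c x, u))"
  proof (subst has_derivative_cong_open[of ?S])
    show "open ?S" using open_overlap[OF c d] by (intro open_Times) auto
    show "(snd c x, u) \<in> ?S" using x by simp
    show "(snd (prod_chart d) \<circ> chart_inv (prod_chart c)) q = (snd d (chart_inv c (fst q)), snd q)"
      if "q \<in> ?S" for q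
      using chart_inv_prod_chart[OF c, of "fst q" "snd q"] that by auto
  qed
  from frechet_derivative_eqI[OF this] show ?thesis by simp
qed

lemma tcoord_prod:
  assumes "c \<in> charts M" "x \<in> fst c"
  shows "tcoord (times_euclidean M) (prod_chart c) (x, u) (\<xi>, a) = (tcoord M c x \<xi>, a)"
  using prod_transition_derivative[of "chart_at M x" c x u \<xi> a] chart_at chart_points assms
  by (simp add: tcoord_def chart_at_times_euclidean)

lemma tvec_prod:
  assumes "c \<in> charts M" "x \<in> fst c"
  shows "tvec (times_euclidean M) (prod_chart c) (x, u) (\<xi>, a) = (tvec M c x \<xi>, a)"
  using prod_transition_derivative[of c "chart_at M x" x u \<xi> a] chart_at chart_points assms
  by (simp add: tvec_def chart_at_times_euclidean)

text \<open>Once the atlas topology is identified with the product topology, the Hausdorff property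
  and connectedness follow from general facts about products.\<close>

lemma manifold_topology_times_euclidean:
  "manifold_topology (times_euclidean M :: ('a \<times> 'v::euclidean_space, 'e \<times> 'v) rmanifold) =
    prod_topology (manifold_topology M) euclidean"
proof (rule topology_eq[THEN iffD2], intro allI)
  fix W :: "('a \<times> 'v) set"
  let ?N = "times_euclidean M :: ('a \<times> 'v, 'e \<times> 'v) rmanifold"
  have "openin (manifold_topology ?N) W \<longleftrightarrow>
      W \<subseteq> points ?N \<and> (\<forall>(U, \<phi>)\<in>charts ?N. open (\<phi> ` (W \<inter> U)))"
    by (rule openin_atlas_topology) (use inj_on_prod_chart in \<open>auto simp: charts_times_euclidean prod_chart_def\<close>)
  then have "openin (manifold_topology ?N) W \<longleftrightarrow>
      W \<subseteq> points M \<times> UNIV \<and> (\<forall>c\<in>charts M. open (map_prod (snd c) id ` (W \<inter> fst c \<times> UNIV)))"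
    unfolding points_times_euclidean by (simp add: charts_times_euclidean prod_chart_def)
  also have "\<dots> \<longleftrightarrow> openin (prod_topology (manifold_topology M) euclidean) W"
  proof
    assume W: "W \<subseteq> points M \<times> UNIV \<and> (\<forall>c\<in>charts M. open (map_prod (snd c) id ` (W \<inter> fst c \<times> UNIV)))"
    show "openin (prod_topology (manifold_topology M) euclidean) W"
      unfolding openin_prod_topology_alt
    proof (intro allI impI)
      fix x u assume xu: "(x, u) \<in> W"
      define c where "c = chart_at M x"
      have c: "c \<in> charts M" "x \<in> fst c" using W xu chart_at by (auto simp: c_def)
      then have "open (map_prod (snd c) id ` (W \<inter> fst c \<times> UNIV))" using W by blast
      moreover have "(snd c x, u) \<in> map_prod (snd c) id ` (W \<inter> fst c \<times> UNIV)" using xu c by force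
      ultimately obtain A B where AB: "open A" "open B" "(snd c x, u) \<in> A \<times> B"
        "A \<times> B \<subseteq> map_prod (snd c) id ` (W \<inter> fst c \<times> UNIV)"
        by (rule open_prod_elim)
      let ?U = "{y \<in> fst c. snd c y \<in> A}"
      have "?U \<times> B \<subseteq> W"
      proof clarify
        fix y b assume y: "y \<in> fst c" "snd c y \<in> A" "b \<in> B"
        then have "(snd c y, b) \<in> map_prod (snd c) id ` (W \<inter> fst c \<times> UNIV)" using AB(4) by blast
        then obtain y' where y': "(y', b) \<in> W" "y' \<in> fst c" "snd c y = snd c y'" by auto
        then have "y = y'" using inj_onD[OF inj_chart[OF c(1)]] y(1) by blast
        then show "(y, b) \<in> W" using y' by simp
      qed
      moreover have "openin (manifold_topology M) ?U" using openin_chart[OF c(1) AB(1)] .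
      moreover have "openin euclidean B" using AB(2) by simp
      moreover have "x \<in> ?U" "u \<in> B" using AB(3) c by auto
      ultimately show "\<exists>U V. openin (manifold_topology M) U \<and> openin euclidean V \<and> x \<in> U \<and> u \<in> V \<and> U \<times> V \<subseteq> W"
        by (intro exI[of _ ?U] exI[of _ B] conjI)
    qed
  next
    assume W: "openin (prod_topology (manifold_topology M) euclidean) W"
    show "W \<subseteq> points M \<times> UNIV \<and> (\<forall>c\<in>charts M. open (map_prod (snd c) id ` (W \<inter> fst c \<times> UNIV)))"
    proof (intro conjI ballI)
      show "W \<subseteq> points M \<times> UNIV" using openin_subset[OF W] by simp
      fix c assume c: "c \<in> charts M"
      show "open (map_prod (snd c) id ` (W \<inter> fst c \<times> UNIV))"
      proof (rule iffD2[OF open_subopen], rule ballI)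
        fix q assume "q \<in> map_prod (snd c) id ` (W \<inter> fst c \<times> UNIV)"
        then obtain x u where xu: "(x, u) \<in> W" "x \<in> fst c" "q = map_prod (snd c) id (x, u)" by auto
        obtain U V where UV: "openin (manifold_topology M) U" "openin euclidean V" "x \<in> U" "u \<in> V" "U \<times> V \<subseteq> W"
          using W[unfolded openin_prod_topology_alt, rule_format, OF xu(1)] by (elim exE conjE)
        have "open (snd c ` (U \<inter> fst c) \<times> V)"
          using open_chart_overlap[OF UV(1) c] UV(2)[folded open_openin] by (rule open_Times)
        moreover have "q \<in> snd c ` (U \<inter> fst c) \<times> V" using UV xu by simp
        moreover have "snd c ` (U \<inter> fst c) \<times> V \<subseteq> map_prod (snd c) id ` (W \<inter> fst c \<times> UNIV)"
        proof clarify
          fix y b assume "y \<in> U" "y \<in> fst c" "b \<in> V"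
          then have "(y, b) \<in> W \<inter> fst c \<times> UNIV" using UV(5) by auto
          from imageI[OF this, of "map_prod (snd c) id"]
          show "(snd c y, b) \<in> map_prod (snd c) id ` (W \<inter> fst c \<times> UNIV)" by simp
        qed
        ultimately show "\<exists>T. open T \<and> q \<in> T \<and> T \<subseteq> map_prod (snd c) id ` (W \<inter> fst c \<times> UNIV)"
          by (intro exI[of _ "snd c ` (U \<inter> fst c) \<times> V"] conjI)
      qed
    qed
  qed
  finally show "openin (manifold_topology (times_euclidean M)) W \<longleftrightarrow>
      openin (prod_topology (manifold_topology M) euclidean) W" .
qed

text \<open>Every chart of the product is a chart of \<open>M\<close> times the identity, so each
  axiom reduces to the factor. As an instance of the locale the product inherits all results on
  lengths and distances.\<close>

lemma riemannian_times_euclidean: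
  "riemannian (times_euclidean M :: ('a \<times> 'v::euclidean_space, 'e \<times> 'v) rmanifold)" (is "riemannian ?N")
proof (unfold_locales, goal_cases)
  case (1 c)
  then show ?case using inj_on_prod_chart by (auto simp: charts_times_euclidean)
next
  case (2 c d)
  then obtain c' d' where cd: "c' \<in> charts M" "d' \<in> charts M" "c = prod_chart c'" "d = prod_chart d'"
    by (auto simp: charts_times_euclidean)
  have eq: "snd c ` (fst c \<inter> fst d) = snd c' ` (fst c' \<inter> fst d') \<times> UNIV"
    by (simp add: cd Times_Int_Times image_prod_chart)
  show ?case unfolding eq by (rule open_Times[OF open_overlap[OF cd(1,2)] open_UNIV])
next
  case (3 c d)
  then obtain c' d' where cd: "c' \<in> charts M" "d' \<in> charts M" "c = prod_chart c'" "d = prod_chart d'"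
    by (auto simp: charts_times_euclidean)
  let ?S = "snd c' ` (fst c' \<inter> fst d')"
  have S: "open (?S \<times> (UNIV :: 'v set))" by (rule open_Times[OF open_overlap[OF cd(1,2)] open_UNIV])
  have "snd c ` (fst c \<inter> fst d) = ?S \<times> UNIV"
    by (simp add: cd Times_Int_Times image_prod_chart)
  moreover have "C_k_on n (?S \<times> UNIV) (\<lambda>q. snd d (chart_inv c q))" for n
  proof -
    have "C_k_on n (?S \<times> (UNIV :: 'v set)) (\<lambda>q. snd d' (chart_inv c' (fst q)))"
      by (rule C_k_on_compose[where g = fst and f = "\<lambda>p. snd d' (chart_inv c' p)", OF S
            open_overlap[OF cd(1,2)] C_k_on_linear_fun[OF S bounded_linear_fst]
            smooth_on_C_k[OF smooth_transition[OF cd(1,2)]]]) auto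
    then have "C_k_on n (?S \<times> (UNIV :: 'v set)) (\<lambda>q. (snd d' (chart_inv c' (fst q)), snd q))"
      by (rule C_k_on_Pair[OF S _ C_k_on_linear_fun[OF S bounded_linear_snd]])
    then show ?thesis
      by (rule iffD1[OF C_k_on_cong[OF S], rotated])
         (use cd(1) in \<open>auto simp: cd chart_inv_prod_chart_snd\<close>)
  qed
  ultimately show ?case by (simp add: smooth_on_def)
next
  case 4
  show ?case unfolding manifold_topology_times_euclidean
    using Hausdorff by (simp add: Hausdorff_space_prod_topology)
next
  case (5 w)
  then have "fst w \<in> points M" unfolding points_times_euclidean by auto
  then show ?case using chart_at(1)[of "fst w"]
    by (simp add: chart_at_times_euclidean charts_times_euclidean)
next
  case (6 w)
  then have "fst w \<in> points M" unfolding points_times_euclidean by auto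
  then show ?case using chart_at(2)[of "fst w"]
    by (cases w) (simp add: chart_at_times_euclidean)
next
  case (7 w)
  then have B: "bilinear (rmetric M (fst w))"
    using metric_bilinear unfolding points_times_euclidean by auto
  show ?case unfolding bilinear_def rmetric_times_euclidean
    by (auto intro!: linearI simp: bilinear_ladd[OF B] bilinear_radd[OF B] bilinear_lmul[OF B] bilinear_rmul[OF B]
        inner_add_left inner_add_right algebra_simps)
next
  case (8 w u v)
  then have "fst w \<in> points M" unfolding points_times_euclidean by auto
  then show ?case using metric_sym[of "fst w"]
    by (simp add: rmetric_times_euclidean inner_commute)
next
  case (9 w v)
  then have w: "fst w \<in> points M" unfolding points_times_euclidean by auto
  show ?case
  proof (cases "fst v = 0")
    case True
    then have "snd v \<noteq> 0" using 9 by (simp add: prod_eq_iff)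
    then show ?thesis using True bilinear_lzero[OF metric_bilinear[OF w]] by (simp add: rmetric_times_euclidean)
  next
    case False
    then show ?thesis using metric_pos[OF w] by (simp add: rmetric_times_euclidean add_pos_nonneg)
  qed
next
  case (10 c u v)
  then obtain c' where c: "c' \<in> charts M" "c = prod_chart c'" by (auto simp: charts_times_euclidean)
  let ?S = "snd c' ` fst c'"
  have S: "open (?S \<times> (UNIV :: 'v set))" by (rule open_Times[OF open_chart_image[OF c(1)] open_UNIV])
  have "snd c ` fst c = ?S \<times> UNIV" by (simp add: c image_prod_chart)
  moreover have "C_k_on n (?S \<times> UNIV)
      (\<lambda>p. rmetric ?N (chart_inv c p) (tvec ?N c (chart_inv c p) u) (tvec ?N c (chart_inv c p) v))" for n
  proof -
    have "C_k_on n (?S \<times> (UNIV :: 'v set)) (\<lambda>q. metric_coord c' (fst q) (fst u) (fst v) + snd u \<bullet> snd v)"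
      by (rule C_k_on_add[OF S C_k_on_compose[where g = fst and f = "\<lambda>p. metric_coord c' p (fst u) (fst v)",
            OF S open_chart_image[OF c(1)] C_k_on_linear_fun[OF S bounded_linear_fst]
            C_k_on_metric_coord[OF c(1) order_refl]] C_k_on_const]) auto
    then show ?thesis
    proof (rule iffD1[OF C_k_on_cong[OF S], rotated])
      fix q :: "'e \<times> 'v" assume q: "q \<in> ?S \<times> UNIV"
      have "chart_inv c q = (chart_inv c' (fst q), snd q)"
        using chart_inv_prod_chart[OF c(1), of "fst q" "snd q"] q by (auto simp: c)
      moreover have "chart_inv c' (fst q) \<in> fst c'" using q by (intro chart_inv_in) auto
      ultimately show "metric_coord c' (fst q) (fst u) (fst v) + snd u \<bullet> snd v =
          rmetric ?N (chart_inv c q) (tvec ?N c (chart_inv c q) u) (tvec ?N c (chart_inv c q) v)"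
        using tvec_prod[OF c(1), of "chart_inv c' (fst q)" "snd q" "fst u" "snd u"]
          tvec_prod[OF c(1), of "chart_inv c' (fst q)" "snd q" "fst v" "snd v"]
        by (simp add: c rmetric_times_euclidean metric_coord_def)
    qed
  qed
  ultimately show ?case by (simp add: smooth_on_def)
qed

lemma connected_times_euclidean:
  "connected_space (manifold_topology M) \<Longrightarrow>
    connected_space (manifold_topology (times_euclidean M :: ('a \<times> 'v::euclidean_space, 'e \<times> 'v) rmanifold))"
  unfolding manifold_topology_times_euclidean connected_space_prod_topology
  by (simp add: connected_UNIV connectedin_iff_connected flip: connectedin_topspace)

end

section \<open>Riemannian distance near a point\<close>

text \<open>Induction on the number of break points strictly between \<open>a\<close> and
  \<open>b\<close>: any such point splits the interval into two with fewer. It glues statements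
  about single segments into statements about the whole curve.\<close>

lemma consecutive_induct:
  fixes P :: "real set"
  assumes P: "finite P" and ab: "a \<in> P" "b \<in> P" "a < b"
    and consecutive: "\<And>u v. u \<in> P \<Longrightarrow> v \<in> P \<Longrightarrow> u < v \<Longrightarrow> P \<inter> {u<..<v} = {} \<Longrightarrow> Q u v"
    and join: "\<And>u v w. u < v \<Longrightarrow> v < w \<Longrightarrow> Q u v \<Longrightarrow> Q v w \<Longrightarrow> Q u w"
  shows "Q a b"
  using ab
proof (induction "card (P \<inter> {a<..<b})" arbitrary: a b rule: less_induct)
  case less
  show ?case
  proof (cases "P \<inter> {a<..<b} = {}")
    case True
    then show ?thesis using less.prems consecutive by blast
  next
    case False
    then obtain m where m: "m \<in> P" "a < m" "m < b" by auto
    have "P \<inter> {a<..<m} \<subset> P \<inter> {a<..<b}" "P \<inter> {m<..<b} \<subset> P \<inter> {a<..<b}"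
      using m by auto
    then have "card (P \<inter> {a<..<m}) < card (P \<inter> {a<..<b})" "card (P \<inter> {m<..<b}) < card (P \<inter> {a<..<b})"
      using P by (auto intro: psubset_card_mono)
    then have "Q a m" "Q m b" using less m by blast+
    then show ?thesis using join m by blast
  qed
qed

lemma between_consecutive:
  fixes P :: "real set"
  assumes P: "finite P" and "a \<in> P" "b \<in> P" "a < t" "t < b" "t \<notin> P"
  obtains u v where "u \<in> P" "v \<in> P" "u < t" "t < v" "P \<inter> {u<..<v} = {}"
proof -
  define u v where "u = Max {p\<in>P. p < t}" and "v = Min {p\<in>P. t < p}"
  have "u \<in> {p\<in>P. p < t}" unfolding u_def using assms by (intro Max_in) auto
  moreover have "v \<in> {p\<in>P. t < p}" unfolding v_def using assms by (intro Min_in) auto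
  moreover have "P \<inter> {u<..<v} = {}"
  proof (rule ccontr)
    assume "P \<inter> {u<..<v} \<noteq> {}"
    then obtain p where p: "p \<in> P" "u < p" "p < v" by auto
    then have "p \<noteq> t" using assms by auto
    then consider "p < t" | "t < p" by linarith
    then show False
    proof cases
      case 1 then have "p \<le> u" unfolding u_def using p P by (intro Max_ge) auto
      then show False using p by simp
    next
      case 2 then have "v \<le> p" unfolding v_def using p P by (intro Min_le) auto
      then show False using p by simp
    qed
  qed
  ultimately show thesis using that by blast
qed

context riemannian
begin

section \<open>Speed and length of curves\<close>

text \<open>On the compact product of \<open>K\<close> with the unit sphere the metric is a
  continuous positive function and attains its extrema; homogeneity extends both bounds to all
  vectors.\<close>

lemma metric_chart_bounds:
  assumes c: "c \<in> charts M" and K: "compact K" "K \<subseteq> snd c ` fst c"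
  obtains k B where "k > 0" "B > 0"
    "\<And>x v. x \<in> fst c \<Longrightarrow> snd c x \<in> K \<Longrightarrow> k * norm (tcoord M c x v) \<le> tnorm M x v"
    "\<And>x v. x \<in> fst c \<Longrightarrow> snd c x \<in> K \<Longrightarrow> tnorm M x v \<le> B * norm (tcoord M c x v)"
proof (cases "K = {}")
  case True
  then show thesis using that[of 1 1] by auto
next
  case False
  let ?S = "K \<times> sphere (0::'e) 1" and ?f = "\<lambda>q. metric_coord c (fst q) (snd q) (snd q)"
  have cont: "continuous_on ?S ?f"
  proof -
    have "continuous_on ?S (\<lambda>q. \<Sum>b\<in>Basis. \<Sum>b'\<in>Basis. (snd q \<bullet> b) * (snd q \<bullet> b') * metric_coord c (fst q) b b')"
      using C_k_on_continuous[OF C_k_on_metric_coord[OF c K(2)]]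
      by (intro continuous_intros continuous_on_compose2[of K _ ?S fst]) auto
    moreover have "(\<Sum>b\<in>Basis. \<Sum>b'\<in>Basis. (snd q \<bullet> b) * (snd q \<bullet> b') * metric_coord c (fst q) b b') = ?f q"
      if "q \<in> ?S" for q
      using bilinear_comb[OF bilinear_metric_coord[OF c], of "fst q" "snd q" "snd q"] that K by auto
    ultimately show ?thesis by (simp cong: continuous_on_cong)
  qed
  have comp: "compact ?S" using K by (intro compact_Times) auto
  have ne: "?S \<noteq> {}"
  proof -
    obtain b :: 'e where "b \<in> Basis" using nonempty_Basis by blast
    then show ?thesis using False by auto
  qed
  obtain q0 where q0: "q0 \<in> ?S" "\<forall>q\<in>?S. ?f q0 \<le> ?f q"
    using continuous_attains_inf[OF comp ne cont] by blast
  obtain q1 where q1: "q1 \<in> ?S" "\<forall>q\<in>?S. ?f q \<le> ?f q1"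
    using continuous_attains_sup[OF comp ne cont] by blast
  note q = q0(1) q1(1) bspec[OF q0(2)] bspec[OF q1(2)]
  have pos: "0 < ?f q" if "q \<in> ?S" for q
    using that K by (intro metric_coord_pos[OF c]) auto
  have scale: "tnorm M x v = sqrt (?f (snd c x, u)) * norm (tcoord M c x v)"
    and uS: "(snd c x, u) \<in> ?S"
    if x: "x \<in> fst c" "snd c x \<in> K" and v: "tcoord M c x v \<noteq> 0" and u: "u = tcoord M c x v /\<^sub>R norm (tcoord M c x v)"
    for x v u
  proof -
    have B: "bilinear (metric_coord c (snd c x))" using x by (intro bilinear_metric_coord c) auto
    have "tcoord M c x v = norm (tcoord M c x v) *\<^sub>R u" using v u by simp
    then have "rmetric M x v v = (norm (tcoord M c x v))\<^sup>2 * ?f (snd c x, u)"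
      unfolding metric_coord_eq[OF c x(1)]
      using bilinear_lmul[OF B, of "norm (tcoord M c x v)" u "norm (tcoord M c x v) *\<^sub>R u"]
        bilinear_rmul[OF B, of u "norm (tcoord M c x v)" u]
      by (simp add: power2_eq_square)
    then show "tnorm M x v = sqrt (?f (snd c x, u)) * norm (tcoord M c x v)"
      by (simp add: tnorm_def real_sqrt_mult)
    show "(snd c x, u) \<in> ?S" using x v u by simp
  qed
  have zero: "tnorm M x v = 0" if "x \<in> fst c" "tcoord M c x v = 0" for x v
  proof -
    have "bilinear (metric_coord c (snd c x))" using that by (intro bilinear_metric_coord c) auto
    then show ?thesis using that by (simp add: tnorm_def metric_coord_eq[OF c] bilinear_lzero)
  qed
  show thesis
  proof (rule that[of "sqrt (?f q0)" "sqrt (?f q1)"])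
    fix x v assume x: "x \<in> fst c" "snd c x \<in> K"
    show "sqrt (?f q0) * norm (tcoord M c x v) \<le> tnorm M x v"
    proof (cases "tcoord M c x v = 0")
      case False
      then show ?thesis
        using scale[OF x False refl] q(3)[OF uS[OF x False refl]] by (simp add: mult_right_mono del: split_paired_All)
    qed (use zero[OF x(1)] in simp)
    show "tnorm M x v \<le> sqrt (?f q1) * norm (tcoord M c x v)"
    proof (cases "tcoord M c x v = 0")
      case False
      then show ?thesis
        using scale[OF x False refl] q(4)[OF uS[OF x False refl]] by (simp add: mult_right_mono del: split_paired_All)
    qed (use zero[OF x(1)] in simp)
  qed (use pos q in auto)
qed

lemma tnorm_nonneg: "0 \<le> tnorm M x v" if "x \<in> points M"
  unfolding tnorm_def using metric_pos[OF that, of v] bilinear_lzero[OF metric_bilinear[OF that]]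
  by (cases "v = 0") auto

lemma C1_segment_derivative:
  assumes "C1_segment M \<gamma> a b" "c \<in> charts M"
  obtains D where "\<And>t. t \<in> {a..b} \<Longrightarrow> \<gamma> t \<in> fst c \<Longrightarrow>
      ((\<lambda>t. snd c (\<gamma> t)) has_vector_derivative D t) (at t within {a..b})"
    "continuous_on {t\<in>{a..b}. \<gamma> t \<in> fst c} D"
proof -
  have "\<forall>c\<in>charts M. \<exists>D. (\<forall>t\<in>{a..b}. \<gamma> t \<in> fst c \<longrightarrow>
        ((\<lambda>t. snd c (\<gamma> t)) has_vector_derivative D t) (at t within {a..b})) \<and>
        continuous_on {t\<in>{a..b}. \<gamma> t \<in> fst c} D"
    using assms(1) by (auto simp: C1_segment_def o_def case_prod_unfold)
  from bspec[OF this assms(2)] obtain D where "\<forall>t\<in>{a..b}. \<gamma> t \<in> fst c \<longrightarrow>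
        ((\<lambda>t. snd c (\<gamma> t)) has_vector_derivative D t) (at t within {a..b})"
     "continuous_on {t\<in>{a..b}. \<gamma> t \<in> fst c} D" by blast
  then show thesis using that[of D] by blast
qed

lemma C1_segmentI:
  assumes "continuous_map (top_of_set {a..b}) (manifold_topology M) \<gamma>"
    and "\<And>c. c \<in> charts M \<Longrightarrow> \<exists>D. (\<forall>t\<in>{a..b}. \<gamma> t \<in> fst c \<longrightarrow>
        ((\<lambda>t. snd c (\<gamma> t)) has_vector_derivative D t) (at t within {a..b})) \<and>
        continuous_on {t\<in>{a..b}. \<gamma> t \<in> fst c} D"
  shows "C1_segment M \<gamma> a b"
proof -
  have "\<exists>D. (\<forall>t\<in>{a..b}. \<gamma> t \<in> U \<longrightarrow> ((\<phi> \<circ> \<gamma>) has_vector_derivative D t) (at t within {a..b})) \<and>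
        continuous_on {t\<in>{a..b}. \<gamma> t \<in> U} D" if "(U, \<phi>) \<in> charts M" for U \<phi>
    using assms(2)[OF that] by (simp add: o_def)
  then show ?thesis using assms(1) unfolding C1_segment_def by blast
qed

lemma C1_segment_continuous:
  "C1_segment M \<gamma> a b \<Longrightarrow> continuous_map (top_of_set {a..b}) (manifold_topology M) \<gamma>"
  by (simp add: C1_segment_def)

lemma curve_in_chart_open:
  assumes \<gamma>: "continuous_map (top_of_set S) (manifold_topology M) \<gamma>" and c: "c \<in> charts M"
  obtains O' where "open O'" "{t\<in>S. \<gamma> t \<in> fst c} = S \<inter> O'"
proof -
  have "openin (top_of_set S) {t \<in> topspace (top_of_set S). \<gamma> t \<in> fst c}"
    using \<gamma> openin_chart_domain[OF c] by (rule openin_continuous_map_preimage)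
  then show thesis using that by (auto simp: openin_open)
qed

lemma velocity_chart:
  assumes \<gamma>: "continuous_map (top_of_set S) (manifold_topology M) \<gamma>" and c: "c \<in> charts M"
    and t: "t \<in> S" "\<gamma> t \<in> fst c" and D: "((\<lambda>t. snd c (\<gamma> t)) has_vector_derivative D) (at t within S)"
  shows "((snd (chart_at M (\<gamma> t)) \<circ> \<gamma>) has_vector_derivative tvec M c (\<gamma> t) D) (at t within S)"
proof -
  let ?a = "chart_at M (\<gamma> t)"
  have a: "?a \<in> charts M" "\<gamma> t \<in> fst ?a" using chart_points[OF c t(2)] chart_at by auto
  \<comment> \<open>The curve is known to be in \<open>c\<close> only near \<open>t\<close>, so the
    composed formula agrees with the wanted function only on a small ball around
    \<open>t\<close>.\<close>
  obtain O' where O': "open O'" "{t\<in>S. \<gamma> t \<in> fst c} = S \<inter> O'" using curve_in_chart_open[OF \<gamma> c] .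
  then obtain e where e: "e > 0" "ball t e \<subseteq> O'" using t open_contains_ball by blast
  have "((\<lambda>p. snd ?a (chart_inv c p)) has_derivative frechet_derivative (snd ?a \<circ> chart_inv c) (at (snd c (\<gamma> t))))
      (at (snd c (\<gamma> t)) within (\<lambda>t. snd c (\<gamma> t)) ` S)"
    using transition_has_derivative[OF c a(1) t(2) a(2)] by (rule has_derivative_at_withinI)
  from vector_derivative_diff_chain_within[OF D this]
  have "((\<lambda>s. snd ?a (chart_inv c (snd c (\<gamma> s)))) has_vector_derivative tvec M c (\<gamma> t) D) (at t within S)"
    by (simp add: o_def tvec_def)
  then show ?thesis
  proof (rule has_vector_derivative_transform_within[OF _ e(1) t(1)])
    fix s assume "s \<in> S" "dist s t < e"
    then have "s \<in> S \<inter> O'" using e(2) by (auto simp: dist_commute)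
    then have "\<gamma> s \<in> fst c" using O'(2) by blast
    then show "snd ?a (chart_inv c (snd c (\<gamma> s))) = (snd ?a \<circ> \<gamma>) s" using c by simp
  qed
qed

lemma velocity_eq:
  assumes \<gamma>: "continuous_map (top_of_set {a..b}) (manifold_topology M) \<gamma>" and c: "c \<in> charts M"
    and t: "t \<in> {a<..<b}" "\<gamma> t \<in> fst c" and D: "((\<lambda>t. snd c (\<gamma> t)) has_vector_derivative D) (at t within {a..b})"
  shows "velocity M \<gamma> t = tvec M c (\<gamma> t) D"
proof -
  have "((snd (chart_at M (\<gamma> t)) \<circ> \<gamma>) has_vector_derivative tvec M c (\<gamma> t) D) (at t within {a..b})"
    using velocity_chart[OF \<gamma> c _ t(2) D] t by simp
  moreover have "at t within {a..b} = at t" using t by (intro at_within_interior) simp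
  ultimately show ?thesis by (simp add: velocity_def vector_derivative_at)
qed

text \<open>The charts used by \<open>velocity\<close> may jump along the curve, yet the speed is
  continuous inside the segment: near each time it can be computed in one fixed chart from the
  continuous derivative there, because the length of a tangent vector does not depend on the
  chart.\<close>

lemma speed_integrable_segment:
  assumes seg: "C1_segment M \<gamma> a b" and ab: "a < b"
  shows "(\<lambda>t. tnorm M (\<gamma> t) (velocity M \<gamma> t)) integrable_on {a..b}"
proof -
  \<comment> \<open>Derivatives within \<open>{a..b}\<close> extend the speed continuously to the
    endpoints. \<open>velocity\<close> uses two-sided derivatives and may differ from them, but only
    at \<open>a\<close> and \<open>b\<close>.\<close>
  define s where "s t = tnorm M (\<gamma> t) (vector_derivative (snd (chart_at M (\<gamma> t)) \<circ> \<gamma>) (at t within {a..b}))" for t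
  note \<gamma> = C1_segment_continuous[OF seg]
  have pts: "\<gamma> t \<in> points M" if "t \<in> {a..b}" for t
    using continuous_map_image_subset_topspace[OF \<gamma>] that by auto
  have "continuous (at t0 within {a..b}) s" if t0: "t0 \<in> {a..b}" for t0
  proof -
    define c where "c = chart_at M (\<gamma> t0)"
    have c: "c \<in> charts M" "\<gamma> t0 \<in> fst c" using chart_at pts[OF t0] by (auto simp: c_def)
    obtain D where D: "\<And>t. t \<in> {a..b} \<Longrightarrow> \<gamma> t \<in> fst c \<Longrightarrow>
        ((\<lambda>t. snd c (\<gamma> t)) has_vector_derivative D t) (at t within {a..b})"
      "continuous_on {t\<in>{a..b}. \<gamma> t \<in> fst c} D"
      using C1_segment_derivative[OF seg c(1)] by blast
    obtain O' where O': "open O'" "{t\<in>{a..b}. \<gamma> t \<in> fst c} = {a..b} \<inter> O'"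
      using curve_in_chart_open[OF \<gamma> c(1)] .
    let ?T = "{t\<in>{a..b}. \<gamma> t \<in> fst c}"
    have s: "s t = sqrt (\<Sum>b\<in>Basis. \<Sum>b'\<in>Basis. (D t \<bullet> b) * (D t \<bullet> b') * metric_coord c (snd c (\<gamma> t)) b b')"
      if t: "t \<in> ?T" for t
    proof -
      have "vector_derivative (snd (chart_at M (\<gamma> t)) \<circ> \<gamma>) (at t within {a..b}) = tvec M c (\<gamma> t) (D t)"
        using velocity_chart[OF \<gamma> c(1) _ _ D(1)] t ab
        by (intro vector_derivative_within_closed_interval) auto
      then have "s t = sqrt (metric_coord c (snd c (\<gamma> t)) (D t) (D t))"
        using t c by (simp add: s_def tnorm_def metric_coord_def)
      then show ?thesis
        using bilinear_comb[OF bilinear_metric_coord[OF c(1)], of "snd c (\<gamma> t)" "D t" "D t"] t by auto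
    qed
    have "continuous_on ?T (\<lambda>t. snd c (\<gamma> t))"
      unfolding continuous_on_eq_continuous_within
    proof
      fix t assume t: "t \<in> ?T"
      then have "continuous (at t within {a..b}) (\<lambda>t. snd c (\<gamma> t))"
        using has_vector_derivative_continuous[OF D(1)] by simp
      then show "continuous (at t within ?T) (\<lambda>t. snd c (\<gamma> t))"
        by (rule continuous_within_subset) auto
    qed
    then have mc: "continuous_on ?T (\<lambda>t. metric_coord c (snd c (\<gamma> t)) b b')" for b b'
      by (rule continuous_on_compose2[OF C_k_on_continuous[OF C_k_on_metric_coord[OF c(1) order_refl]]]) auto
    have "continuous_on ?T (\<lambda>t. sqrt (\<Sum>b\<in>Basis. \<Sum>b'\<in>Basis. (D t \<bullet> b) * (D t \<bullet> b') * metric_coord c (snd c (\<gamma> t)) b b'))"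
      by (intro continuous_intros mc D(2))
    then have "continuous_on ?T s"
      by (rule continuous_on_eq) (simp only: s)
    then have "continuous (at t0 within ?T) s"
      using t0 c by (auto simp: continuous_on_eq_continuous_within)
    moreover have "at t0 within ?T = at t0 within {a..b}"
      using O' t0 c by (intro at_within_nhd[of t0 O']) auto
    ultimately show ?thesis by simp
  qed
  then have int: "s integrable_on {a..b}"
    by (intro integrable_continuous_interval) (simp add: continuous_on_eq_continuous_within)
  have eq: "tnorm M (\<gamma> t) (velocity M \<gamma> t) = s t" if "t \<in> {a..b} - {a, b}" for t
  proof -
    have "at t within {a..b} = at t" using that by (intro at_within_interior) auto
    then show ?thesis by (simp add: s_def velocity_def)
  qed
  show ?thesis
    by (rule integrable_spike_finite[where S = "{a, b}", OF _ eq int]) simp_all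
qed

lemma piecewise_C1_curveE:
  assumes "piecewise_C1_curve M \<gamma>"
  obtains P where "finite P" "0 \<in> P" "1 \<in> P" "P \<subseteq> {0..1}"
    "\<And>a b. a \<in> P \<Longrightarrow> b \<in> P \<Longrightarrow> a < b \<Longrightarrow> P \<inter> {a<..<b} = {} \<Longrightarrow> C1_segment M \<gamma> a b"
proof -
  obtain P where P: "finite P" "{0, 1} \<subseteq> P" "P \<subseteq> {0..1}"
    and seg: "\<forall>a\<in>P. \<forall>b\<in>P. a < b \<and> P \<inter> {a<..<b} = {} \<longrightarrow> C1_segment M \<gamma> a b"
    using assms unfolding piecewise_C1_curve_def by (elim exE conjE)
  show thesis
  proof (rule that[OF P(1) _ _ P(3)])
    show "0 \<in> P" "1 \<in> P" using P(2) by simp_all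
    show "C1_segment M \<gamma> a b" if "a \<in> P" "b \<in> P" "a < b" "P \<inter> {a<..<b} = {}" for a b
      using seg[rule_format, OF that(1,2)] that(3,4) by simp
  qed
qed

lemma speed_integrable:
  assumes "piecewise_C1_curve M \<gamma>"
  shows "(\<lambda>t. tnorm M (\<gamma> t) (velocity M \<gamma> t)) integrable_on {0..1}"
proof -
  obtain P where P: "finite P" "0 \<in> P" "1 \<in> P"
    "\<And>a b. a \<in> P \<Longrightarrow> b \<in> P \<Longrightarrow> a < b \<Longrightarrow> P \<inter> {a<..<b} = {} \<Longrightarrow> C1_segment M \<gamma> a b"
    by (rule piecewise_C1_curveE[OF assms]) (rule that; assumption)
  show ?thesis
  proof (rule consecutive_induct[OF P(1-3)])
    fix u v w :: real
    assume "u < v" "v < w" and int: "(\<lambda>t. tnorm M (\<gamma> t) (velocity M \<gamma> t)) integrable_on {u..v}"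
      "(\<lambda>t. tnorm M (\<gamma> t) (velocity M \<gamma> t)) integrable_on {v..w}"
    then show "(\<lambda>t. tnorm M (\<gamma> t) (velocity M \<gamma> t)) integrable_on {u..w}"
      using Henstock_Kurzweil_Integration.integrable_combine[OF _ _ int] by simp
  qed (simp_all add: speed_integrable_segment P(4))
qed

lemma piecewise_C1_continuous:
  assumes "piecewise_C1_curve M \<gamma>"
  shows "continuous_map (top_of_set {0..1}) (manifold_topology M) \<gamma>"
proof -
  obtain P where P: "finite P" "0 \<in> P" "1 \<in> P"
    "\<And>a b. a \<in> P \<Longrightarrow> b \<in> P \<Longrightarrow> a < b \<Longrightarrow> P \<inter> {a<..<b} = {} \<Longrightarrow> C1_segment M \<gamma> a b"
    by (rule piecewise_C1_curveE[OF assms]) (rule that; assumption)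
  show ?thesis
  proof (rule consecutive_induct[OF P(1-3)])
    fix u v w :: real
    assume uvw: "u < v" "v < w" "continuous_map (top_of_set {u..v}) (manifold_topology M) \<gamma>"
      "continuous_map (top_of_set {v..w}) (manifold_topology M) \<gamma>"
    have eq: "{u..w} = {u..v} \<union> {v..w}" using uvw by auto
    show "continuous_map (top_of_set {u..w}) (manifold_topology M) \<gamma>"
      unfolding continuous_map_closedin
    proof (intro conjI allI impI)
      show "\<gamma> \<in> topspace (top_of_set {u..w}) \<rightarrow> topspace (manifold_topology M)"
        using uvw(3,4) by (auto simp: eq continuous_map_def Pi_iff)
      fix C assume C: "closedin (manifold_topology M) C"
      have "closed {t \<in> {u..v}. \<gamma> t \<in> C}" "closed {t \<in> {v..w}. \<gamma> t \<in> C}"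
        using closedin_continuous_map_preimage[OF uvw(3) C] closedin_continuous_map_preimage[OF uvw(4) C]
        by (auto intro: closedin_closed_trans)
      moreover have "{t \<in> topspace (top_of_set {u..w}). \<gamma> t \<in> C} = {t \<in> {u..v}. \<gamma> t \<in> C} \<union> {t \<in> {v..w}. \<gamma> t \<in> C}"
        by (auto simp: eq)
      ultimately show "closedin (top_of_set {u..w}) {t \<in> topspace (top_of_set {u..w}). \<gamma> t \<in> C}"
        by (intro closed_subset) auto
    qed
  qed (auto intro: C1_segment_continuous P(4))
qed

lemma continuous_map_chart:
  assumes c: "c \<in> charts M"
  shows "continuous_map (subtopology (manifold_topology M) (fst c)) euclidean (snd c)"
  unfolding continuous_map
proof (intro conjI allI impI)
  fix Q :: "'e set" assume "openin euclidean Q"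
  then have "openin (manifold_topology M) {x \<in> fst c. snd c x \<in> Q}" using openin_chart[OF c] by simp
  moreover have "{x \<in> topspace (subtopology (manifold_topology M) (fst c)). snd c x \<in> Q} =
      fst c \<inter> {x \<in> fst c. snd c x \<in> Q}"
    using chart_points[OF c] by auto
  ultimately show "openin (subtopology (manifold_topology M) (fst c))
      {x \<in> topspace (subtopology (manifold_topology M) (fst c)). snd c x \<in> Q}"
    by (simp add: openin_subtopology_Int2)
qed auto

text \<open>The coordinate displacement is the integral of the velocity components, whose norm is at
  most the speed divided by \<open>k\<close>. The time \<open>t1\<close> allows for curves that
  start far away and enter the chart late.\<close>

lemma chart_displacement_le_length:
  assumes \<gamma>: "piecewise_C1_curve M \<gamma>" and c: "c \<in> charts M" and t1: "0 \<le> t1" "t1 \<le> 1"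
    and inc: "\<And>t. t \<in> {t1..1} \<Longrightarrow> \<gamma> t \<in> fst c"
    and k: "k > 0" "\<And>t v. t \<in> {t1..1} \<Longrightarrow> k * norm (tcoord M c (\<gamma> t) v) \<le> tnorm M (\<gamma> t) v"
  shows "k * norm (snd c (\<gamma> 1) - snd c (\<gamma> t1)) \<le> curve_length M \<gamma>"
proof -
  obtain P where P: "finite P" "0 \<in> P" "1 \<in> P"
    "\<And>a b. a \<in> P \<Longrightarrow> b \<in> P \<Longrightarrow> a < b \<Longrightarrow> P \<inter> {a<..<b} = {} \<Longrightarrow> C1_segment M \<gamma> a b"
    by (rule piecewise_C1_curveE[OF \<gamma>]) (rule that; assumption)
  let ?s = "\<lambda>t. tnorm M (\<gamma> t) (velocity M \<gamma> t)" and ?f' = "\<lambda>t. tcoord M c (\<gamma> t) (velocity M \<gamma> t)"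
  have sub: "{t1..1} \<subseteq> {0..1}" using t1 by auto
  have cont: "continuous_map (top_of_set {0..1}) (manifold_topology M) \<gamma>"
    using \<gamma> by (rule piecewise_C1_continuous)
  have "((?f') has_integral (snd c (\<gamma> 1) - snd c (\<gamma> t1))) {t1..1}"
  proof (rule fundamental_theorem_of_calculus_interior_strong[OF P(1) t1(2)])
    fix t assume t: "t \<in> {t1<..<1} - P"
    then have "0 < t" "t < 1" "t \<notin> P" using t1 by auto
    then obtain u v where uv: "u \<in> P" "v \<in> P" "u < t" "t < v" "P \<inter> {u<..<v} = {}"
      using between_consecutive[OF P(1,2,3)] by blast
    then have seg: "C1_segment M \<gamma> u v" by (intro P(4)) auto
    obtain D where D: "\<And>t. t \<in> {u..v} \<Longrightarrow> \<gamma> t \<in> fst c \<Longrightarrow>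
        ((\<lambda>t. snd c (\<gamma> t)) has_vector_derivative D t) (at t within {u..v})"
      using C1_segment_derivative[OF seg c] by metis
    have tc: "\<gamma> t \<in> fst c" using inc t by auto
    have "velocity M \<gamma> t = tvec M c (\<gamma> t) (D t)"
      using velocity_eq[OF C1_segment_continuous[OF seg] c _ tc D] uv tc by auto
    then have "?f' t = D t" using c tc by simp
    moreover have "at t within {u..v} = at t" using uv by (intro at_within_interior) auto
    ultimately show "((\<lambda>t. snd c (\<gamma> t)) has_vector_derivative ?f' t) (at t)"
      using D[of t] uv tc by simp
  next
    have "continuous_map (top_of_set {t1..1}) (manifold_topology M) \<gamma>"
      using continuous_map_from_subtopology_mono[OF cont sub] .
    then have "continuous_map (top_of_set {t1..1}) (subtopology (manifold_topology M) (fst c)) \<gamma>"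
      using inc by (auto simp: continuous_map_in_subtopology)
    from continuous_map_compose[OF this continuous_map_chart[OF c]]
    show "continuous_on {t1..1} (\<lambda>t. snd c (\<gamma> t))" by (simp add: o_def)
  qed
  then have f': "?f' integrable_on {t1..1}" "integral {t1..1} ?f' = snd c (\<gamma> 1) - snd c (\<gamma> t1)"
    by (auto simp: has_integral_integrable integral_unique)
  have s: "?s integrable_on {0..1}" using \<gamma> by (rule speed_integrable)
  then have s1: "?s integrable_on {t1..1}" using sub by (rule integrable_on_subinterval)
  have "norm (integral {t1..1} ?f') \<le> integral {t1..1} (\<lambda>t. ?s t / k)"
  proof (rule integral_norm_bound_integral[OF f'(1)])
    show "(\<lambda>t. ?s t / k) integrable_on {t1..1}" using s1 by (rule integrable_on_divide)
    show "norm (?f' t) \<le> ?s t / k" if "t \<in> {t1..1}" for t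
      using k(2)[OF that, of "velocity M \<gamma> t"] k(1) by (simp add: pos_le_divide_eq mult.commute)
  qed
  then have "k * norm (snd c (\<gamma> 1) - snd c (\<gamma> t1)) \<le> integral {t1..1} ?s"
    using k(1) f'(2) by (simp add: pos_le_divide_eq mult.commute)
  \<comment> \<open>Before \<open>t1\<close> the curve may be outside the chart; that part
    contributes a nonnegative amount.\<close>
  also have "\<dots> \<le> integral {0..1} ?s"
  proof (rule integral_subset_le[OF sub s1 s], rule ballI)
    fix t :: real assume "t \<in> {0..1}"
    then have "\<gamma> t \<in> points M" using continuous_map_image_subset_topspace[OF cont] by auto
    then show "0 \<le> ?s t" by (rule tnorm_nonneg)
  qed
  finally show ?thesis by (simp add: curve_length_def)
qed

section \<open>Straight segments in a chart\<close>

definition chart_segment :: "('a, 'e) chart \<Rightarrow> 'e \<Rightarrow> 'e \<Rightarrow> real \<Rightarrow> 'a" where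
  "chart_segment c p q t = chart_inv c (p + t *\<^sub>R (q - p))"

lemma line_in_convex:
  assumes "convex K" "p \<in> K" "q \<in> K" "t \<in> {0..1}"
  shows "p + t *\<^sub>R (q - p) \<in> K"
  using convexD_alt[OF assms(1-3), of t] assms(4) by (simp add: algebra_simps)

lemma continuous_map_chart_inv:
  assumes c: "c \<in> charts M"
  shows "continuous_map (top_of_set (snd c ` fst c)) (manifold_topology M) (chart_inv c)"
  unfolding continuous_map
proof (intro conjI allI impI)
  show "chart_inv c ` topspace (top_of_set (snd c ` fst c)) \<subseteq> topspace (manifold_topology M)"
    using chart_points[OF c] c by auto
  fix W assume W: "openin (manifold_topology M) W"
  have "{p \<in> topspace (top_of_set (snd c ` fst c)). chart_inv c p \<in> W} = snd c ` (W \<inter> fst c)"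
    using overlap_image[OF c, of W] by simp
  moreover have "openin (top_of_set (snd c ` fst c)) (snd c ` (W \<inter> fst c))"
    using open_chart_overlap[OF W c] by (intro open_subset) auto
  ultimately show "openin (top_of_set (snd c ` fst c)) {p \<in> topspace (top_of_set (snd c ` fst c)). chart_inv c p \<in> W}"
    by simp
qed

lemma chart_segment_C1:
  assumes c: "c \<in> charts M" and K: "convex K" "K \<subseteq> snd c ` fst c" and p: "p \<in> K" and q: "q \<in> K"
  shows "C1_segment M (chart_segment c p q) 0 1"
proof (rule C1_segmentI)
  let ?l = "\<lambda>t. p + t *\<^sub>R (q - p)"
  have l: "?l t \<in> snd c ` fst c" if "t \<in> {0..1}" for t
    using line_in_convex[OF K(1) p q that] K(2) by blast
  have l': "(?l has_vector_derivative (q - p)) (at t within S)" for t S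
    by (auto intro!: derivative_eq_intros)
  have lc: "continuous_on S ?l" for S by (intro continuous_intros)
  have "continuous_map (top_of_set {0..1}) (top_of_set (snd c ` fst c)) ?l"
    using lc l by (auto simp: continuous_map_in_subtopology)
  from continuous_map_compose[OF this continuous_map_chart_inv[OF c]]
  show "continuous_map (top_of_set {0..1}) (manifold_topology M) (chart_segment c p q)"
    by (simp add: o_def chart_segment_def[abs_def])
  fix d assume d: "d \<in> charts M"
  let ?T = "\<lambda>p. snd d (chart_inv c p)"
  let ?S = "snd c ` (fst c \<inter> fst d)"
  let ?D = "\<lambda>t. frechet_derivative ?T (at (?l t)) (q - p)"
  have lS: "?l t \<in> ?S" if t: "t \<in> {0..1}" "chart_segment c p q t \<in> fst d" for t
  proof -
    obtain x where x: "x \<in> fst c" "?l t = snd c x" using l[OF t(1)] by auto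
    then show ?thesis using t(2) c by (simp add: chart_segment_def)
  qed
  have "((\<lambda>t. snd d (chart_segment c p q t)) has_vector_derivative ?D t) (at t within {0..1})"
    if t: "t \<in> {0..1}" "chart_segment c p q t \<in> fst d" for t
  proof -
    have "(?T has_derivative frechet_derivative ?T (at (?l t))) (at (?l t) within ?l ` {0..1})"
      by (rule has_derivative_at_withinI[OF differentiable_has_frechet_derivative[OF
            smooth_on_differentiable[OF smooth_transition[OF c d] lS[OF t]]]])
    from vector_derivative_diff_chain_within[OF l' this]
    show ?thesis by (simp add: o_def chart_segment_def)
  qed
  moreover have "continuous_on {t \<in> {0..1}. chart_segment c p q t \<in> fst d} ?D"
    by (rule continuous_on_compose2[OF C_k_on_continuous[OF C_k_on_derivative[OF
            smooth_on_C_k[OF smooth_transition[OF c d], of "Suc 0"]]] lc]) (use lS in auto)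
  ultimately show "\<exists>D. (\<forall>t\<in>{0..1}. chart_segment c p q t \<in> fst d \<longrightarrow>
        ((\<lambda>t. snd d (chart_segment c p q t)) has_vector_derivative D t) (at t within {0..1})) \<and>
        continuous_on {t\<in>{0..1}. chart_segment c p q t \<in> fst d} D"
    by (intro exI[of _ ?D]) simp
qed

lemma C1_segment_piecewise: "C1_segment M \<gamma> 0 1 \<Longrightarrow> piecewise_C1_curve M \<gamma>"
  unfolding piecewise_C1_curve_def by (intro exI[of _ "{0, 1}"]) auto

lemma chart_segment_length:
  assumes c: "c \<in> charts M" and K: "convex K" "K \<subseteq> snd c ` fst c" and p: "p \<in> K" and q: "q \<in> K"
    and B: "\<And>x v. x \<in> fst c \<Longrightarrow> snd c x \<in> K \<Longrightarrow> tnorm M x v \<le> B * norm (tcoord M c x v)"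
  shows "curve_length M (chart_segment c p q) \<le> B * norm (q - p)"
proof -
  let ?\<gamma> = "chart_segment c p q" and ?l = "\<lambda>t. p + t *\<^sub>R (q - p)"
  let ?s = "\<lambda>t. tnorm M (?\<gamma> t) (velocity M ?\<gamma> t)"
  note seg = chart_segment_C1[OF assms(1-5)]
  have lK: "?l t \<in> K" if "t \<in> {0..1}" for t using line_in_convex[OF K(1) p q that] .
  have in_c: "?\<gamma> t \<in> fst c" "snd c (?\<gamma> t) = ?l t" if "t \<in> {0..1}" for t
    using lK[OF that] K(2) by (auto simp: chart_segment_def chart_inv_in subset_iff)
  have s: "?s t \<le> B * norm (q - p)" if t: "t \<in> {0<..<1}" for t
  proof -
    have "((\<lambda>t. snd c (?\<gamma> t)) has_vector_derivative (q - p)) (at t within {0..1})"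
    proof (rule has_vector_derivative_transform[where f = ?l])
      show "(?l has_vector_derivative (q - p)) (at t within {0..1})"
        by (auto intro!: derivative_eq_intros)
    qed (use t in_c in auto)
    then have "velocity M ?\<gamma> t = tvec M c (?\<gamma> t) (q - p)"
      using velocity_eq[OF C1_segment_continuous[OF seg] c t] in_c t by simp
    moreover have "snd c (?\<gamma> t) \<in> K" using in_c lK t by simp
    ultimately show ?thesis using B[of "?\<gamma> t" "velocity M ?\<gamma> t"] in_c(1)[of t] c t by simp
  qed
  have "?s integrable_on {0..1}" by (rule speed_integrable[OF C1_segment_piecewise[OF seg]])
  \<comment> \<open>The velocity is identified at interior times only; the open interval discards
    the endpoints without changing the integral.\<close>
  then have int: "?s integrable_on {0<..<1}" by (simp add: integrable_on_open_interval_real)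
  have "curve_length M ?\<gamma> = integral {0<..<1} ?s"
    unfolding curve_length_def by (rule integral_open_interval_real)
  also have "\<dots> \<le> integral {0<..<1} (\<lambda>t::real. B * norm (q - p))"
    by (rule integral_le[OF int _ s]) (auto simp: integrable_on_open_interval_real)
  also have "\<dots> = B * norm (q - p)"
    by (rule trans[OF integral_open_interval_real[symmetric]]) simp
  finally show ?thesis .
qed

section \<open>Joining points by piecewise smooth curves\<close>

text \<open>Unless some curve joins the points, \<open>riemannian_dist\<close> is the infimum of an
  empty set of reals, whose value carries no information. Reachability supplies the
  nonemptiness.\<close>

definition reachable :: "'a \<Rightarrow> 'a \<Rightarrow> bool" where
  "reachable p q \<longleftrightarrow> (\<exists>\<gamma>. piecewise_C1_curve M \<gamma> \<and> \<gamma> 0 = p \<and> \<gamma> 1 = q)"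

lemma reachable_chart:
  assumes c: "c \<in> charts M" and K: "convex K" "K \<subseteq> snd c ` fst c"
    and x: "x \<in> fst c" "snd c x \<in> K" and y: "y \<in> fst c" "snd c y \<in> K"
  shows "reachable x y"
  unfolding reachable_def
  using C1_segment_piecewise[OF chart_segment_C1[OF c K x(2) y(2)]] x y c
  by (intro exI[of _ "chart_segment c (snd c x) (snd c y)"]) (simp add: chart_segment_def)

lemma C1_segment_cong:
  assumes "\<And>t. t \<in> {a..b} \<Longrightarrow> \<gamma> t = \<gamma>' t" and "C1_segment M \<gamma> a b"
  shows "C1_segment M \<gamma>' a b"
proof (rule C1_segmentI)
  show "continuous_map (top_of_set {a..b}) (manifold_topology M) \<gamma>'"
    using continuous_map_eq[OF C1_segment_continuous[OF assms(2)]] assms(1) by simp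
  fix c assume c: "c \<in> charts M"
  obtain D where D: "\<And>t. t \<in> {a..b} \<Longrightarrow> \<gamma> t \<in> fst c \<Longrightarrow>
        ((\<lambda>t. snd c (\<gamma> t)) has_vector_derivative D t) (at t within {a..b})"
      "continuous_on {t\<in>{a..b}. \<gamma> t \<in> fst c} D"
    by (rule C1_segment_derivative[OF assms(2) c]) (rule that; assumption)
  have "((\<lambda>t. snd c (\<gamma>' t)) has_vector_derivative D t) (at t within {a..b})"
    if "t \<in> {a..b}" "\<gamma>' t \<in> fst c" for t
    by (rule has_vector_derivative_transform[OF that(1) _ D(1)[OF that(1)]]) (use assms(1) that in auto)
  moreover have "{t\<in>{a..b}. \<gamma>' t \<in> fst c} = {t\<in>{a..b}. \<gamma> t \<in> fst c}" using assms(1) by auto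
  ultimately show "\<exists>D. (\<forall>t\<in>{a..b}. \<gamma>' t \<in> fst c \<longrightarrow>
        ((\<lambda>t. snd c (\<gamma>' t)) has_vector_derivative D t) (at t within {a..b})) \<and>
        continuous_on {t\<in>{a..b}. \<gamma>' t \<in> fst c} D"
    using D(2) by (intro exI[of _ D]) simp
qed

lemma C1_segment_affine:
  assumes seg: "C1_segment M \<gamma> (m * a + d) (m * b + d)" and m: "m > 0"
  shows "C1_segment M (\<lambda>t. \<gamma> (m * t + d)) a b"
proof (rule C1_segmentI)
  let ?l = "\<lambda>t. m * t + d"
  have l: "?l ` {a..b} \<subseteq> {?l a..?l b}" using m by auto
  have l': "(?l has_vector_derivative m) (at t within S)" for t S
    by (auto intro!: derivative_eq_intros simp: has_real_derivative_iff_has_vector_derivative[symmetric])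
  have lc: "continuous_on S ?l" for S by (intro continuous_intros)
  have "continuous_map (top_of_set {a..b}) (top_of_set {?l a..?l b}) ?l"
    using lc l by (auto simp: continuous_map_in_subtopology)
  from continuous_map_compose[OF this C1_segment_continuous[OF seg]]
  show "continuous_map (top_of_set {a..b}) (manifold_topology M) (\<lambda>t. \<gamma> (m * t + d))"
    by (simp add: o_def)
  fix c assume c: "c \<in> charts M"
  obtain D where D: "\<And>t. t \<in> {?l a..?l b} \<Longrightarrow> \<gamma> t \<in> fst c \<Longrightarrow>
        ((\<lambda>t. snd c (\<gamma> t)) has_vector_derivative D t) (at t within {?l a..?l b})"
      "continuous_on {t\<in>{?l a..?l b}. \<gamma> t \<in> fst c} D"
    by (rule C1_segment_derivative[OF seg c]) (rule that; assumption)
  have "((\<lambda>t. snd c (\<gamma> (?l t))) has_vector_derivative m *\<^sub>R D (?l t)) (at t within {a..b})"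
    if t: "t \<in> {a..b}" "\<gamma> (?l t) \<in> fst c" for t
  proof -
    have "?l t \<in> {?l a..?l b}" using l t by blast
    from has_vector_derivative_within_subset[OF D(1)[OF this t(2)] l]
    show ?thesis using vector_diff_chain_within[OF l'] by (simp add: o_def)
  qed
  moreover have "continuous_on {t\<in>{a..b}. \<gamma> (?l t) \<in> fst c} (\<lambda>t. m *\<^sub>R D (?l t))"
    by (intro continuous_on_scaleR continuous_on_const continuous_on_compose2[OF D(2) lc])
      (use m in \<open>auto intro!: mult_left_mono\<close>)
  ultimately show "\<exists>D. (\<forall>t\<in>{a..b}. \<gamma> (?l t) \<in> fst c \<longrightarrow>
        ((\<lambda>t. snd c (\<gamma> (?l t))) has_vector_derivative D t) (at t within {a..b})) \<and>
        continuous_on {t\<in>{a..b}. \<gamma> (?l t) \<in> fst c} D"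
    by (intro exI[of _ "\<lambda>t. m *\<^sub>R D (?l t)"]) simp
qed

lemma reachable_trans:
  assumes "reachable p q" "reachable q r"
  shows "reachable p r"
proof -
  obtain \<gamma>1 where \<gamma>1: "piecewise_C1_curve M \<gamma>1" "\<gamma>1 0 = p" "\<gamma>1 1 = q"
    using assms(1) by (auto simp: reachable_def)
  obtain \<gamma>2 where \<gamma>2: "piecewise_C1_curve M \<gamma>2" "\<gamma>2 0 = q" "\<gamma>2 1 = r"
    using assms(2) by (auto simp: reachable_def)
  obtain P1 where P1: "finite P1" "0 \<in> P1" "1 \<in> P1" "P1 \<subseteq> {0..1}"
    "\<And>a b. a \<in> P1 \<Longrightarrow> b \<in> P1 \<Longrightarrow> a < b \<Longrightarrow> P1 \<inter> {a<..<b} = {} \<Longrightarrow> C1_segment M \<gamma>1 a b"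
    by (rule piecewise_C1_curveE[OF \<gamma>1(1)]) (rule that; assumption)
  obtain P2 where P2: "finite P2" "0 \<in> P2" "1 \<in> P2" "P2 \<subseteq> {0..1}"
    "\<And>a b. a \<in> P2 \<Longrightarrow> b \<in> P2 \<Longrightarrow> a < b \<Longrightarrow> P2 \<inter> {a<..<b} = {} \<Longrightarrow> C1_segment M \<gamma>2 a b"
    by (rule piecewise_C1_curveE[OF \<gamma>2(1)]) (rule that; assumption)
  \<comment> \<open>Concatenation at double speed. The summands \<open>0\<close> and
    \<open>- 1\<close> match the affine form in \<open>C1_segment_affine\<close>.\<close>
  define \<gamma> where "\<gamma> t = (if t \<le> 1/2 then \<gamma>1 (2 * t + 0) else \<gamma>2 (2 * t + (- 1)))" for t
  define P where "P = (\<lambda>t. t / 2) ` P1 \<union> (\<lambda>t. (t + 1) / 2) ` P2"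
  have half: "1/2 \<in> P" using P1(3) by (auto simp: P_def)
  have low: "2 * t \<in> P1" if t: "t \<in> P" "t \<le> 1/2" for t
  proof -
    have "t \<in> (\<lambda>t. t / 2) ` P1 \<or> t \<in> (\<lambda>t. (t + 1) / 2) ` P2" using t(1) by (simp add: P_def)
    then show ?thesis
    proof
      assume "t \<in> (\<lambda>t. (t + 1) / 2) ` P2"
      then obtain s where "s \<in> P2" "t = (s + 1) / 2" by auto
      then have "2 * t = 1" using t(2) P2(4) by auto
      then show ?thesis using P1(3) by simp
    qed auto
  qed
  have high: "2 * t - 1 \<in> P2" if t: "t \<in> P" "1/2 \<le> t" for t
  proof -
    have "t \<in> (\<lambda>t. t / 2) ` P1 \<or> t \<in> (\<lambda>t. (t + 1) / 2) ` P2" using t(1) by (simp add: P_def)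
    then show ?thesis
    proof
      assume "t \<in> (\<lambda>t. t / 2) ` P1"
      then obtain s where "s \<in> P1" "t = s / 2" by auto
      then have "2 * t - 1 = 0" using t(2) P1(4) by auto
      then show ?thesis using P2(2) by simp
    next
      assume "t \<in> (\<lambda>t. (t + 1) / 2) ` P2"
      then obtain s where "s \<in> P2" "t = (s + 1) / 2" by auto
      then show ?thesis by (simp add: field_simps)
    qed
  qed
  have "C1_segment M \<gamma> a b" if ab: "a \<in> P" "b \<in> P" "a < b" "P \<inter> {a<..<b} = {}" for a b
  proof -
    \<comment> \<open>As \<open>1/2\<close> is itself a break point, consecutive break points lie on
      one side of the junction.\<close>
    have "\<not> (a < 1/2 \<and> 1/2 < b)" using half ab(4) by auto
    then consider "b \<le> 1/2" | "1/2 \<le> a" by linarith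
    then show ?thesis
    proof cases
      case 1
      have "P1 \<inter> {2 * a<..<2 * b} = {}"
      proof (rule ccontr)
        assume "P1 \<inter> {2 * a<..<2 * b} \<noteq> {}"
        then obtain s where s: "s \<in> P1" "2 * a < s" "s < 2 * b" by auto
        then have "s / 2 \<in> P \<inter> {a<..<b}" by (auto simp: P_def)
        then show False using ab(4) by blast
      qed
      then have "C1_segment M \<gamma>1 (2 * a + 0) (2 * b + 0)"
        using P1(5)[of "2 * a" "2 * b"] low ab 1 by simp
      from C1_segment_affine[OF this] have "C1_segment M (\<lambda>t. \<gamma>1 (2 * t + 0)) a b" by simp
      then show ?thesis by (rule C1_segment_cong[rotated]) (use 1 in \<open>simp add: \<gamma>_def\<close>)
    next
      case 2
      have "P2 \<inter> {2 * a - 1<..<2 * b - 1} = {}"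
      proof (rule ccontr)
        assume "P2 \<inter> {2 * a - 1<..<2 * b - 1} \<noteq> {}"
        then obtain s where s: "s \<in> P2" "2 * a - 1 < s" "s < 2 * b - 1" by auto
        then have "(s + 1) / 2 \<in> P \<inter> {a<..<b}" by (auto simp: P_def)
        then show False using ab(4) by blast
      qed
      then have "C1_segment M \<gamma>2 (2 * a + (- 1)) (2 * b + (- 1))"
        using P2(5)[of "2 * a - 1" "2 * b - 1"] high ab 2 by simp
      from C1_segment_affine[OF this] have "C1_segment M (\<lambda>t. \<gamma>2 (2 * t + (- 1))) a b" by simp
      then show ?thesis
      proof (rule C1_segment_cong[rotated])
        fix t assume t: "t \<in> {a..b}"
        show "\<gamma>2 (2 * t + (- 1)) = \<gamma> t"
        \<comment> \<open>At the junction \<open>\<gamma>\<close> is defined by the first branch; it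
          agrees with the second because both curves pass through \<open>q\<close> there.\<close>
        proof (cases "t = 1/2")
          case True
          show ?thesis unfolding True \<gamma>_def using \<gamma>1(3) \<gamma>2(2) by simp
        next
          case False
          then show ?thesis using t 2 by (simp add: \<gamma>_def)
        qed
      qed
    qed
  qed
  moreover have "finite P" "{0, 1} \<subseteq> P" "P \<subseteq> {0..1}"
    using P1 P2 by (auto simp: P_def image_iff intro: bexI[of _ 0] bexI[of _ 1])
  ultimately have "piecewise_C1_curve M \<gamma>"
    unfolding piecewise_C1_curve_def by (intro exI[of _ P]) simp
  then show ?thesis unfolding reachable_def
    using \<gamma>1 \<gamma>2 by (intro exI[of _ \<gamma>]) (simp add: \<gamma>_def)
qed

lemma reachable_neighbourhood:
  assumes x: "x \<in> points M"
  obtains N where "openin (manifold_topology M) N" "x \<in> N" "\<And>y. y \<in> N \<Longrightarrow> reachable x y \<and> reachable y x"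
proof -
  define c where "c = chart_at M x"
  have c: "c \<in> charts M" "x \<in> fst c" using chart_at[OF x] by (auto simp: c_def)
  obtain r where r: "r > 0" "ball (snd c x) r \<subseteq> snd c ` fst c"
    using open_chart_image[OF c(1)] c(2) open_contains_ball by blast
  show thesis
  proof (rule that[of "{y \<in> fst c. snd c y \<in> ball (snd c x) r}"])
    show "openin (manifold_topology M) {y \<in> fst c. snd c y \<in> ball (snd c x) r}"
      using openin_chart[OF c(1) open_ball] .
    show "reachable x y \<and> reachable y x" if "y \<in> {y \<in> fst c. snd c y \<in> ball (snd c x) r}" for y
      using that c r reachable_chart[OF c(1) convex_ball r(2)] by auto
  qed (use c r in auto)
qed

text \<open>Every point has a neighbourhood whose points are reachable from it and reach it, so the
  set reachable from \<open>x\<close> and its complement are both open. Recording both directions in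
  \<open>reachable_neighbourhood\<close> takes the place of reversing curves.\<close>

lemma connected_reachable:
  assumes conn: "connected_space (manifold_topology M)" and x: "x \<in> points M" and y: "y \<in> points M"
  shows "reachable x y"
proof -
  let ?A = "{z \<in> points M. reachable x z}" and ?B = "{z \<in> points M. \<not> reachable x z}"
  have nb: "\<exists>N. openin (manifold_topology M) N \<and> z \<in> N \<and> (\<forall>y\<in>N. y \<in> points M \<and> (reachable x y \<longleftrightarrow> reachable x z))"
    if z: "z \<in> points M" for z
  proof -
    obtain N where N: "openin (manifold_topology M) N" "z \<in> N" "\<And>y. y \<in> N \<Longrightarrow> reachable z y \<and> reachable y z"
      by (rule reachable_neighbourhood[OF z]) (rule that; assumption)
    have n1: "y \<in> points M" if "y \<in> N" for y using subsetD[OF openin_subset[OF N(1)] that] by simp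
    have n2: "reachable x y \<longleftrightarrow> reachable x z" if "y \<in> N" for y
      using N(3)[OF that] reachable_trans[of x y z] reachable_trans[of x z y] by auto
    show ?thesis
      by (intro exI[of _ N] conjI ballI) (fact N(1) N(2) | erule n1 n2)+
  qed
  have A: "openin (manifold_topology M) ?A"
    unfolding openin_subopen[of _ ?A]
  proof
    fix z assume z: "z \<in> ?A"
    then obtain N where "openin (manifold_topology M) N" "z \<in> N"
      "\<forall>y\<in>N. y \<in> points M \<and> (reachable x y \<longleftrightarrow> reachable x z)" using nb[of z] by auto
    moreover from this(3) z have "N \<subseteq> ?A" by blast
    ultimately show "\<exists>T. openin (manifold_topology M) T \<and> z \<in> T \<and> T \<subseteq> ?A" by (intro exI[of _ N] conjI)
  qed
  have B: "openin (manifold_topology M) ?B"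
    unfolding openin_subopen[of _ ?B]
  proof
    fix z assume z: "z \<in> ?B"
    then obtain N where "openin (manifold_topology M) N" "z \<in> N"
      "\<forall>y\<in>N. y \<in> points M \<and> (reachable x y \<longleftrightarrow> reachable x z)" using nb[of z] by auto
    moreover from this(3) z have "N \<subseteq> ?B" by blast
    ultimately show "\<exists>T. openin (manifold_topology M) T \<and> z \<in> T \<and> T \<subseteq> ?B" by (intro exI[of _ N] conjI)
  qed
  obtain N where "openin (manifold_topology M) N" "x \<in> N" "\<And>y. y \<in> N \<Longrightarrow> reachable x y \<and> reachable y x"
    by (rule reachable_neighbourhood[OF x]) (rule that; assumption)
  then have xA: "x \<in> ?A" using x by simp
  have "topspace (manifold_topology M) \<subseteq> ?A \<union> ?B" "?A \<inter> ?B = {}" by auto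
  then have "?A = {} \<or> ?B = {}"
    using conn[unfolded connected_space_def] A B by blast
  then show ?thesis using xA y by auto
qed

section \<open>Comparison of the distance with the coordinate norm\<close>

lemma curve_length_nonneg:
  assumes "piecewise_C1_curve M \<gamma>"
  shows "0 \<le> curve_length M \<gamma>"
  unfolding curve_length_def
proof (rule integral_nonneg[OF speed_integrable[OF assms]])
  fix t :: real assume "t \<in> {0..1}"
  then have "\<gamma> t \<in> points M"
    using continuous_map_image_subset_topspace[OF piecewise_C1_continuous[OF assms]] by auto
  then show "0 \<le> tnorm M (\<gamma> t) (velocity M \<gamma> t)" by (rule tnorm_nonneg)
qed

text \<open>A set closed in the chart image may acquire limit points outside the chart domain.
  Compactness together with the Hausdorff property excludes this.\<close>

lemma closedin_chart_compact:
  assumes c: "c \<in> charts M" and K: "compact K" "K \<subseteq> snd c ` fst c"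
  shows "closedin (manifold_topology M) {x \<in> fst c. snd c x \<in> K}"
proof -
  have "compactin (top_of_set (snd c ` fst c)) K"
    using K by (simp add: compactin_subtopology)
  from image_compactin[OF this continuous_map_chart_inv[OF c]]
  have "compactin (manifold_topology M) (chart_inv c ` K)" .
  then have "closedin (manifold_topology M) (chart_inv c ` K)"
    using compactin_imp_closedin[OF Hausdorff] by blast
  moreover have "chart_inv c ` K = {x \<in> fst c. snd c x \<in> K}"
  proof
    show "chart_inv c ` K \<subseteq> {x \<in> fst c. snd c x \<in> K}" using K(2) by (auto simp: chart_inv_in subset_iff)
    show "{x \<in> fst c. snd c x \<in> K} \<subseteq> chart_inv c ` K"
    proof clarify
      fix x assume "x \<in> fst c" "snd c x \<in> K"
      then have "x = chart_inv c (snd c x)" using c by simp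
      then show "x \<in> chart_inv c ` K" using \<open>snd c x \<in> K\<close> by blast
    qed
  qed
  ultimately show ?thesis by simp
qed

text \<open>A curve ending at \<open>x0\<close> either stays in the chart ball, or its last portion, from the last
  time outside the ball on, crosses the spherical shell between the radii \<open>r / 2\<close> and \<open>r\<close>.\<close>

lemma curve_length_lower:
  assumes c: "c \<in> charts M" and x0: "x0 \<in> fst c" and r: "r > 0" "cball (snd c x0) r \<subseteq> snd c ` fst c"
    and k: "k > 0" "\<And>x v. x \<in> fst c \<Longrightarrow> snd c x \<in> cball (snd c x0) r \<Longrightarrow> k * norm (tcoord M c x v) \<le> tnorm M x v"
    and \<gamma>: "piecewise_C1_curve M \<gamma>" "\<gamma> 1 = x0"
  shows "k * (r / 2) \<le> curve_length M \<gamma> \<or>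
    \<gamma> 0 \<in> fst c \<and> snd c (\<gamma> 0) \<in> ball (snd c x0) r \<and> k * norm (snd c (\<gamma> 0) - snd c x0) \<le> curve_length M \<gamma>"
proof -
  let ?B = "{x \<in> fst c. snd c x \<in> ball (snd c x0) r}" and ?C = "{x \<in> fst c. snd c x \<in> cball (snd c x0) (r / 2)}"
  have cont: "continuous_map (top_of_set {0..1}) (manifold_topology M) \<gamma>"
    using \<gamma>(1) by (rule piecewise_C1_continuous)
  have len: "k * norm (snd c x0 - snd c (\<gamma> t1)) \<le> curve_length M \<gamma>"
    if t1: "0 \<le> t1" "t1 \<le> 1" and B: "\<And>t. t \<in> {t1..1} \<Longrightarrow> \<gamma> t \<in> ?B" for t1
  proof -
    have "k * norm (snd c (\<gamma> 1) - snd c (\<gamma> t1)) \<le> curve_length M \<gamma>"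
    proof (rule chart_displacement_le_length[OF \<gamma>(1) c t1 _ k(1)])
      fix t v assume t: "t \<in> {t1..1}"
      show "\<gamma> t \<in> fst c" using B[OF t] by simp
      show "k * norm (tcoord M c (\<gamma> t) v) \<le> tnorm M (\<gamma> t) v" using B[OF t] by (intro k(2)) auto
    qed
    then show ?thesis using \<gamma>(2) by simp
  qed
  define S where "S = {t \<in> {0..1}. \<gamma> t \<notin> ?B}"
  show ?thesis
  proof (cases "S = {}")
    case True
    then have B: "\<gamma> t \<in> ?B" if "t \<in> {0..1}" for t using that by (auto simp: S_def)
    show ?thesis using len[of 0] B B[of 0] by (simp add: norm_minus_commute)
  next
    case False
    have "openin (top_of_set {0..1}) {t \<in> topspace (top_of_set {0..1}). \<gamma> t \<in> ?B}"
      using cont openin_chart[OF c open_ball] by (rule openin_continuous_map_preimage)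
    then have "closedin (top_of_set {0..1}) ({0..1} - {t \<in> {0..1}. \<gamma> t \<in> ?B})"
      by (simp add: closedin_diff)
    moreover have "{0..1} - {t \<in> {0..1}. \<gamma> t \<in> ?B} = S" by (auto simp: S_def)
    ultimately have "closed S" using closedin_closed_trans[of "{0..1}" S] by simp
    moreover have bdd: "bdd_above S" by (auto simp: S_def intro: bdd_aboveI[of _ 1])
    ultimately have t0: "Sup S \<in> S" using False by (intro closed_contains_Sup)
    \<comment> \<open>The last time outside the ball: it belongs to \<open>S\<close> because
      \<open>S\<close> is closed, and after it the curve stays in the chart.\<close>
    define t0 where "t0 = Sup S"
    have t0: "t0 \<in> {0..1}" "\<gamma> t0 \<notin> ?B" using t0 by (auto simp: S_def t0_def)
    have "\<gamma> 1 \<in> ?B" using \<gamma>(2) x0 r by simp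
    then have "t0 \<noteq> 1" using t0 by auto
    then have t01: "t0 < 1" using t0 by simp
    have after: "\<gamma> t \<in> ?B" if t: "t0 < t" "t \<le> 1" for t
    proof (rule ccontr)
      assume "\<gamma> t \<notin> ?B"
      then have "t \<in> S" using t t0(1) by (auto simp: S_def)
      then have "t \<le> t0" unfolding t0_def using bdd by (rule cSup_upper)
      then show False using t by simp
    qed
    \<comment> \<open>Otherwise closedness of \<open>?C\<close> would put \<open>\<gamma> t0\<close>
      into \<open>?C\<close>, hence into the open ball, against the choice of
      \<open>t0\<close>.\<close>
    have "\<exists>t1\<in>{t0<..1}. \<gamma> t1 \<notin> ?C"
    proof (rule ccontr)
      assume "\<not> (\<exists>t1\<in>{t0<..1}. \<gamma> t1 \<notin> ?C)"
      then have C: "\<gamma> t \<in> ?C" if "t \<in> {t0<..1}" for t using that by blast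
      have "closedin (top_of_set {0..1}) {t \<in> topspace (top_of_set {0..1}). \<gamma> t \<in> ?C}"
        by (rule closedin_continuous_map_preimage[OF cont closedin_chart_compact[OF c compact_cball]])
          (rule order_trans[OF _ r(2)], use r(1) in auto)
      then have "closed {t \<in> {0..1}. \<gamma> t \<in> ?C}"
        by (auto intro: closedin_closed_trans)
      moreover have "{t0<..1} \<subseteq> {t \<in> {0..1}. \<gamma> t \<in> ?C}" using C t0(1) by auto
      ultimately have "closure {t0<..1} \<subseteq> {t \<in> {0..1}. \<gamma> t \<in> ?C}" by (rule closure_minimal[rotated])
      moreover have "t0 \<in> closure {t0<..1}" using t01 by simp
      ultimately have "\<gamma> t0 \<in> ?C" by blast
      then show False using t0(2) r by auto
    qed
    then obtain t1 where t1: "t0 < t1" "t1 \<le> 1" "\<gamma> t1 \<notin> ?C" by auto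
    have "\<gamma> t1 \<in> ?B" using after t1 by simp
    then have "r / 2 \<le> norm (snd c x0 - snd c (\<gamma> t1))" using t1(3) by (auto simp: dist_norm)
    then have "k * (r / 2) \<le> k * norm (snd c x0 - snd c (\<gamma> t1))" using k(1) by (intro mult_left_mono) auto
    also have "\<dots> \<le> curve_length M \<gamma>" using len[of t1] after t1 t0(1) by auto
    finally show ?thesis by simp
  qed
qed

text \<open>From above, the straight segment in the chart has length at most \<open>B\<close> times
  the displacement. From below, the infimum inherits the alternative of
  \<open>curve_length_lower\<close>; for short curves only its second case remains, which locates
  the starting point.\<close>

lemma riemannian_dist_chart:
  assumes conn: "connected_space (manifold_topology M)" and c: "c \<in> charts M" and x0: "x0 \<in> fst c"
  obtains r k B where "r > 0" "k > 0" "B > 0"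
    "\<And>x. x \<in> fst c \<Longrightarrow> norm (snd c x - snd c x0) < r \<Longrightarrow>
      k * norm (snd c x - snd c x0) \<le> riemannian_dist M x x0 \<and>
      riemannian_dist M x x0 \<le> B * norm (snd c x - snd c x0)"
    "\<And>x. x \<in> points M \<Longrightarrow> riemannian_dist M x x0 < k * r \<Longrightarrow> x \<in> fst c \<and> norm (snd c x - snd c x0) < r"
proof -
  obtain r where r: "r > 0" "cball (snd c x0) r \<subseteq> snd c ` fst c"
    using open_chart_image[OF c] x0 open_contains_cball by blast
  obtain k B where kB: "k > 0" "B > 0"
    "\<And>x v. x \<in> fst c \<Longrightarrow> snd c x \<in> cball (snd c x0) r \<Longrightarrow> k * norm (tcoord M c x v) \<le> tnorm M x v"
    "\<And>x v. x \<in> fst c \<Longrightarrow> snd c x \<in> cball (snd c x0) r \<Longrightarrow> tnorm M x v \<le> B * norm (tcoord M c x v)"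
    by (rule metric_chart_bounds[OF c compact_cball r(2)]) (rule that; assumption)
  let ?curves = "\<lambda>x. {\<gamma>. piecewise_C1_curve M \<gamma> \<and> \<gamma> 0 = x \<and> \<gamma> 1 = x0}"
  have ne: "curve_length M ` ?curves x \<noteq> {}" if "x \<in> points M" for x
    using connected_reachable[OF conn that chart_points[OF c x0]] by (auto simp: reachable_def)
  have lower: "k * (r / 2) \<le> curve_length M \<gamma> \<or>
    x \<in> fst c \<and> snd c x \<in> ball (snd c x0) r \<and> k * norm (snd c x - snd c x0) \<le> curve_length M \<gamma>"
    if "\<gamma> \<in> ?curves x" for \<gamma> x
    using curve_length_lower[OF c x0 r kB(1,3), of \<gamma>] that by auto
  have bdd: "bdd_below (curve_length M ` ?curves x)" for x
    using curve_length_nonneg by (auto intro!: bdd_belowI[of _ 0])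
  show thesis
  \<comment> \<open>The factor 1/2 covers curves that leave the ball: their length is at least
    \<open>k * (r / 2)\<close>, while the displacement is below \<open>r\<close>. The same number is
    the threshold below which a point must lie in the chart ball.\<close>
  proof (rule that[of r "k / 2" B])
    fix x assume x: "x \<in> fst c" "norm (snd c x - snd c x0) < r"
    have xp: "x \<in> points M" using chart_points[OF c x(1)] .
    have "k / 2 * norm (snd c x - snd c x0) \<le> l" if l: "l \<in> curve_length M ` ?curves x" for l
    proof -
      obtain \<gamma> where \<gamma>: "\<gamma> \<in> ?curves x" "l = curve_length M \<gamma>" using l by (rule imageE)
      have 1: "k * norm (snd c x - snd c x0) \<le> k * r" using x(2) kB(1) by (intro mult_left_mono) auto
      have 2: "0 \<le> k * norm (snd c x - snd c x0)" using kB(1) by simp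
      show ?thesis using lower[OF \<gamma>(1)] \<gamma>(2) 1 2 by auto
    qed
    then have "k / 2 * norm (snd c x - snd c x0) \<le> riemannian_dist M x x0"
      unfolding riemannian_dist_def by (intro cInf_greatest ne xp) auto
    moreover have "riemannian_dist M x x0 \<le> B * norm (snd c x - snd c x0)"
    proof -
      let ?\<gamma> = "chart_segment c (snd c x) (snd c x0)"
      have xr: "snd c x \<in> cball (snd c x0) r" using x by (simp add: dist_norm norm_minus_commute)
      have x0r: "snd c x0 \<in> cball (snd c x0) r" using r by simp
      have "?\<gamma> \<in> ?curves x"
        using C1_segment_piecewise[OF chart_segment_C1[OF c convex_cball r(2) xr x0r]] c x x0
        by (simp add: chart_segment_def)
      then have "riemannian_dist M x x0 \<le> curve_length M ?\<gamma>"
        unfolding riemannian_dist_def by (intro cInf_lower bdd) auto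
      also have "\<dots> \<le> B * norm (snd c x0 - snd c x)"
        by (rule chart_segment_length[OF c convex_cball r(2) xr x0r kB(4)])
      finally show ?thesis by (simp add: norm_minus_commute)
    qed
    ultimately show "k / 2 * norm (snd c x - snd c x0) \<le> riemannian_dist M x x0 \<and>
      riemannian_dist M x x0 \<le> B * norm (snd c x - snd c x0)" ..
  next
    fix x assume x: "x \<in> points M" "riemannian_dist M x x0 < k / 2 * r"
    then obtain l where "l \<in> curve_length M ` ?curves x" "l < k / 2 * r"
      using cInf_lessD[OF ne[OF x(1)] x(2)[unfolded riemannian_dist_def]] by blast
    then obtain \<gamma> where \<gamma>: "\<gamma> \<in> ?curves x" "curve_length M \<gamma> < k / 2 * r" by auto
    then show "x \<in> fst c \<and> norm (snd c x - snd c x0) < r"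
      using lower[OF \<gamma>(1)] by (auto simp: dist_norm norm_minus_commute)
  qed (use r kB in auto)
qed

end

section \<open>The KKT vector field in a chart\<close>

text \<open>The rules for \<open>C_k_on\<close> and \<open>has_derivative\<close> handle finite sums
  and scalings; a vector given by its components is brought into that form.\<close>

lemma vec_lambda_axis_sum: "(\<chi> i. a i) = (\<Sum>i\<in>UNIV. a i *\<^sub>R axis i (1::real))"
  using basis_expansion[of "\<chi> i. a i"] by (simp add: scalar_mult_eq_scaleR)

lemma has_derivative_fst_compose:
  assumes "(G has_derivative G') (at (fst q))"
  shows "((\<lambda>q. G (fst q)) has_derivative (\<lambda>v. G' (fst v))) (at q)"
  using diff_chain_at[OF has_derivative_fst[OF has_derivative_ident] assms] by (simp add: o_def)

lemma C_k_on_fst_compose: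
  assumes "open S" "C_k_on n S G"
  shows "C_k_on n (S \<times> UNIV) (\<lambda>q. G (fst q))"
proof -
  have *: "open (S \<times> UNIV)" by (rule open_Times[OF assms(1) open_UNIV])
  show ?thesis
    by (rule C_k_on_compose[OF * assms(1) C_k_on_linear_fun[OF * bounded_linear_fst] assms(2)]) auto
qed

lemma bounded_linear_kkt_components:
  shows "bounded_linear (\<lambda>q :: 'a::real_normed_vector \<times> (real ^ 'l) \<times> (real ^ 'm) \<times> (real ^ 'm). fst (snd q) $ i)"
    and "bounded_linear (\<lambda>q :: 'a \<times> (real ^ 'l) \<times> (real ^ 'm) \<times> (real ^ 'm). fst (snd (snd q)) $ j)"
    and "bounded_linear (\<lambda>q :: 'a \<times> (real ^ 'l) \<times> (real ^ 'm) \<times> (real ^ 'm). snd (snd (snd q)) $ j)"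
    and "bounded_linear (\<lambda>q :: 'a \<times> (real ^ 'l) \<times> (real ^ 'm) \<times> (real ^ 'm). snd (snd (snd q)))"
proof -
  note ss = bounded_linear_compose[OF bounded_linear_snd bounded_linear_snd]
  note n = bounded_linear_compose[OF bounded_linear_vec_nth]
  show "bounded_linear (\<lambda>q :: 'a \<times> (real ^ 'l) \<times> (real ^ 'm) \<times> (real ^ 'm). fst (snd q) $ i)"
    by (rule n[OF bounded_linear_compose[OF bounded_linear_fst bounded_linear_snd]])
  show "bounded_linear (\<lambda>q :: 'a \<times> (real ^ 'l) \<times> (real ^ 'm) \<times> (real ^ 'm). fst (snd (snd q)) $ j)"
    by (rule n[OF bounded_linear_compose[OF bounded_linear_fst ss]])
  show "bounded_linear (\<lambda>q :: 'a \<times> (real ^ 'l) \<times> (real ^ 'm) \<times> (real ^ 'm). snd (snd (snd q)) $ j)"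
    by (rule n[OF bounded_linear_compose[OF bounded_linear_snd ss]])
  show "bounded_linear (\<lambda>q :: 'a \<times> (real ^ 'l) \<times> (real ^ 'm) \<times> (real ^ 'm). snd (snd (snd q)))"
    by (rule bounded_linear_compose[OF bounded_linear_snd ss])
qed

section \<open>Smooth problem data and the gradient of the Lagrangian\<close>

locale kkt_problem = riemannian_connection M conn
  for M :: "('a, 'e::euclidean_space) rmanifold" and conn :: "('a, 'e) connection" +
  fixes f :: "'a \<Rightarrow> real" and h :: "'a \<Rightarrow> real ^ 'l" and g :: "'a \<Rightarrow> real ^ 'm"
  assumes smooth_f: "smooth_fun_on M (points M) f"
    and smooth_h: "smooth_fun_on M (points M) h"
    and smooth_g: "smooth_fun_on M (points M) g"
begin

lemma points_Int_chart: "c \<in> charts M \<Longrightarrow> points M \<inter> fst c = fst c"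
  by (rule Int_absorb1, rule subsetI, erule chart_points)

lemma chart_repr:
  assumes "smooth_fun_on M (points M) F" and c: "c \<in> charts M"
  shows "C_k_on n (snd c ` fst c) (\<lambda>p. F (chart_inv c p))"
  using smooth_on_C_k[OF smooth_fun_on_chart[OF assms]] by (simp add: points_Int_chart[OF c])

lemma smooth_component:
  fixes F :: "'a \<Rightarrow> real ^ 'k"
  assumes "smooth_fun_on M (points M) F"
  shows "smooth_fun_on M (points M) (\<lambda>p. F p $ i)"
  unfolding smooth_fun_on_iff smooth_on_def
proof (intro ballI allI)
  fix d n assume d: "d \<in> charts M"
  show "C_k_on n (snd d ` (points M \<inter> fst d)) (\<lambda>p. F (chart_inv d p) $ i)"
    unfolding points_Int_chart[OF d]
    by (rule C_k_on_bounded_linear[OF bounded_linear_vec_nth open_chart_image[OF d] chart_repr[OF assms d]])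
qed

lemmas smooth_h_component = smooth_component[OF smooth_h]
lemmas smooth_g_component = smooth_component[OF smooth_g]

lemma smooth_lagrangian: "smooth_fun_on M (points M) (lagrangian f h g y z)"
  unfolding smooth_fun_on_iff smooth_on_def lagrangian_def
proof (intro ballI allI)
  fix d n assume d: "d \<in> charts M"
  note S = open_chart_image[OF d]
  show "C_k_on n (snd d ` (points M \<inter> fst d)) (\<lambda>p. f (chart_inv d p) +
      (\<Sum>i\<in>UNIV. y $ i * h (chart_inv d p) $ i) + (\<Sum>i\<in>UNIV. z $ i * g (chart_inv d p) $ i))"
    unfolding points_Int_chart[OF d]
    by (intro C_k_on_add[OF S] C_k_on_sum[OF S] C_k_on_mult[OF S] C_k_on_const
        chart_repr[OF smooth_f d] chart_repr[OF smooth_h_component d] chart_repr[OF smooth_g_component d])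
qed

lemma repr_has_derivative:
  assumes F: "smooth_fun_on M (points M) F" and c: "c \<in> charts M" and x: "x \<in> fst c"
  shows "((\<lambda>p. F (chart_inv c p)) has_derivative
    frechet_derivative (\<lambda>p. F (chart_inv c p)) (at (snd c x))) (at (snd c x))"
  by (rule C_k_on_has_derivative[OF chart_repr[OF F c, of "Suc 0"]]) (use x in simp)

lemma differential_eq:
  assumes F: "smooth_fun_on M (points M) F" and c: "c \<in> charts M" and x: "x \<in> fst c"
  shows "differential M F x v = frechet_derivative (\<lambda>p. F (chart_inv c p)) (at (snd c x)) (tcoord M c x v)"
  by (rule differential_chart[OF c x]) (rule differentiableI[OF repr_has_derivative[OF F c x]])

lemma metric_grad_global:
  "smooth_fun_on M (points M) F \<Longrightarrow> x \<in> points M \<Longrightarrow> rmetric M x (grad M F x) \<xi> = differential M F x \<xi>"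
  using metric_grad[of "points M" F x \<xi>] by simp

lemma differential_lagrangian:
  assumes x: "x \<in> points M"
  shows "differential M (lagrangian f h g y z) x v = differential M f x v +
    (\<Sum>i\<in>UNIV. y $ i * differential M (\<lambda>p. h p $ i) x v) +
    (\<Sum>i\<in>UNIV. z $ i * differential M (\<lambda>p. g p $ i) x v)"
proof -
  define c where "c = chart_at M x"
  have c: "c \<in> charts M" "x \<in> fst c" using chart_at[OF x] by (auto simp: c_def)
  let ?D = "\<lambda>F. frechet_derivative (\<lambda>p. F (chart_inv c p) :: real) (at (snd c x))"
  have "((\<lambda>p. lagrangian f h g y z (chart_inv c p)) has_derivative
      (\<lambda>v. ?D f v + (\<Sum>i\<in>UNIV. y $ i * ?D (\<lambda>p. h p $ i) v) + (\<Sum>i\<in>UNIV. z $ i * ?D (\<lambda>p. g p $ i) v)))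
      (at (snd c x))"
    unfolding lagrangian_def
    by (intro has_derivative_add has_derivative_sum has_derivative_mult_right
        repr_has_derivative[OF smooth_f c] repr_has_derivative[OF smooth_h_component c]
        repr_has_derivative[OF smooth_g_component c])
  from frechet_derivative_eqI[OF this] show ?thesis
    by (simp add: differential_eq[OF smooth_lagrangian c] differential_eq[OF smooth_f c]
        differential_eq[OF smooth_h_component c] differential_eq[OF smooth_g_component c])
qed

text \<open>Uniqueness of the gradient turns linearity of the differential into this splitting.
  Joint smoothness in the point and the multipliers then reduces to smoothness of finitely many
  gradients in the point alone.\<close>

lemma grad_lagrangian:
  assumes x: "x \<in> points M"
  shows "grad M (lagrangian f h g y z) x = grad M f x + grad_comb M h x y + grad_comb M g x z"
proof -
  note B = metric_bilinear[OF x]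
  have lin: "linear (differential M (lagrangian f h g y z) x)"
    by (rule linear_differential[OF smooth_lagrangian x x])
  have "rmetric M x (grad M f x + grad_comb M h x y + grad_comb M g x z) \<xi> =
      differential M (lagrangian f h g y z) x \<xi>" for \<xi>
    unfolding grad_comb_def differential_lagrangian[OF x]
    by (simp add: bilinear_ladd[OF B] linear_sum[OF bilinear_linear_left[OF B]]
        bilinear_lmul[OF B] metric_grad_global smooth_f smooth_h_component smooth_g_component x)
  then have "\<forall>\<xi>. rmetric M x (grad M f x + grad_comb M h x y + grad_comb M g x z) \<xi> =
      differential M (lagrangian f h g y z) x \<xi>" ..
  then show ?thesis using iffD1[OF grad_unique[OF x lin]] by metis
qed

section \<open>The KKT field and its derivative in coordinates\<close>

text \<open>The KKT field in a chart, already split along the multipliers and with the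
  complementarity block as a sum over \<open>axis\<close>, so that only operations with a closure
  rule occur.\<close>

definition kkt_coord ::
  "('a, 'e) chart \<Rightarrow> ('e, 'l, 'm) kkt_point \<Rightarrow> ('e, 'l, 'm) kkt_point" where
  "kkt_coord c q =
    (grad_coord c f (fst q) + (\<Sum>i\<in>UNIV. fst (snd q) $ i *\<^sub>R grad_coord c (\<lambda>x. h x $ i) (fst q)) +
       (\<Sum>i\<in>UNIV. fst (snd (snd q)) $ i *\<^sub>R grad_coord c (\<lambda>x. g x $ i) (fst q)),
     h (chart_inv c (fst q)), g (chart_inv c (fst q)) + snd (snd (snd q)),
     \<Sum>i\<in>UNIV. (fst (snd (snd q)) $ i * snd (snd (snd q)) $ i) *\<^sub>R axis i 1)"

lemma C_k_on_grad_coord_global: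
  "smooth_fun_on M (points M) F \<Longrightarrow> c \<in> charts M \<Longrightarrow> C_k_on n (snd c ` fst c) (grad_coord c F)"
  using C_k_on_grad_coord[OF openin_points, of F c n] by (simp add: points_Int_chart)

lemma C_k_on_kkt_coord:
  assumes c: "c \<in> charts M"
  shows "C_k_on n ((snd c ` fst c) \<times> UNIV) (kkt_coord c)"
proof -
  let ?S = "snd c ` fst c"
  have S: "open ?S" using c by (rule open_chart_image)
  have T: "open (?S \<times> (UNIV :: ((real ^ 'l) \<times> (real ^ 'm) \<times> (real ^ 'm)) set))"
    by (rule open_Times[OF S open_UNIV])
  have y: "bounded_linear (\<lambda>q :: ('e, 'l, 'm) kkt_point. fst (snd q) $ i)" for i
    by (rule bounded_linear_kkt_components)
  have z: "bounded_linear (\<lambda>q :: ('e, 'l, 'm) kkt_point. fst (snd (snd q)) $ i)" for i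
    by (rule bounded_linear_kkt_components)
  have s: "bounded_linear (\<lambda>q :: ('e, 'l, 'm) kkt_point. snd (snd (snd q)))"
    by (rule bounded_linear_kkt_components)
  have s': "bounded_linear (\<lambda>q :: ('e, 'l, 'm) kkt_point. snd (snd (snd q)) $ i)" for i
    by (rule bounded_linear_kkt_components)
  show ?thesis
    unfolding kkt_coord_def[abs_def]
    by (intro C_k_on_Pair[OF T] C_k_on_add[OF T] C_k_on_sum[OF T] C_k_on_scaleR[OF T] C_k_on_mult[OF T]
        C_k_on_const C_k_on_linear_fun[OF T y] C_k_on_linear_fun[OF T z] C_k_on_linear_fun[OF T s]
        C_k_on_linear_fun[OF T s']
        C_k_on_fst_compose[OF S C_k_on_grad_coord_global[OF smooth_f c]]
        C_k_on_fst_compose[OF S C_k_on_grad_coord_global[OF smooth_h_component c]]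
        C_k_on_fst_compose[OF S C_k_on_grad_coord_global[OF smooth_g_component c]]
        C_k_on_fst_compose[OF S chart_repr[OF smooth_h c]]
        C_k_on_fst_compose[OF S chart_repr[OF smooth_g c]])
qed

text \<open>\<open>point_coord c\<close> and \<open>vec_coord c x\<close> are the chart of \<open>kkt_manifold M\<close> given by \<open>c\<close> and its
  differential at points over \<open>x\<close>.\<close>

definition point_coord :: "('a, 'e) chart \<Rightarrow> ('a, 'l, 'm) kkt_point \<Rightarrow> ('e, 'l, 'm) kkt_point" where
  "point_coord c w = (snd c (fst w), snd w)"

definition vec_coord :: "('a, 'e) chart \<Rightarrow> 'a \<Rightarrow> ('e, 'l, 'm) kkt_point \<Rightarrow> ('e, 'l, 'm) kkt_point" where
  "vec_coord c x \<Delta> = (tcoord M c x (fst \<Delta>), snd \<Delta>)"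

lemma linear_vec_coord:
  assumes "c \<in> charts M" "x \<in> fst c"
  shows "linear (vec_coord c x)"
  using linear_add[OF linear_tcoord[OF assms]] linear_scale[OF linear_tcoord[OF assms]]
  by (intro linearI) (simp_all add: vec_coord_def)

lemma bij_vec_coord:
  assumes c: "c \<in> charts M" "x \<in> fst c"
  shows "bij (vec_coord c x)"
proof (rule bij_betw_byWitness[where f' = "\<lambda>v. (tvec M c x (fst v), snd v)"])
qed (use c in \<open>auto simp: vec_coord_def\<close>)

lemma grad_coord_lagrangian:
  assumes c: "c \<in> charts M" and p: "p \<in> snd c ` fst c"
  shows "grad_coord c (lagrangian f h g y z) p = fst (kkt_coord c (p, y, z, s))"
proof -
  obtain x where x: "x \<in> fst c" "p = snd c x" using p by auto
  note lin = linear_tcoord[OF c x(1)]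
  have "grad_coord c (lagrangian f h g y z) p =
      tcoord M c x (grad M f x + grad_comb M h x y + grad_comb M g x z)"
    using c x grad_lagrangian[OF chart_points[OF c x(1)]] by (simp add: grad_coord_def)
  then show ?thesis
    using c x by (simp add: grad_comb_def kkt_coord_def grad_coord_def linear_add[OF lin]
        linear_sum[OF lin] linear_scale[OF lin])
qed

lemma kkt_field_coord:
  assumes c: "c \<in> charts M" and x: "fst w \<in> fst c"
  shows "vec_coord c (fst w) (kkt_field M f h g w) = kkt_coord c (point_coord c w)"
proof -
  obtain x y z s where w: "w = (x, y, z, s)" by (cases w)
  have "tcoord M c x (grad M (lagrangian f h g y z) x) = fst (kkt_coord c (snd c x, y, z, s))"
    using grad_coord_lagrangian[OF c, of "snd c x" y z s] x c w by (simp add: grad_coord_def)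
  then show ?thesis
    using x c w by (simp add: vec_coord_def kkt_field_def point_coord_def)
      (simp add: kkt_coord_def vec_lambda_axis_sum)
qed

text \<open>Product rule in each block. The terms with frozen multipliers are collected into the
  derivative of \<open>grad_coord c (lagrangian f h g y z)\<close>, the shape in which the Hessian
  appears in \<open>hess_coord\<close>.\<close>

lemma kkt_coord_derivative:
  assumes c: "c \<in> charts M" and p: "p \<in> snd c ` fst c"
  shows "frechet_derivative (kkt_coord c) (at (p, y, z, s)) (dp, dy, dz, ds) =
    (frechet_derivative (grad_coord c (lagrangian f h g y z)) (at p) dp +
       (\<Sum>i\<in>UNIV. dy $ i *\<^sub>R grad_coord c (\<lambda>x. h x $ i) p) + (\<Sum>i\<in>UNIV. dz $ i *\<^sub>R grad_coord c (\<lambda>x. g x $ i) p),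
     frechet_derivative (\<lambda>p. h (chart_inv c p)) (at p) dp,
     frechet_derivative (\<lambda>p. g (chart_inv c p)) (at p) dp + ds,
     \<chi> i. z $ i * ds $ i + s $ i * dz $ i)"
proof -
  let ?q = "(p, y, z, s)" and ?S = "snd c ` fst c"
  have G: "(grad_coord c F has_derivative frechet_derivative (grad_coord c F) (at (fst ?q))) (at (fst ?q))"
    if "smooth_fun_on M (points M) F" for F
    by (rule C_k_on_has_derivative[OF C_k_on_grad_coord_global[OF that c, of "Suc 0"]]) (use p in simp)
  have R: "((\<lambda>p. F (chart_inv c p)) has_derivative frechet_derivative (\<lambda>p. F (chart_inv c p)) (at (fst ?q))) (at (fst ?q))"
    if "smooth_fun_on M (points M) F" for F :: "'a \<Rightarrow> real ^ 'k"
    by (rule C_k_on_has_derivative[OF chart_repr[OF that c, of "Suc 0"]]) (use p in simp)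
  let ?Gf = "frechet_derivative (grad_coord c f) (at p)"
    and ?Gh = "\<lambda>i. frechet_derivative (grad_coord c (\<lambda>x. h x $ i)) (at p)"
    and ?Gg = "\<lambda>i. frechet_derivative (grad_coord c (\<lambda>x. g x $ i)) (at p)"
  have y: "((\<lambda>q :: ('e, 'l, 'm) kkt_point. fst (snd q) $ i) has_derivative (\<lambda>v. fst (snd v) $ i)) (at ?q)" for i
    by (rule bounded_linear_imp_has_derivative[OF bounded_linear_kkt_components(1)])
  have z: "((\<lambda>q :: ('e, 'l, 'm) kkt_point. fst (snd (snd q)) $ i) has_derivative (\<lambda>v. fst (snd (snd v)) $ i)) (at ?q)" for i
    by (rule bounded_linear_imp_has_derivative[OF bounded_linear_kkt_components(2)])
  have s: "((\<lambda>q :: ('e, 'l, 'm) kkt_point. snd (snd (snd q))) has_derivative (\<lambda>v. snd (snd (snd v)))) (at ?q)"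
    by (rule bounded_linear_imp_has_derivative[OF bounded_linear_kkt_components(4)])
  have s': "((\<lambda>q :: ('e, 'l, 'm) kkt_point. snd (snd (snd q)) $ i) has_derivative (\<lambda>v. snd (snd (snd v)) $ i)) (at ?q)" for i
    by (rule bounded_linear_imp_has_derivative[OF bounded_linear_kkt_components(3)])
  have L: "frechet_derivative (grad_coord c (lagrangian f h g y z)) (at p) dp =
      ?Gf dp + (\<Sum>i\<in>UNIV. y $ i *\<^sub>R ?Gh i dp) + (\<Sum>i\<in>UNIV. z $ i *\<^sub>R ?Gg i dp)"
  proof -
    have "((\<lambda>p. grad_coord c f p + (\<Sum>i\<in>UNIV. y $ i *\<^sub>R grad_coord c (\<lambda>x. h x $ i) p) +
        (\<Sum>i\<in>UNIV. z $ i *\<^sub>R grad_coord c (\<lambda>x. g x $ i) p)) has_derivative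
        (\<lambda>dp. ?Gf dp + (\<Sum>i\<in>UNIV. y $ i *\<^sub>R ?Gh i dp) + (\<Sum>i\<in>UNIV. z $ i *\<^sub>R ?Gg i dp))) (at p)"
      using G[OF smooth_f] G[OF smooth_h_component] G[OF smooth_g_component]
      by (intro has_derivative_add has_derivative_sum has_derivative_scaleR_right) simp_all
    then have "(grad_coord c (lagrangian f h g y z) has_derivative
        (\<lambda>dp. ?Gf dp + (\<Sum>i\<in>UNIV. y $ i *\<^sub>R ?Gh i dp) + (\<Sum>i\<in>UNIV. z $ i *\<^sub>R ?Gg i dp))) (at p)"
      by (rule iffD1[OF has_derivative_cong_open[OF open_chart_image[OF c] p], rotated])
         (use grad_coord_lagrangian[OF c, of _ y z 0] in \<open>simp add: kkt_coord_def\<close>)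
    from frechet_derivative_eqI[OF this] show ?thesis by simp
  qed
  have "(kkt_coord c has_derivative (\<lambda>v.
     (?Gf (fst v) + (\<Sum>i\<in>UNIV. fst (snd ?q) $ i *\<^sub>R ?Gh i (fst v) + fst (snd v) $ i *\<^sub>R grad_coord c (\<lambda>x. h x $ i) (fst ?q)) +
       (\<Sum>i\<in>UNIV. fst (snd (snd ?q)) $ i *\<^sub>R ?Gg i (fst v) + fst (snd (snd v)) $ i *\<^sub>R grad_coord c (\<lambda>x. g x $ i) (fst ?q)),
      frechet_derivative (\<lambda>p. h (chart_inv c p)) (at p) (fst v),
      frechet_derivative (\<lambda>p. g (chart_inv c p)) (at p) (fst v) + snd (snd (snd v)),
      \<Sum>i\<in>UNIV. (fst (snd (snd ?q)) $ i * snd (snd (snd v)) $ i + fst (snd (snd v)) $ i * snd (snd (snd ?q)) $ i) *\<^sub>R axis i 1))) (at ?q)"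
    unfolding kkt_coord_def[abs_def]
    using has_derivative_fst_compose[OF G[OF smooth_f]] has_derivative_fst_compose[OF G[OF smooth_h_component]]
      has_derivative_fst_compose[OF G[OF smooth_g_component]] has_derivative_fst_compose[OF R[OF smooth_h]]
      has_derivative_fst_compose[OF R[OF smooth_g]]
    by (intro has_derivative_Pair has_derivative_add has_derivative_sum has_derivative_scaleR
        has_derivative_scaleR_left has_derivative_mult y z s s') simp_all
  from frechet_derivative_eqI[OF this] show ?thesis
    by (simp add: L sum.distrib vec_lambda_axis_sum mult.commute)
qed

definition christoffel_term :: "('a, 'e) chart \<Rightarrow> 'e \<Rightarrow> 'e \<Rightarrow> 'e \<Rightarrow> 'e" where
  "christoffel_term c p u v = (\<Sum>b\<in>Basis. \<Sum>b'\<in>Basis. ((u \<bullet> b) * (v \<bullet> b')) *\<^sub>R christoffel c b b' p)"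

section \<open>The covariant derivative in coordinates\<close>

text \<open>Two forms of the adjoint: inner products with the gradients serve the second-order
  argument, the chart derivative of \<open>F\<close> the comparison with
  \<open>kkt_coord_derivative\<close>.\<close>

lemma tadjoint_grad_comb:
  fixes F :: "'a \<Rightarrow> real ^ 'k"
  assumes F: "smooth_fun_on M (points M) F" and c: "c \<in> charts M" and x: "x \<in> fst c"
  shows "tadjoint M x (grad_comb M F x) \<xi> = (\<chi> i. rmetric M x (grad M (\<lambda>p. F p $ i) x) \<xi>)"
    and "tadjoint M x (grad_comb M F x) \<xi> =
      frechet_derivative (\<lambda>p. F (chart_inv c p)) (at (snd c x)) (tcoord M c x \<xi>)"
proof -
  have xp: "x \<in> points M" using chart_points[OF c x] .
  note B = metric_bilinear[OF xp]
  let ?u = "\<chi> i. rmetric M x (grad M (\<lambda>p. F p $ i) x) \<xi>"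
  have u: "v \<bullet> ?u = rmetric M x (grad_comb M F x v) \<xi>" for v
    by (simp add: grad_comb_def linear_sum[OF bilinear_linear_left[OF B]] bilinear_lmul[OF B] inner_vec_def)
  show 1: "tadjoint M x (grad_comb M F x) \<xi> = ?u"
    unfolding tadjoint_def
  proof (rule the_equality)
    fix u' assume "\<forall>v. v \<bullet> u' = rmetric M x (grad_comb M F x v) \<xi>"
    then have "v \<bullet> u' = v \<bullet> ?u" for v using u by simp
    then show "u' = ?u" by (metis vector_eq_ldot)
  qed (use u in simp)
  have "rmetric M x (grad M (\<lambda>p. F p $ i) x) \<xi> =
      frechet_derivative (\<lambda>p. F (chart_inv c p)) (at (snd c x)) (tcoord M c x \<xi>) $ i" for i
  proof -
    have "((\<lambda>p. F (chart_inv c p) $ i) has_derivative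
        (\<lambda>v. frechet_derivative (\<lambda>p. F (chart_inv c p)) (at (snd c x)) v $ i)) (at (snd c x))"
      by (rule bounded_linear.has_derivative[OF bounded_linear_vec_nth repr_has_derivative[OF F c x]])
    from frechet_derivative_eqI[OF this] show ?thesis
      by (simp add: metric_grad_global[OF smooth_component[OF F] xp] differential_eq[OF smooth_component[OF F] c x])
  qed
  then show "tadjoint M x (grad_comb M F x) \<xi> =
      frechet_derivative (\<lambda>p. F (chart_inv c p)) (at (snd c x)) (tcoord M c x \<xi>)"
    unfolding 1 by (simp add: vec_eq_iff)
qed

lemma hess_coord:
  assumes c: "c \<in> charts M" and x: "x \<in> fst c" and F: "smooth_fun_on M (points M) F"
  shows "tcoord M c x (hess M conn F x \<xi>) =
    frechet_derivative (grad_coord c F) (at (snd c x)) (tcoord M c x \<xi>) +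
    christoffel_term c (snd c x) (tcoord M c x \<xi>) (tcoord M c x (grad M F x))"
proof -
  have "smooth_field_on M (fst c) (grad M F)"
    by (rule smooth_field_on_subset[OF smooth_field_on_grad[OF openin_points F]])
      (use chart_points[OF c] in auto)
  from conn_coord[OF c this x, of \<xi>] show ?thesis
    by (simp add: hess_def christoffel_term_def field_coord_def[abs_def] grad_coord_def[abs_def])
qed

text \<open>Only the first block contains a covariant derivative; the others are differentials of
  functions or algebraic. The correction is bilinear in the direction and in the gradient of the
  Lagrangian, which is the first block of the field itself, and so vanishes at a KKT point.\<close>

lemma kkt_deriv_coord:
  assumes c: "c \<in> charts M" and x: "fst w \<in> fst c"
  shows "vec_coord c (fst w) (kkt_deriv M conn f h g w \<Delta>) =
    frechet_derivative (kkt_coord c) (at (point_coord c w)) (vec_coord c (fst w) \<Delta>) +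
    (christoffel_term c (snd c (fst w)) (fst (vec_coord c (fst w) \<Delta>)) (fst (kkt_coord c (point_coord c w))), 0)"
proof -
  obtain x y z s where w: "w = (x, y, z, s)" by (cases w)
  obtain dx dy dz ds where \<Delta>: "\<Delta> = (dx, dy, dz, ds)" by (cases \<Delta>)
  have xc: "x \<in> fst c" and px: "snd c x \<in> snd c ` fst c" using x w by auto
  note lin = linear_tcoord[OF c xc]
  have "tcoord M c x (grad M (lagrangian f h g y z) x) = fst (kkt_coord c (point_coord c w))"
    using arg_cong[OF kkt_field_coord[OF c x], of fst] w by (simp add: vec_coord_def kkt_field_def)
  note H = hess_coord[OF c xc smooth_lagrangian[of y z], of dx, unfolded this]
  show ?thesis
    unfolding w \<Delta>
    by (simp add: vec_coord_def point_coord_def kkt_deriv_def kkt_coord_derivative[OF c px]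
        tadjoint_grad_comb(2)[OF smooth_h c xc] tadjoint_grad_comb(2)[OF smooth_g c xc]
        linear_add[OF lin] H[unfolded w point_coord_def])
      (use c xc in \<open>simp add: grad_comb_def linear_sum[OF lin] linear_scale[OF lin] grad_coord_def\<close>)
qed

lemma christoffel_term_bound:
  assumes c: "c \<in> charts M" and K: "compact K" "K \<subseteq> snd c ` fst c"
  obtains C where "C > 0" "\<And>p u v. p \<in> K \<Longrightarrow> norm (christoffel_term c p u v) \<le> C * norm u * norm v"
proof -
  have "\<exists>C. \<forall>p\<in>K. norm (christoffel c b b' p) \<le> C" for b b'
  proof -
    have "compact (christoffel c b b' ` K)"
      using K by (intro compact_continuous_image continuous_on_subset[OF continuous_on_christoffel[OF c]])
    then show ?thesis using compact_imp_bounded by (force simp: bounded_iff)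
  qed
  then have "\<forall>q. \<exists>C. \<forall>p\<in>K. norm (christoffel c (fst q) (snd q) p) \<le> C" by blast
  then obtain C' where C': "\<forall>q. \<forall>p\<in>K. norm (christoffel c (fst q) (snd q) p) \<le> C' q"
    by (rule choice[THEN exE])
  define C where "C b b' = C' (b, b')" for b b'
  have C: "norm (christoffel c b b' p) \<le> C b b'" if "p \<in> K" for b b' p
    using C'[rule_format, OF that, of "(b, b')"] by (simp add: C_def)
  define D where "D = (\<Sum>b\<in>Basis. \<Sum>b'\<in>Basis. \<bar>C b b'\<bar>) + 1"
  have "norm (christoffel_term c p u v) \<le> D * norm u * norm v" if p: "p \<in> K" for p u v
  proof -
    have "norm (christoffel_term c p u v) \<le> (\<Sum>b\<in>Basis. \<Sum>b'\<in>Basis. (norm u * norm v) * \<bar>C b b'\<bar>)"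
      unfolding christoffel_term_def
    proof (intro sum_norm_le)
      fix b b' :: 'e assume "b \<in> Basis" "b' \<in> Basis"
      then show "norm (((u \<bullet> b) * (v \<bullet> b')) *\<^sub>R christoffel c b b' p) \<le> (norm u * norm v) * \<bar>C b b'\<bar>"
        using C[OF p, of b b'] by (auto simp: abs_mult intro!: mult_mono Basis_le_norm)
    qed
    also have "\<dots> \<le> D * norm u * norm v"
      by (simp add: sum_distrib_left[symmetric] D_def algebra_simps)
    finally show ?thesis .
  qed
  moreover have "D > 0" by (auto simp: D_def intro!: add_nonneg_pos sum_nonneg)
  ultimately show thesis using that by blast
qed

section \<open>Nonsingularity at the solution\<close>

text \<open>The complementarity row makes \<open>ds\<close> vanish on active and \<open>dz\<close>
  on inactive constraints. Hence \<open>dx\<close> is orthogonal to the equality and active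
  gradients, and pairing the first row with \<open>dx\<close> removes the multiplier terms and
  leaves a vanishing Hessian form. Second-order sufficiency gives \<open>dx = 0\<close>, the third
  row \<open>ds = 0\<close>, and linear independence of the gradients removes \<open>dy\<close> and
  \<open>dz\<close>.\<close>

lemma kkt_deriv_injective:
  assumes x: "fst w \<in> points M" and A1: "kkt_conditions M f h g w" and A2: "licq M h g (fst w)"
    and A3: "strict_complementarity g w" and A4: "second_order_sufficient M conn f h g w"
    and 0: "kkt_deriv M conn f h g w \<Delta> = 0"
  shows "\<Delta> = 0"
proof -
  obtain x y z s where w: "w = (x, y, z, s)" by (cases w)
  obtain dx dy dz ds where \<Delta>: "\<Delta> = (dx, dy, dz, ds)" by (cases \<Delta>)
  have xp: "x \<in> points M" using x w by simp
  note B = metric_bilinear[OF xp]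
  define c where "c = chart_at M x"
  have c: "c \<in> charts M" "x \<in> fst c" using chart_at[OF xp] by (auto simp: c_def)
  let ?H = "hess M conn (lagrangian f h g y z) x dx"
  let ?gh = "\<lambda>i. grad M (\<lambda>p. h p $ i) x" and ?gg = "\<lambda>i. grad M (\<lambda>p. g p $ i) x"
  have e1: "?H + grad_comb M h x dy + grad_comb M g x dz = 0"
    and e2: "rmetric M x (?gh i) dx = 0"
    and e3: "rmetric M x (?gg j) dx + ds $ j = 0"
    and e4: "z $ j * ds $ j + s $ j * dz $ j = 0" for i j
    using 0 unfolding w \<Delta>
    by (simp_all add: kkt_deriv_def zero_prod_def tadjoint_grad_comb(1)[OF smooth_h c] tadjoint_grad_comb(1)[OF smooth_g c]
        vec_eq_iff)
  have gx: "g x $ j \<le> 0" and s: "s $ j = - g x $ j" and zg: "z $ j * g x $ j = 0" for j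
    using A1 by (simp_all add: w kkt_conditions_def)
  \<comment> \<open>Active indices have \<open>s $ j = 0 < z $ j\<close>, inactive ones
    \<open>z $ j = 0 < s $ j\<close>; in each case one product of the last row disappears and the
    other has a nonzero factor.\<close>
  have act: "ds $ j = 0" if "g x $ j = 0" for j
    using e4[of j] A3 that s[of j] by (auto simp: w strict_complementarity_def)
  have inact: "dz $ j = 0" if "g x $ j \<noteq> 0" for j
    using e4[of j] zg[of j] s[of j] that by auto
  have ort: "dz $ j * rmetric M x (?gg j) dx = 0" for j
    using e3[of j] act[of j] inact[of j] by (cases "g x $ j = 0") auto
  have "rmetric M x ?H dx + rmetric M x (grad_comb M h x dy) dx + rmetric M x (grad_comb M g x dz) dx = 0"
    using arg_cong[OF e1, of "\<lambda>v. rmetric M x v dx"] by (simp add: bilinear_ladd[OF B] bilinear_lzero[OF B])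
  moreover have "rmetric M x (grad_comb M h x dy) dx = 0" "rmetric M x (grad_comb M g x dz) dx = 0"
    by (simp_all add: grad_comb_def linear_sum[OF bilinear_linear_left[OF B]] bilinear_lmul[OF B] e2 ort)
  ultimately have H0: "rmetric M x ?H dx = 0" by simp
  have dx: "dx = 0"
  proof (rule ccontr)
    assume "dx \<noteq> 0"
    moreover have "rmetric M x dx (?gh i) = 0" for i using e2 metric_sym[OF xp] by simp
    moreover have "rmetric M x dx (?gg i) = 0" if "i \<in> active_set g x" for i
      using e3[of i] act[of i] that metric_sym[OF xp, of dx] by (simp add: active_set_def)
    ultimately have "0 < rmetric M x ?H dx"
      using A4 by (simp add: w second_order_sufficient_def)
    then show False using H0 by simp
  qed
  have ds: "ds = 0" using e3 dx by (simp add: vec_eq_iff bilinear_rzero[OF B])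
  have "?H = 0"
  proof -
    have "linear (\<lambda>u. conn x u (grad M (lagrangian f h g y z)))"
      by (rule linear_conn[OF openin_points smooth_field_on_grad[OF openin_points smooth_lagrangian] xp])
    from linear_0[OF this] show ?thesis by (simp add: hess_def dx)
  qed
  then have comb: "grad_comb M h x dy + grad_comb M g x dz = 0" using e1 by simp
  let ?I = "range Inl \<union> Inr ` active_set g x :: ('l + 'm) set"
  let ?v = "case_sum ?gh ?gg" and ?a = "case_sum (\<lambda>i. dy $ i) (\<lambda>j. dz $ j)"
  have inj: "inj_on ?v ?I" and ind: "independent (?v ` ?I)"
    using A2 by (simp_all add: w licq_def Let_def)
  have "(\<Sum>i\<in>?I. ?a i *\<^sub>R ?v i) =
      (\<Sum>i\<in>range Inl. ?a i *\<^sub>R ?v i) + (\<Sum>i\<in>Inr ` active_set g x. ?a i *\<^sub>R ?v i)"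
    by (rule sum.union_disjoint) auto
  also have "(\<Sum>i\<in>range Inl. ?a i *\<^sub>R ?v i) = grad_comb M h x dy"
    by (simp add: sum.reindex grad_comb_def)
  also have "(\<Sum>i\<in>Inr ` active_set g x. ?a i *\<^sub>R ?v i) = (\<Sum>j\<in>active_set g x. dz $ j *\<^sub>R ?gg j)"
    by (simp add: sum.reindex inj_on_def)
  also have "\<dots> = grad_comb M g x dz"
    unfolding grad_comb_def by (rule sum.mono_neutral_left) (auto simp: active_set_def inact)
  finally have sum0: "(\<Sum>i\<in>?I. ?a i *\<^sub>R ?v i) = 0" using comb by simp
  \<comment> \<open>\<open>independent\<close> speaks of the set of gradients. Injectivity of the
    family lets coefficients indexed by constraints be read as coefficients on that set.\<close>
  have "?a i = 0" if i: "i \<in> ?I" for i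
  proof -
    have "(\<Sum>v\<in>?v ` ?I. ?a (inv_into ?I ?v v) *\<^sub>R v) = (\<Sum>i\<in>?I. ?a (inv_into ?I ?v (?v i)) *\<^sub>R ?v i)"
      using sum.reindex[OF inj, of "\<lambda>v. ?a (inv_into ?I ?v v) *\<^sub>R v"] by (simp add: o_def)
    also have "\<dots> = (\<Sum>i\<in>?I. ?a i *\<^sub>R ?v i)"
      by (rule sum.cong[OF refl]) (simp only: inv_into_f_f[OF inj])
    finally have "(\<Sum>v\<in>?v ` ?I. ?a (inv_into ?I ?v v) *\<^sub>R v) = 0" using sum0 by simp
    then have "?a (inv_into ?I ?v (?v i)) = 0"
      by (rule independentD[OF ind _ order_refl _ imageI[OF i], rotated]) simp
    then show ?thesis by (simp only: inv_into_f_f[OF inj i])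
  qed
  note a0 = this
  have dy: "dy = 0" using a0[of "Inl _"] by (simp add: vec_eq_iff)
  have "dz $ j = 0" for j
    using a0[of "Inr j"] inact[of j] by (cases "g x $ j = 0") (auto simp: active_set_def)
  then have "dz = 0" by (simp add: vec_eq_iff)
  then show ?thesis using \<Delta> dx dy ds by (simp add: zero_prod_def)
qed

end

section \<open>Local analysis of a damped Newton step\<close>

text \<open>The perturbation \<open>B\<close> accounts for the difference between the covariant derivative and the
  derivative of the coordinate representation; it vanishes at the zero of \<open>F\<close>.\<close>

lemma perturbed_newton:
  fixes F :: "'e::euclidean_space \<Rightarrow> 'e" and B :: "'e \<Rightarrow> 'e \<Rightarrow> 'e"
  assumes T: "open T" and F: "C_k_on 2 T F" and w0: "w0 \<in> T" and zero: "F w0 = 0"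
    and inj: "\<And>v. frechet_derivative F (at w0) v = 0 \<Longrightarrow> v = 0"
    and \<rho>: "\<rho> > 0" and C: "C > 0"
    and B: "\<And>w v. w \<in> cball w0 \<rho> \<Longrightarrow> norm (B w v) \<le> C * norm (F w) * norm v"
    and linB: "\<And>w. w \<in> cball w0 \<rho> \<Longrightarrow> linear (B w)"
  obtains r K where "r > 0" "K > 0"
    "\<And>w b. norm (w - w0) \<le> r \<Longrightarrow> \<exists>!v. frechet_derivative F (at w) v + B w v = b"
    "\<And>w. norm (w - w0) \<le> r \<Longrightarrow> norm (F w) \<le> K * norm (w - w0)"
    "\<And>w v u. norm (w - w0) \<le> r \<Longrightarrow> frechet_derivative F (at w) v + B w v = - F w + u \<Longrightarrow>
        norm (v + (w - w0)) \<le> K * ((norm (w - w0))\<^sup>2 + norm u)"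
proof -
  let ?F' = "\<lambda>w. frechet_derivative F (at w)"
  obtain r1 L where r1: "r1 > 0" "L > 0" "cball w0 r1 \<subseteq> T"
    and E1: "\<And>x y. x \<in> cball w0 r1 \<Longrightarrow> y \<in> cball w0 r1 \<Longrightarrow> norm (F y - F x) \<le> L * norm (y - x)"
    and E2: "\<And>x y v. x \<in> cball w0 r1 \<Longrightarrow> y \<in> cball w0 r1 \<Longrightarrow>
        norm (?F' y v - ?F' x v) \<le> L * norm (y - x) * norm v"
    and E3: "\<And>x y. x \<in> cball w0 r1 \<Longrightarrow> y \<in> cball w0 r1 \<Longrightarrow>
        norm (F y - F x - ?F' x (y - x)) \<le> L * (norm (y - x))\<^sup>2"
    by (rule C2_estimates[OF T F w0]) (rule that; assumption)
  have lin: "linear (?F' w)" if "w \<in> T" for w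
    using F that by (intro linear_frechet_derivative) (simp add: numeral_2_eq_2)
  have "inj (?F' w0)" using inj linear_injective_0[OF lin[OF w0]] by blast
  then obtain m where m: "m > 0" "\<And>v. m * norm v \<le> norm (?F' w0 v)"
    using linear_inj_bounded_below_pos[OF lin[OF w0]] by blast
  \<comment> \<open>The variation of the derivative, at rate \<open>L\<close>, and the perturbation,
    at rate \<open>C * L\<close>, together must consume at most half of the lower bound
    \<open>m\<close>.\<close>
  define r where "r = min (min r1 \<rho>) (m / (2 * (L + C * L)))"
  have LC: "L + C * L > 0" using r1 C by (simp add: add_pos_pos)
  have r: "r > 0" using r1 \<rho> m LC by (simp add: r_def)
  have r': "(L + C * L) * r \<le> m / 2"
  proof -
    have "(L + C * L) * r \<le> (L + C * L) * (m / (2 * (L + C * L)))"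
      using LC by (intro mult_left_mono) (auto simp: r_def)
    also have "\<dots> = m / 2" using LC by (simp add: field_simps)
    finally show ?thesis .
  qed
  have ball: "w \<in> cball w0 r1" "w \<in> cball w0 \<rho>" "w \<in> T" if "norm (w - w0) \<le> r" for w
    using that r1(3) by (auto simp: r_def dist_norm norm_minus_commute subset_iff)
  have w0r: "w0 \<in> cball w0 r1" using r1 by simp
  let ?A = "\<lambda>w v. ?F' w v + B w v"
  have linA: "linear (?A w)" if "norm (w - w0) \<le> r" for w
    using lin ball[OF that] linB by (intro linear_compose_add) auto
  have FL: "norm (F w) \<le> L * norm (w - w0)" if "norm (w - w0) \<le> r" for w
    using E1[OF w0r ball(1)[OF that]] zero by simp
  have BL: "norm (B w v) \<le> C * L * norm (w - w0) * norm v" if "norm (w - w0) \<le> r" for w v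
  proof -
    have "C * norm (F w) * norm v \<le> C * (L * norm (w - w0)) * norm v"
      using FL[OF that] C by (intro mult_right_mono mult_left_mono) auto
    then show ?thesis using B[OF ball(2)[OF that], of v] by (simp add: mult.assoc)
  qed
  have below: "m / 2 * norm v \<le> norm (?A w v)" if w: "norm (w - w0) \<le> r" for w v
  proof -
    have "norm (?F' w v - ?F' w0 v + B w v) \<le> L * norm (w - w0) * norm v + C * L * norm (w - w0) * norm v"
      using E2[OF w0r ball(1)[OF w], of v] BL[OF w, of v] norm_triangle_mono by blast
    also have "\<dots> = (L + C * L) * norm (w - w0) * norm v" by (simp add: algebra_simps)
    also have "\<dots> \<le> (L + C * L) * r * norm v"
      using w LC by (intro mult_right_mono mult_left_mono) auto
    also have "\<dots> \<le> m / 2 * norm v" using r' by (intro mult_right_mono) auto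
    finally have "norm (?A w v - ?F' w0 v) \<le> m / 2 * norm v" by (simp add: algebra_simps)
    moreover have "norm (?F' w0 v) - norm (?A w v) \<le> norm (?A w v - ?F' w0 v)"
      by (metis norm_minus_commute norm_triangle_ineq2)
    ultimately show ?thesis using m(2)[of v] by simp
  qed
  \<comment> \<open>The first summand bounds \<open>F\<close>; the other two come from dividing the
    Newton estimate by \<open>m / 2\<close>.\<close>
  define K where "K = L + 2 / m * (L + C * L) + 2 / m"
  have K: "K > 0" "L \<le> K" using r1 LC m by (auto simp: K_def intro!: add_pos_pos)
  show thesis
  proof (rule that[OF r K(1)])
    fix w b assume w: "norm (w - w0) \<le> r"
    have injA: "inj (?A w)"
      unfolding linear_injective_0[OF linA[OF w]]
    proof (intro allI impI)
      fix v assume "?A w v = 0"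
      then have "m / 2 * norm v \<le> 0" using below[OF w, of v] by simp
      then show "v = 0" using m(1) by (simp add: mult_le_0_iff)
    qed
    then have "surj (?A w)" using linear_injective_imp_surjective[OF linA[OF w]] by blast
    then obtain v where v: "b = ?A w v" by (rule surjE)
    show "\<exists>!v. ?A w v = b"
    proof (rule ex1I)
      show "?A w v = b" using v by simp
      show "v' = v" if "?A w v' = b" for v' using injD[OF injA, of v' v] that v by simp
    qed
  next
    fix w assume w: "norm (w - w0) \<le> r"
    have "L * norm (w - w0) \<le> K * norm (w - w0)" using K by (intro mult_right_mono) auto
    then show "norm (F w) \<le> K * norm (w - w0)" using FL[OF w] by simp
  next
    fix w v u assume w: "norm (w - w0) \<le> r" and eq: "?A w v = - F w + u"
    let ?e = "w - w0"
    \<comment> \<open>Adding \<open>?A w ?e\<close> to the Newton equation turns its right-hand side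
      into the Taylor remainder of \<open>F\<close> from \<open>w\<close> to the zero
      \<open>w0\<close>, plus \<open>B w ?e\<close> and \<open>u\<close>.\<close>
    have "?A w (v + ?e) = - F w + u + (?F' w ?e + B w ?e)"
      using linear_add[OF linA[OF w], of v ?e] eq by simp
    also have "\<dots> = (F w0 - F w - ?F' w (w0 - w)) + B w ?e + u"
      using linear_neg[OF lin[OF ball(3)[OF w]], of ?e] zero by simp
    finally have "norm (?A w (v + ?e)) \<le> L * (norm ?e)\<^sup>2 + C * L * (norm ?e)\<^sup>2 + norm u"
      using E3[OF ball(1)[OF w] w0r] BL[OF w, of ?e]
        norm_triangle_ineq[of "(F w0 - F w - ?F' w (w0 - w)) + B w ?e" u]
        norm_triangle_ineq[of "F w0 - F w - ?F' w (w0 - w)" "B w ?e"]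
      by (simp add: norm_minus_commute[of w0 w] power2_eq_square mult.assoc)
    then have "m / 2 * norm (v + ?e) \<le> (L + C * L) * (norm ?e)\<^sup>2 + norm u"
      using below[OF w, of "v + ?e"] by (simp add: algebra_simps)
    then have "norm (v + ?e) \<le> 2 / m * ((L + C * L) * (norm ?e)\<^sup>2 + norm u)"
      using m(1) by (simp add: field_simps)
    also have "\<dots> = 2 / m * (L + C * L) * (norm ?e)\<^sup>2 + 2 / m * norm u"
      by (subst distrib_left) (simp only: mult.assoc)
    also have "\<dots> \<le> K * (norm ?e)\<^sup>2 + K * norm u"
      using r1 LC m by (intro add_mono mult_right_mono) (auto simp: K_def)
    finally show "norm (v + ?e) \<le> K * ((norm ?e)\<^sup>2 + norm u)" by (simp add: algebra_simps)
  qed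
qed

text \<open>For a strictly complementary pair the ratio test admits nearly full steps: if \<open>b\<close> stays
  away from zero, the linearised complementarity equation controls \<open>da\<close> by \<open>a\<close>.\<close>

lemma ratio_bound:
  fixes a b da db :: real
  assumes nonneg: "0 \<le> a" "0 \<le> b" and compl: "- (b * a) \<le> b * da + a * db"
    and D: "\<bar>da\<bar> \<le> D" "\<bar>db\<bar> \<le> D" "D \<le> \<eta>" and \<eta>: "0 < \<eta>" "\<eta> \<le> a \<or> \<eta> \<le> b" and da: "da < 0"
  shows "1 - D / \<eta> \<le> - a / da"
proof -
  have D0: "0 \<le> D" using D(1) by simp
  have "(1 - D / \<eta>) * (- da) \<le> a"
    using \<eta>(2)
  proof
    \<comment> \<open>Here \<open>- da \<le> D \<le> \<eta> \<le> a\<close>, so the ratio is already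
      at least 1.\<close>
    assume "\<eta> \<le> a"
    have "(1 - D / \<eta>) * (- da) \<le> 1 * (- da)" using da D0 \<eta>(1) by (intro mult_right_mono) auto
    also have "\<dots> \<le> a" using D \<open>\<eta> \<le> a\<close> by simp
    finally show ?thesis .
  next
    assume b: "\<eta> \<le> b"
    \<comment> \<open>Solved for \<open>da\<close>, the linearised complementarity yields
      \<open>- da \<le> a * (1 + D / \<eta>)\<close>. Multiplied by \<open>1 - D / \<eta>\<close>,
      the right-hand side differs from \<open>a\<close> only by a term of second order, which has
      the favourable sign.\<close>
    have "b * (- da) \<le> a * (b + db)" using compl by (simp add: algebra_simps)
    also have "\<dots> \<le> a * (b + D)" using D nonneg by (intro mult_left_mono) auto
    finally have "- da \<le> a * (b + D) / b" using b \<eta>(1) by (simp add: pos_le_divide_eq mult.commute)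
    also have "\<dots> = a * (1 + D / b)" using b \<eta>(1) by (simp add: field_simps)
    also have "\<dots> \<le> a * (1 + D / \<eta>)" using nonneg b \<eta>(1) D0 by (intro mult_left_mono add_left_mono divide_left_mono) auto
    finally have "(1 - D / \<eta>) * (- da) \<le> (1 - D / \<eta>) * (a * (1 + D / \<eta>))"
      using D(3) \<eta>(1) by (intro mult_left_mono) (auto simp: field_simps)
    also have "\<dots> = a * (1 - (D / \<eta>)\<^sup>2)" by algebra
    also have "\<dots> \<le> a * 1" using nonneg by (intro mult_left_mono) auto
    finally show ?thesis by simp
  qed
  then show ?thesis using da by (simp add: field_simps)
qed

text \<open>\<open>ratio_bound\<close> applies to both members of each pair, with the roles of
  \<open>z\<close> and \<open>s\<close> exchanged. The barrier parameter enters through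
  \<open>compl\<close> alone: being nonnegative, it turns the linearised equation into an inequality
  of the required direction.\<close>

lemma step_size_bounds:
  fixes z s dz ds :: "real ^ 'm::finite" and x :: 'a and dx :: "'e::euclidean_space" and y dy :: "real ^ 'l::finite"
  assumes nonneg: "\<And>i. 0 \<le> z $ i" "\<And>i. 0 \<le> s $ i"
    and compl: "\<And>i. - (z $ i * s $ i) \<le> z $ i * ds $ i + s $ i * dz $ i"
    and D: "\<And>i. \<bar>dz $ i\<bar> \<le> D" "\<And>i. \<bar>ds $ i\<bar> \<le> D" "0 \<le> D" "D \<le> \<eta>"
    and \<eta>: "0 < \<eta>" "\<And>i. \<eta> \<le> z $ i \<or> \<eta> \<le> s $ i"
    and \<gamma>: "0 \<le> \<gamma>" "\<gamma> \<le> 1"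
  defines "\<alpha> \<equiv> step_size (x, y, z, s) (dx, dy, dz, ds) \<gamma>"
  shows "0 \<le> \<alpha>" "\<alpha> \<le> 1" "\<gamma> * (1 - D / \<eta>) \<le> \<alpha>"
    "\<And>i. 0 \<le> z $ i + \<alpha> * dz $ i" "\<And>i. 0 \<le> s $ i + \<alpha> * ds $ i"
proof -
  let ?S = "{\<gamma> * (- s $ i / ds $ i) | i. ds $ i < 0}" and ?Z = "{\<gamma> * (- z $ i / dz $ i) | i. dz $ i < 0}"
  have fin: "finite ({1} \<union> ?S \<union> ?Z)" by simp
  have \<alpha>: "\<alpha> = Min ({1} \<union> ?S \<union> ?Z)" by (simp add: \<alpha>_def step_size_def)
  have rS: "1 - D / \<eta> \<le> - s $ i / ds $ i" if "ds $ i < 0" for i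
    by (rule ratio_bound[OF nonneg(2,1) compl D(2,1,4) \<eta>(1) _ that]) (use \<eta>(2)[of i] in auto)
  have rZ: "1 - D / \<eta> \<le> - z $ i / dz $ i" if "dz $ i < 0" for i
    by (rule ratio_bound[OF nonneg(1,2) _ D(1,2,4) \<eta>(1) _ that])
      (use \<eta>(2)[of i] compl[of i] in \<open>auto simp: add.commute mult.commute\<close>)
  have "1 - D / \<eta> \<le> 1" "0 \<le> 1 - D / \<eta>" using D \<eta> by auto
  then have "\<gamma> * (1 - D / \<eta>) \<le> 1" using \<gamma> by (simp add: mult_le_one)
  then have "\<gamma> * (1 - D / \<eta>) \<le> a" if "a \<in> {1} \<union> ?S \<union> ?Z" for a
    using that mult_left_mono[OF rS \<gamma>(1)] mult_left_mono[OF rZ \<gamma>(1)] by auto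
  then show low: "\<gamma> * (1 - D / \<eta>) \<le> \<alpha>" unfolding \<alpha> using fin by (subst Min_ge_iff) auto
  have "0 \<le> \<gamma> * (1 - D / \<eta>)" using \<gamma> \<open>0 \<le> 1 - D / \<eta>\<close> by simp
  then show \<alpha>0: "0 \<le> \<alpha>" using low by simp
  show "\<alpha> \<le> 1" unfolding \<alpha> using fin by (intro Min_le) auto
  \<comment> \<open>As \<open>\<gamma> \<le> 1\<close>, the step never exceeds the full ratio, so no
    component becomes negative.\<close>
  have aS: "\<alpha> \<le> - s $ i / ds $ i" if "ds $ i < 0" for i
  proof -
    have "\<alpha> \<le> \<gamma> * (- s $ i / ds $ i)" unfolding \<alpha> using fin that by (intro Min_le) auto
    also have "\<dots> \<le> 1 * (- s $ i / ds $ i)"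
      using \<gamma>(2) that nonneg(2)[of i] by (intro mult_right_mono) (auto simp: divide_nonneg_neg)
    finally show ?thesis by simp
  qed
  have aZ: "\<alpha> \<le> - z $ i / dz $ i" if "dz $ i < 0" for i
  proof -
    have "\<alpha> \<le> \<gamma> * (- z $ i / dz $ i)" unfolding \<alpha> using fin that by (intro Min_le) auto
    also have "\<dots> \<le> 1 * (- z $ i / dz $ i)"
      using \<gamma>(2) that nonneg(1)[of i] by (intro mult_right_mono) (auto simp: divide_nonneg_neg)
    finally show ?thesis by simp
  qed
  have step: "0 \<le> a + \<alpha> * da" if "0 \<le> a" "da < 0 \<Longrightarrow> \<alpha> \<le> - a / da" for a da :: real
  proof (cases "da < 0")
    case True
    then have "\<alpha> * (- da) \<le> a" using that(2)[OF True] by (simp add: field_simps)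
    then show ?thesis by simp
  next
    case False
    then show ?thesis using that(1) \<alpha>0 by simp
  qed
  show "0 \<le> z $ i + \<alpha> * dz $ i" for i using step nonneg(1) aZ by blast
  show "0 \<le> s $ i + \<alpha> * ds $ i" for i using step nonneg(2) aS by blast
qed

text \<open>With \<open>\<gamma> = 1\<close> an iterate may reach the boundary, so only nonnegativity is invariant.\<close>

definition nonneg_zs :: "('a, 'l::finite, 'm::finite) kkt_point \<Rightarrow> bool" where
  "nonneg_zs w \<longleftrightarrow> (\<forall>i. 0 \<le> fst (snd (snd w)) $ i) \<and> (\<forall>i. 0 \<le> snd (snd (snd w)) $ i)"

lemma norm_fst_le_norm: "norm (fst a) \<le> norm a"
  using norm_fst_le[of "fst a" "snd a"] by simp

lemma norm_snd_le_norm: "norm (snd a) \<le> norm a"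
  using norm_snd_le[of "snd a" "fst a"] by simp

context kkt_problem
begin

text \<open>The Newton equation lives in the tangent space at \<open>w\<close>; the bijection
  \<open>vec_coord c (fst w)\<close> moves it to coordinates. It fixes \<open>ehat\<close>, whose
  tangent component is 0.\<close>

lemma newton_coord:
  assumes c: "c \<in> charts M" and x: "fst w \<in> fst c"
  shows "newton_direction M conn f h g w \<mu> \<Delta> \<longleftrightarrow>
    frechet_derivative (kkt_coord c) (at (point_coord c w)) (vec_coord c (fst w) \<Delta>) +
    (christoffel_term c (fst (point_coord c w)) (fst (vec_coord c (fst w) \<Delta>)) (fst (kkt_coord c (point_coord c w))), 0) =
    - kkt_coord c (point_coord c w) + \<mu> *\<^sub>R ehat"
proof -
  note lin = linear_vec_coord[OF c x]
  have eh: "vec_coord c (fst w) (\<mu> *\<^sub>R ehat) = \<mu> *\<^sub>R ehat"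
    using linear_0[OF linear_tcoord[OF c x]] by (simp add: vec_coord_def ehat_def)
  have "newton_direction M conn f h g w \<mu> \<Delta> \<longleftrightarrow>
      vec_coord c (fst w) (kkt_deriv M conn f h g w \<Delta>) = vec_coord c (fst w) (- kkt_field M f h g w + \<mu> *\<^sub>R ehat)"
    unfolding newton_direction_def using bij_is_inj[OF bij_vec_coord[OF c x]] by (simp add: inj_eq)
  also have "vec_coord c (fst w) (- kkt_field M f h g w + \<mu> *\<^sub>R ehat) =
      - kkt_coord c (point_coord c w) + \<mu> *\<^sub>R ehat"
    by (simp only: linear_add[OF lin] linear_neg[OF lin] eh kkt_field_coord[OF c x])
  finally show ?thesis
    unfolding kkt_deriv_coord[OF c x] by (simp add: point_coord_def)
qed

lemma kkt_field_zero: "kkt_conditions M f h g w \<Longrightarrow> kkt_field M f h g w = 0"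
  by (cases w) (auto simp: kkt_conditions_def kkt_field_def zero_prod_def vec_eq_iff)

text \<open>At a KKT point the field vanishes, and with it the Christoffel correction, so a kernel
  vector of the coordinate derivative comes from one of the covariant derivative.\<close>

lemma kkt_coord_injective_derivative:
  assumes c: "c \<in> charts M" and x: "fst w \<in> fst c"
    and A1: "kkt_conditions M f h g w" and A2: "licq M h g (fst w)"
    and A3: "strict_complementarity g w" and A4: "second_order_sufficient M conn f h g w"
    and 0: "frechet_derivative (kkt_coord c) (at (point_coord c w)) v = 0"
  shows "v = 0"
proof -
  have F0: "kkt_coord c (point_coord c w) = 0"
    using kkt_field_coord[OF c x] kkt_field_zero[OF A1] linear_0[OF linear_vec_coord[OF c x]] by simp
  obtain \<Delta> where \<Delta>: "v = vec_coord c (fst w) \<Delta>" using surjE[OF bij_is_surj[OF bij_vec_coord[OF c x]]] by blast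
  have "vec_coord c (fst w) (kkt_deriv M conn f h g w \<Delta>) = 0"
    unfolding kkt_deriv_coord[OF c x] F0 using 0 \<Delta> by (simp add: christoffel_term_def zero_prod_def)
  then have "kkt_deriv M conn f h g w \<Delta> = 0"
    using bij_is_inj[OF bij_vec_coord[OF c x]] linear_0[OF linear_vec_coord[OF c x]] by (metis injD)
  then have "\<Delta> = 0" using kkt_deriv_injective[OF chart_points[OF c x] A1 A2 A3 A4] by blast
  then show ?thesis using \<Delta> linear_0[OF linear_vec_coord[OF c x]] by simp
qed

sublocale product: riemannian "kkt_manifold M :: (('a, 'l, 'm) kkt_point, ('e, 'l, 'm) kkt_point) rmanifold"
  unfolding kkt_manifold_def by (rule riemannian_times_euclidean)

lemma prod_chart_kkt: "c \<in> charts M \<Longrightarrow> prod_chart c \<in> charts (kkt_manifold M)"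
  by (simp add: kkt_manifold_def charts_times_euclidean)

lemma tcoord_kkt:
  assumes "c \<in> charts M" "fst w \<in> fst c"
  shows "tcoord (kkt_manifold M) (prod_chart c) w v = vec_coord c (fst w) v"
  using tcoord_prod[OF assms, of "snd w" "fst v" "snd v"] by (simp add: kkt_manifold_def vec_coord_def)

lemma snd_prod_chart_kkt: "snd (prod_chart c) w = point_coord c w"
  by (cases w) (simp add: point_coord_def)

text \<open>\<open>perturbed_newton\<close> with the Christoffel term as perturbation. Bijectivity
  of \<open>vec_coord\<close> carries existence and uniqueness back to the manifold, and the metric
  bounds on the product relate \<open>kkt_norm\<close> to the coordinate norm.\<close>

lemma local_newton:
  assumes c: "c \<in> charts M" and x: "fst ws \<in> fst c"
    and A: "kkt_conditions M f h g ws" "licq M h g (fst ws)"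
      "strict_complementarity g ws" "second_order_sufficient M conn f h g ws"
  obtains r K where "r > 0" "K > 0"
    "\<And>w \<mu>. fst w \<in> fst c \<Longrightarrow> norm (point_coord c w - point_coord c ws) \<le> r \<Longrightarrow>
        \<exists>!\<Delta>. newton_direction M conn f h g w \<mu> \<Delta>"
    "\<And>w. fst w \<in> fst c \<Longrightarrow> norm (point_coord c w - point_coord c ws) \<le> r \<Longrightarrow>
        0 \<le> kkt_norm M f h g w \<and> kkt_norm M f h g w \<le> K * norm (point_coord c w - point_coord c ws)"
    "\<And>w \<mu> \<Delta>. fst w \<in> fst c \<Longrightarrow> norm (point_coord c w - point_coord c ws) \<le> r \<Longrightarrow> 0 \<le> \<mu> \<Longrightarrow>
        newton_direction M conn f h g w \<mu> \<Delta> \<Longrightarrow>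
        norm (vec_coord c (fst w) \<Delta> + (point_coord c w - point_coord c ws)) \<le>
          K * ((norm (point_coord c w - point_coord c ws))\<^sup>2 + \<mu>)"
proof -
  let ?S = "snd c ` fst c" and ?w0 = "point_coord c ws"
  let ?T = "?S \<times> (UNIV :: ((real ^ 'l) \<times> (real ^ 'm) \<times> (real ^ 'm)) set)"
  have T: "open ?T" by (rule open_Times[OF open_chart_image[OF c] open_UNIV])
  have w0: "?w0 \<in> ?T" using x by (simp add: point_coord_def mem_Times_iff)
  obtain \<rho> where \<rho>: "\<rho> > 0" "cball (fst ?w0) \<rho> \<subseteq> ?S"
    using open_chart_image[OF c] w0[unfolded mem_Times_iff, THEN conjunct1] open_contains_cball by blast
  obtain C where C: "C > 0"
    "\<And>p u v. p \<in> cball (fst ?w0) \<rho> \<Longrightarrow> norm (christoffel_term c p u v) \<le> C * norm u * norm v"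
    by (rule christoffel_term_bound[OF c compact_cball \<rho>(2)]) (rule that; assumption)
  define B :: "('e, 'l, 'm) kkt_point \<Rightarrow> ('e, 'l, 'm) kkt_point \<Rightarrow> ('e, 'l, 'm) kkt_point"
    where "B w v = (christoffel_term c (fst w) (fst v) (fst (kkt_coord c w)), 0)" for w v
  have F0: "kkt_coord c ?w0 = 0"
    using kkt_field_coord[OF c x] kkt_field_zero[OF A(1)] linear_0[OF linear_vec_coord[OF c x]] by simp
  have B: "norm (B w v) \<le> C * norm (kkt_coord c w) * norm v" if w: "w \<in> cball ?w0 \<rho>" for w v
  proof -
    have "fst w \<in> cball (fst ?w0) \<rho>" using w dist_fst_le[of ?w0 w] by simp
    then have "norm (B w v) \<le> C * norm (fst v) * norm (fst (kkt_coord c w))"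
      using C(2) by (simp add: B_def norm_Pair)
    also have "\<dots> \<le> C * norm v * norm (kkt_coord c w)"
      using C(1) by (intro mult_mono) (auto simp: norm_fst_le_norm)
    finally show ?thesis by (simp add: mult_ac)
  qed
  have linB: "linear (B w)" for w
    unfolding B_def christoffel_term_def
    by (intro linearI) (simp_all add: inner_add_left algebra_simps sum.distrib scaleR_sum_right)
  have inj: "v = 0" if "frechet_derivative (kkt_coord c) (at ?w0) v = 0" for v
    using kkt_coord_injective_derivative[OF c x A that] .
  obtain r K where rK: "r > 0" "K > 0"
    and N1: "\<And>w b. norm (w - ?w0) \<le> r \<Longrightarrow> \<exists>!v. frechet_derivative (kkt_coord c) (at w) v + B w v = b"
    and N2: "\<And>w. norm (w - ?w0) \<le> r \<Longrightarrow> norm (kkt_coord c w) \<le> K * norm (w - ?w0)"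
    and N3: "\<And>w v u. norm (w - ?w0) \<le> r \<Longrightarrow> frechet_derivative (kkt_coord c) (at w) v + B w v = - kkt_coord c w + u \<Longrightarrow>
        norm (v + (w - ?w0)) \<le> K * ((norm (w - ?w0))\<^sup>2 + norm u)"
    by (rule perturbed_newton[OF T C_k_on_kkt_coord[OF c] w0 F0 inj \<rho>(1) C(1) B linB])
      (assumption | (rule that; assumption))+
  have newton: "newton_direction M conn f h g w \<mu> \<Delta> \<longleftrightarrow>
      frechet_derivative (kkt_coord c) (at (point_coord c w)) (vec_coord c (fst w) \<Delta>) +
      B (point_coord c w) (vec_coord c (fst w) \<Delta>) = - kkt_coord c (point_coord c w) + \<mu> *\<^sub>R ehat"
    if "fst w \<in> fst c" for w \<mu> \<Delta>
    using newton_coord[OF c that] by (simp add: B_def)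
  obtain r2 where r2: "r2 > 0" "cball ?w0 r2 \<subseteq> ?T"
    using bspec[OF T[unfolded open_contains_cball] w0] by (elim exE conjE)
  have "snd (prod_chart c) ` fst (prod_chart c :: (('a, 'l, 'm) kkt_point, ('e, 'l, 'm) kkt_point) chart) = ?T"
    by (simp add: image_prod_chart)
  with r2(2) have r2': "cball ?w0 r2 \<subseteq> snd (prod_chart c) ` fst (prod_chart c)" by simp
  obtain k B' where B': "B' > 0" "\<And>w v. w \<in> fst (prod_chart c) \<Longrightarrow> snd (prod_chart c) w \<in> cball ?w0 r2 \<Longrightarrow>
      tnorm (kkt_manifold M) w v \<le> B' * norm (tcoord (kkt_manifold M) (prod_chart c) w v)"
    by (rule product.metric_chart_bounds[OF prod_chart_kkt[OF c] compact_cball r2']) (rule that; assumption)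
  define ne :: real where "ne = norm (ehat :: ('e, 'l, 'm) kkt_point)"
  \<comment> \<open>The factor \<open>1 + ne\<close> absorbs the norm of
    \<open>\<mu> *\<^sub>R ehat\<close>; the summand \<open>B' * K\<close> pays for the passage from
    the coordinate norm to the Riemannian norm.\<close>
  define K' where "K' = K * (1 + ne) + B' * K"
  have ne: "ne \<ge> 0" by (simp add: ne_def)
  have K': "K' > 0" "B' * K \<le> K'" "K * (1 + ne) \<le> K'" using rK B'(1) ne by (auto simp: K'_def add_pos_pos add_nonneg_pos)
  show thesis
  proof (rule that[of "min r r2" K'])
    show "0 < min r r2" "0 < K'" using rK r2 K' by auto
  next
    fix w \<mu> assume w: "fst w \<in> fst c" "norm (point_coord c w - ?w0) \<le> min r r2"
    define P where "P v \<longleftrightarrow> frechet_derivative (kkt_coord c) (at (point_coord c w)) v + B (point_coord c w) v =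
        - kkt_coord c (point_coord c w) + \<mu> *\<^sub>R ehat" for v
    have ex: "\<exists>!v. P v" unfolding P_def by (rule N1) (use w in simp)
    then obtain v where v: "P v" "\<And>v'. P v' \<Longrightarrow> v' = v" by blast
    obtain \<Delta> where \<Delta>: "v = vec_coord c (fst w) \<Delta>"
      using surjE[OF bij_is_surj[OF bij_vec_coord[OF c w(1)]]] by blast
    show "\<exists>!\<Delta>. newton_direction M conn f h g w \<mu> \<Delta>"
    proof (rule ex1I[of _ \<Delta>])
      show "newton_direction M conn f h g w \<mu> \<Delta>" using v(1) by (simp add: newton[OF w(1)] \<Delta> P_def)
      fix \<Delta>' assume "newton_direction M conn f h g w \<mu> \<Delta>'"
      then have "vec_coord c (fst w) \<Delta>' = vec_coord c (fst w) \<Delta>"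
        using v(2) by (simp add: newton[OF w(1)] \<Delta> P_def)
      then show "\<Delta>' = \<Delta>" by (rule injD[OF bij_is_inj[OF bij_vec_coord[OF c w(1)]]])
    qed
  next
    fix w assume w: "fst w \<in> fst c" "norm (point_coord c w - ?w0) \<le> min r r2"
    have "w \<in> fst (prod_chart c)" using w(1) by (simp add: mem_Times_iff)
    then have "kkt_norm M f h g w \<le> B' * norm (kkt_coord c (point_coord c w))"
      using B'(2)[of w "kkt_field M f h g w"] w
      by (simp only: kkt_norm_def tcoord_kkt[OF c w(1)] kkt_field_coord[OF c w(1)] snd_prod_chart_kkt)
        (simp add: dist_norm norm_minus_commute)
    also have "\<dots> \<le> B' * (K * norm (point_coord c w - ?w0))"
      using N2[of "point_coord c w"] w B'(1) by (intro mult_left_mono) auto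
    also have "\<dots> \<le> K' * norm (point_coord c w - ?w0)"
      unfolding mult.assoc[symmetric] using K' by (intro mult_right_mono) auto
    finally have "kkt_norm M f h g w \<le> K' * norm (point_coord c w - ?w0)" .
    moreover have "0 \<le> kkt_norm M f h g w"
      unfolding kkt_norm_def
      by (rule product.tnorm_nonneg[OF product.chart_points[OF prod_chart_kkt[OF c]]])
        (use w(1) in \<open>simp add: mem_Times_iff\<close>)
    ultimately show "0 \<le> kkt_norm M f h g w \<and> kkt_norm M f h g w \<le> K' * norm (point_coord c w - ?w0)"
      by (intro conjI)
  next
    fix w \<mu> \<Delta> assume w: "fst w \<in> fst c" "norm (point_coord c w - ?w0) \<le> min r r2" and \<mu>: "0 \<le> \<mu>"
      and nd: "newton_direction M conn f h g w \<mu> \<Delta>"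
    let ?e = "norm (point_coord c w - ?w0)"
    have "norm (vec_coord c (fst w) \<Delta> + (point_coord c w - ?w0)) \<le> K * (?e\<^sup>2 + norm (\<mu> *\<^sub>R ehat :: ('e, 'l, 'm) kkt_point))"
      by (rule N3) (use w nd newton[OF w(1)] in auto)
    also have "\<dots> \<le> K * ((1 + ne) * (?e\<^sup>2 + \<mu>))"
      using rK(2) \<mu> ne by (intro mult_left_mono) (auto simp: ne_def algebra_simps)
    also have "\<dots> \<le> K' * (?e\<^sup>2 + \<mu>)"
      unfolding mult.assoc[symmetric] using K' \<mu> by (intro mult_right_mono) auto
    finally show "norm (vec_coord c (fst w) \<Delta> + (point_coord c w - ?w0)) \<le> K' * (?e\<^sup>2 + \<mu>)" .
  qed
qed

end

section \<open>Convergence of the algorithm\<close>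

context kkt_problem
begin

text \<open>For an active index the multiplier is positive, for an inactive one the slack. The
  margin is \<open>2 * \<eta>\<close> so that \<open>\<eta>\<close> is left at all points within
  \<open>\<eta>\<close> of the solution.\<close>

lemma complementarity_margin:
  assumes A1: "kkt_conditions M f h g ws" and A3: "strict_complementarity g ws"
  obtains \<eta> where "\<eta> > 0" "\<And>i. 2 * \<eta> \<le> fst (snd (snd ws)) $ i \<or> 2 * \<eta> \<le> snd (snd (snd ws)) $ i"
proof -
  obtain x y z s where ws: "ws = (x, y, z, s)" by (cases ws)
  define \<eta> where "\<eta> = Min (range (\<lambda>i. max (z $ i) (s $ i))) / 2"
  have "0 < max (z $ i) (s $ i)" for i
  proof (cases "g x $ i = 0")
    case True
    then have "0 < z $ i" using A3 by (simp add: ws strict_complementarity_def)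
    then show ?thesis by simp
  next
    case False
    moreover have "g x $ i \<le> 0" "s $ i = - g x $ i" using A1 by (simp_all add: ws kkt_conditions_def)
    ultimately show ?thesis by simp
  qed
  then have "\<eta> > 0" by (simp add: \<eta>_def)
  moreover have "2 * \<eta> \<le> max (z $ i) (s $ i)" for i
    unfolding \<eta>_def by (simp add: Min_le)
  ultimately show thesis using that by (simp add: ws le_max_iff_disj)
qed

lemma newton_complementarity:
  assumes "newton_direction M conn f h g (x, y, z, s) \<mu> (dx, dy, dz, ds)"
  shows "z $ i * ds $ i + s $ i * dz $ i = - (z $ i * s $ i) + \<mu>"
  using assms by (simp add: newton_direction_def kkt_deriv_def kkt_field_def ehat_def vec_eq_iff)

text \<open>With coordinate error \<open>E\<close> and Newton direction \<open>v\<close>, the new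
  error is the retraction remainder plus \<open>(1 - \<alpha>) *\<^sub>R E\<close> plus
  \<open>\<alpha> *\<^sub>R (v + E)\<close>. The first is quadratic in the step, the second is
  governed by the ratio test, the third by the Newton estimate.\<close>

lemma local_step:
  assumes R: "manifold_retraction M R" and c: "c \<in> charts M" and x: "fst ws \<in> fst c"
    and A: "kkt_conditions M f h g ws" "licq M h g (fst ws)"
      "strict_complementarity g ws" "second_order_sufficient M conn f h g ws"
  obtains r K where "0 < r" "r \<le> 1" "0 < K"
    "\<And>w w' \<mu> \<Delta> \<gamma>. fst w \<in> fst c \<Longrightarrow> norm (point_coord c w - point_coord c ws) \<le> r \<Longrightarrow> nonneg_zs w \<Longrightarrow>
        0 \<le> \<mu> \<Longrightarrow> \<mu> \<le> r \<Longrightarrow> newton_direction M conn f h g w \<mu> \<Delta> \<Longrightarrow> 0 \<le> \<gamma> \<Longrightarrow> \<gamma> \<le> 1 \<Longrightarrow>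
        w' = kkt_retraction R w (step_size w \<Delta> \<gamma> *\<^sub>R \<Delta>) \<Longrightarrow>
        fst w' \<in> fst c \<and> nonneg_zs w' \<and>
        norm (point_coord c w' - point_coord c ws) \<le>
          (1 - \<gamma>) * norm (point_coord c w - point_coord c ws) +
          K * ((norm (point_coord c w - point_coord c ws))\<^sup>2 + \<mu>)"
proof -
  let ?w0 = "point_coord c ws"
  obtain r1 K1 where K1: "r1 > 0" "K1 > 0"
    and N: "\<And>w \<mu> \<Delta>. fst w \<in> fst c \<Longrightarrow> norm (point_coord c w - ?w0) \<le> r1 \<Longrightarrow> 0 \<le> \<mu> \<Longrightarrow>
        newton_direction M conn f h g w \<mu> \<Delta> \<Longrightarrow>
        norm (vec_coord c (fst w) \<Delta> + (point_coord c w - ?w0)) \<le>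
          K1 * ((norm (point_coord c w - ?w0))\<^sup>2 + \<mu>)"
    by (rule local_newton[OF c x A]) (rule that; assumption)
  obtain rR L where RL: "rR > 0" "L > 0"
    and Ret: "\<And>x v. x \<in> fst c \<Longrightarrow> snd c x \<in> cball (snd c (fst ws)) rR \<Longrightarrow> norm (tcoord M c x v) \<le> rR \<Longrightarrow>
      R x v \<in> fst c \<and> norm (snd c (R x v) - snd c x - tcoord M c x v) \<le> L * (norm (tcoord M c x v))\<^sup>2"
    by (rule retraction_chart_estimate[OF R c x]) (rule that; assumption)
  obtain \<eta> where \<eta>: "\<eta> > 0" "\<And>i. 2 * \<eta> \<le> fst (snd (snd ws)) $ i \<or> 2 * \<eta> \<le> snd (snd (snd ws)) $ i"
    by (rule complementarity_margin[OF A(1,3)]) (rule that; assumption)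
  \<comment> \<open>The factor in \<open>norm v \<le> \<kappa> * (e + \<mu>)\<close>: 1 for the
    error itself, \<open>K1\<close> for the deviation of \<open>v\<close> from its negative.\<close>
  define \<kappa> where "\<kappa> = 1 + K1"
  have \<kappa>: "\<kappa> > 0" "1 \<le> \<kappa>" "K1 \<le> \<kappa>" using K1 by (auto simp: \<kappa>_def)
  \<comment> \<open>With \<open>e\<close> and \<open>\<mu>\<close> at most \<open>r\<close>, the
    last entry keeps the norm of the direction within \<open>rR\<close> and \<open>\<eta>\<close>,
    the ranges of the retraction estimate and of the ratio test.\<close>
  define r where "r = min (min r1 1) (min (min rR \<eta>) (min rR \<eta> / (2 * \<kappa>)))"
  have r: "0 < r" "r \<le> r1" "r \<le> 1" "r \<le> rR" "r \<le> \<eta>" "r \<le> min rR \<eta> / (2 * \<kappa>)"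
    using K1 RL \<eta> \<kappa> by (auto simp: r_def)
  \<comment> \<open>One summand for each part of the new error: retraction, damping, Newton.\<close>
  define K where "K = L * (2 * \<kappa>\<^sup>2) + \<kappa> / \<eta> + K1"
  have K: "0 < K" using RL \<kappa> \<eta> K1 by (auto simp: K_def intro!: add_nonneg_pos add_nonneg_nonneg)
  show thesis
  proof (rule that[OF r(1,3) K])
    fix w w' :: "('a, 'l, 'm) kkt_point" and \<mu> \<gamma> :: real and \<Delta> :: "('e, 'l, 'm) kkt_point"
    assume w: "fst w \<in> fst c" "norm (point_coord c w - ?w0) \<le> r" and nn: "nonneg_zs w"
      and \<mu>: "0 \<le> \<mu>" "\<mu> \<le> r" and nd: "newton_direction M conn f h g w \<mu> \<Delta>"
      and \<gamma>: "0 \<le> \<gamma>" "\<gamma> \<le> 1" and w': "w' = kkt_retraction R w (step_size w \<Delta> \<gamma> *\<^sub>R \<Delta>)"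
    obtain x1 y z s where w1: "w = (x1, y, z, s)" by (cases w)
    obtain dx dy dz ds where \<Delta>1: "\<Delta> = (dx, dy, dz, ds)" by (cases \<Delta>)
    have x1: "x1 \<in> fst c" using w w1 by simp
    define e where "e = norm (point_coord c w - ?w0)"
    define v where "v = vec_coord c (fst w) \<Delta>"
    define D where "D = norm v"
    define \<alpha> where "\<alpha> = step_size w \<Delta> \<gamma>"
    have e: "0 \<le> e" "e \<le> r" "e \<le> 1" using w(2) r by (auto simp: e_def)
    have ve: "norm (v + (point_coord c w - ?w0)) \<le> K1 * (e\<^sup>2 + \<mu>)"
      unfolding v_def e_def by (rule N[OF w(1) _ \<mu>(1) nd]) (use w r in simp)
    have e2: "e\<^sup>2 \<le> e" using e by (simp add: power2_eq_square mult_left_le)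
    have "D \<le> norm (v + (point_coord c w - ?w0)) + e"
      unfolding D_def e_def using norm_triangle_ineq4[of "v + (point_coord c w - ?w0)" "point_coord c w - ?w0"] by simp
    also have "\<dots> \<le> K1 * (e + \<mu>) + (e + \<mu>)"
    proof -
      have "K1 * (e\<^sup>2 + \<mu>) \<le> K1 * (e + \<mu>)" using e2 K1 by simp
      then show ?thesis using ve \<mu> by linarith
    qed
    finally have D: "D \<le> \<kappa> * (e + \<mu>)" by (simp add: \<kappa>_def algebra_simps)
    have D0: "0 \<le> D" by (simp add: D_def)
    have "\<kappa> * (e + \<mu>) \<le> \<kappa> * (2 * (min rR \<eta> / (2 * \<kappa>)))"
      using e \<mu> r \<kappa> by (intro mult_left_mono) auto
    also have "\<dots> = min rR \<eta>" using \<kappa> by simp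
    finally have Dr: "D \<le> rR" "D \<le> \<eta>" using D by auto
    have vd: "v = (tcoord M c x1 dx, dy, dz, ds)" by (simp add: v_def vec_coord_def w1 \<Delta>1)
    have comp: "\<bar>dz $ i\<bar> \<le> D" "\<bar>ds $ i\<bar> \<le> D" for i
    proof -
      have "norm dz \<le> D" "norm ds \<le> D"
        using norm_fst_le_norm[of "(dz, ds)"] norm_snd_le_norm[of "(dz, ds)"] norm_snd_le_norm[of "(dy, dz, ds)"] norm_snd_le_norm[of v]
        by (auto simp: D_def vd)
      then show "\<bar>dz $ i\<bar> \<le> D" "\<bar>ds $ i\<bar> \<le> D"
        using component_le_norm_cart[of dz i] component_le_norm_cart[of ds i] by linarith+
    qed
    have near: "\<bar>z $ i - fst (snd (snd ws)) $ i\<bar> \<le> \<eta>" "\<bar>s $ i - snd (snd (snd ws)) $ i\<bar> \<le> \<eta>" for i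
    proof -
      let ?d = "point_coord c w - ?w0"
      have "norm (fst (snd (snd ?d))) \<le> e" "norm (snd (snd (snd ?d))) \<le> e"
        unfolding e_def using norm_fst_le_norm[of "snd (snd ?d)"] norm_snd_le_norm[of "snd (snd ?d)"]
          norm_snd_le_norm[of "snd ?d"] norm_snd_le_norm[of ?d] by linarith+
      moreover have "fst (snd (snd ?d)) = z - fst (snd (snd ws))" "snd (snd (snd ?d)) = s - snd (snd (snd ws))"
        by (simp_all add: point_coord_def w1)
      ultimately show "\<bar>z $ i - fst (snd (snd ws)) $ i\<bar> \<le> \<eta>" "\<bar>s $ i - snd (snd (snd ws)) $ i\<bar> \<le> \<eta>"
        using component_le_norm_cart[of "z - fst (snd (snd ws))" i]
          component_le_norm_cart[of "s - snd (snd (snd ws))" i] e(2) r(5) by simp_all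
    qed
    have margin: "\<eta> \<le> z $ i \<or> \<eta> \<le> s $ i" for i
      using \<eta>(2)[of i] near[of i] by linarith
    have nz: "0 \<le> z $ i" and ns: "0 \<le> s $ i" for i using nn by (simp_all add: nonneg_zs_def w1)
    have cm: "- (z $ i * s $ i) \<le> z $ i * ds $ i + s $ i * dz $ i" for i
      using newton_complementarity[OF nd[unfolded w1 \<Delta>1], of i] \<mu> by simp
    note sb = step_size_bounds[OF nz ns cm comp D0 Dr(2) \<eta>(1) margin \<gamma>, folded w1 \<Delta>1 \<alpha>_def]
    have sb': "0 \<le> \<alpha>" "\<alpha> \<le> 1" "\<gamma> * (1 - D / \<eta>) \<le> \<alpha>"
      "0 \<le> z $ i + \<alpha> * dz $ i" "0 \<le> s $ i + \<alpha> * ds $ i" for i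
      using sb[where x = x1 and y = y and dx = dx and dy = dy] by (simp_all add: w1 \<Delta>1 \<alpha>_def)
    have w'1: "w' = (R x1 (\<alpha> *\<^sub>R dx), y + \<alpha> *\<^sub>R dy, z + \<alpha> *\<^sub>R dz, s + \<alpha> *\<^sub>R ds)"
      using w' by (simp add: kkt_retraction_def \<alpha>_def) (simp add: w1 \<Delta>1)
    have nn': "nonneg_zs w'" using sb'(4,5) by (simp add: nonneg_zs_def w'1)
    let ?u = "tcoord M c x1 (\<alpha> *\<^sub>R dx)"
    have u: "?u = \<alpha> *\<^sub>R tcoord M c x1 dx" using linear_scale[OF linear_tcoord[OF c x1]] .
    have "norm (tcoord M c x1 dx) \<le> D" using norm_fst_le_norm[of v] by (simp add: vd D_def)
    then have uD: "norm ?u \<le> D"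
      using mult_left_le_one_le[of "norm (tcoord M c x1 dx)" \<alpha>] sb'(1,2) by (simp add: u)
    have "snd c x1 \<in> cball (snd c (fst ws)) rR"
      using norm_fst_le_norm[of "point_coord c w - ?w0"] w(2) r(4)
      by (simp add: point_coord_def w1 dist_norm norm_minus_commute)
    from Ret[OF x1 this, of "\<alpha> *\<^sub>R dx"] uD Dr(1)
    have Rx: "R x1 (\<alpha> *\<^sub>R dx) \<in> fst c" "norm (snd c (R x1 (\<alpha> *\<^sub>R dx)) - snd c x1 - ?u) \<le> L * (norm ?u)\<^sup>2"
      by auto
    let ?rem = "point_coord c w' - point_coord c w - \<alpha> *\<^sub>R v"
    have "?rem = (snd c (R x1 (\<alpha> *\<^sub>R dx)) - snd c x1 - ?u, 0)"
      by (simp add: point_coord_def w'1 w1 vd u zero_prod_def)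
    then have "norm ?rem \<le> L * (norm ?u)\<^sup>2" using Rx(2) by (simp add: norm_Pair)
    also have "\<dots> \<le> L * (\<kappa> * (e + \<mu>))\<^sup>2"
      using uD D RL by (intro mult_left_mono power_mono) auto
    also have "\<dots> \<le> L * (2 * \<kappa>\<^sup>2 * (e\<^sup>2 + \<mu>))"
    proof -
      \<comment> \<open>Since \<open>\<mu> \<le> r \<le> 1\<close>, the squared step, of order
        \<open>(e + \<mu>)\<^sup>2\<close>, fits under a multiple of
        \<open>e\<^sup>2 + \<mu>\<close>.\<close>
      have "\<mu>\<^sup>2 \<le> \<mu>" using \<mu> r by (simp add: power2_eq_square mult_left_le)
      moreover have "(e + \<mu>)\<^sup>2 \<le> 2 * (e\<^sup>2 + \<mu>\<^sup>2)"
        using sum_squares_bound[of e \<mu>] by (simp add: power2_sum)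
      ultimately have "(e + \<mu>)\<^sup>2 \<le> 2 * (e\<^sup>2 + \<mu>)" by simp
      then have "\<kappa>\<^sup>2 * (e + \<mu>)\<^sup>2 \<le> \<kappa>\<^sup>2 * (2 * (e\<^sup>2 + \<mu>))" by (intro mult_left_mono) auto
      then have "(\<kappa> * (e + \<mu>))\<^sup>2 \<le> 2 * \<kappa>\<^sup>2 * (e\<^sup>2 + \<mu>)"
        by (simp only: power_mult_distrib mult.left_commute mult.assoc)
      then show ?thesis using RL by (intro mult_left_mono) auto
    qed
    finally have rem: "norm ?rem \<le> L * (2 * \<kappa>\<^sup>2) * (e\<^sup>2 + \<mu>)" by (simp add: mult_ac)
    have q: "0 \<le> e\<^sup>2 + \<mu>" using \<mu> by simp
    \<comment> \<open>Damping costs \<open>1 - \<gamma>\<close> plus \<open>D / \<eta>\<close>;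
      multiplied by \<open>e\<close>, the second term is again of order
      \<open>e\<^sup>2 + \<mu>\<close>.\<close>
    have "1 - \<alpha> \<le> 1 - \<gamma> + \<gamma> * (D / \<eta>)" using sb'(3) by (simp add: algebra_simps)
    also have "\<gamma> * (D / \<eta>) \<le> 1 * (D / \<eta>)" using \<gamma> D0 \<eta> by (intro mult_right_mono) auto
    also have "1 * (D / \<eta>) \<le> \<kappa> / \<eta> * (e + \<mu>)" using D \<eta> by (simp add: divide_right_mono)
    finally have "(1 - \<alpha>) * e \<le> (1 - \<gamma> + \<kappa> / \<eta> * (e + \<mu>)) * e" using e by (intro mult_right_mono) auto
    also have "\<dots> = (1 - \<gamma>) * e + \<kappa> / \<eta> * (e * e + \<mu> * e)" by (simp only: distrib_right distrib_left mult.assoc)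
    also have "\<dots> \<le> (1 - \<gamma>) * e + \<kappa> / \<eta> * (e\<^sup>2 + \<mu>)"
      using e \<mu> \<kappa> \<eta> by (intro add_left_mono mult_left_mono) (auto simp: power2_eq_square mult_left_le)
    finally have damp: "(1 - \<alpha>) * e \<le> (1 - \<gamma>) * e + \<kappa> / \<eta> * (e\<^sup>2 + \<mu>)" .
    have "point_coord c w' - ?w0 = ?rem + (1 - \<alpha>) *\<^sub>R (point_coord c w - ?w0) + \<alpha> *\<^sub>R (v + (point_coord c w - ?w0))"
      by (simp add: algebra_simps)
    then have "norm (point_coord c w' - ?w0) \<le> norm ?rem + norm ((1 - \<alpha>) *\<^sub>R (point_coord c w - ?w0)) +
        norm (\<alpha> *\<^sub>R (v + (point_coord c w - ?w0)))"
      by (metis norm_triangle_mono norm_triangle_ineq order_refl)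
    also have "\<dots> \<le> L * (2 * \<kappa>\<^sup>2) * (e\<^sup>2 + \<mu>) + ((1 - \<gamma>) * e + \<kappa> / \<eta> * (e\<^sup>2 + \<mu>)) + K1 * (e\<^sup>2 + \<mu>)"
    proof (intro add_mono rem)
      show "norm ((1 - \<alpha>) *\<^sub>R (point_coord c w - ?w0)) \<le> (1 - \<gamma>) * e + \<kappa> / \<eta> * (e\<^sup>2 + \<mu>)"
        using damp sb'(2) by (simp add: e_def)
      have "\<alpha> * norm (v + (point_coord c w - ?w0)) \<le> norm (v + (point_coord c w - ?w0))"
        using sb'(1,2) by (intro mult_left_le_one_le) auto
      then show "norm (\<alpha> *\<^sub>R (v + (point_coord c w - ?w0))) \<le> K1 * (e\<^sup>2 + \<mu>)"
        using ve sb'(1) by simp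
    qed
    also have "\<dots> = (1 - \<gamma>) * e + K * (e\<^sup>2 + \<mu>)" by (simp add: K_def algebra_simps)
    finally show "fst w' \<in> fst c \<and> nonneg_zs w' \<and> norm (point_coord c w' - ?w0) \<le>
          (1 - \<gamma>) * norm (point_coord c w - ?w0) + K * ((norm (point_coord c w - ?w0))\<^sup>2 + \<mu>)"
      using Rx(1) nn' by (simp add: w'1 e_def)
  qed
qed

text \<open>The constants are obtained before any run is considered. The bound on
  \<open>\<mu> k\<close> is demanded only where the iterate is near the solution, since the KKT norm
  is known to be bounded by the error only there; the induction supplies this nearness step by
  step.\<close>

lemma local_run:
  fixes \<tau> :: "nat \<Rightarrow> real"
  assumes R: "manifold_retraction M R" and c: "c \<in> charts M" and x: "fst ws \<in> fst c"
    and A: "kkt_conditions M f h g ws" "licq M h g (fst ws)"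
      "strict_complementarity g ws" "second_order_sufficient M conn f h g ws"
    and \<gamma>0: "0 < \<gamma>0" "\<gamma>0 < 1" and \<tau>: "\<tau> \<longlonglongrightarrow> 0" "\<And>k. 0 \<le> \<tau> k" and Q: "0 \<le> Q" and \<rho>0: "0 < \<rho>0"
  defines "err \<equiv> \<lambda>w :: ('a, 'l, 'm) kkt_point. norm (point_coord c w - point_coord c ws)"
  obtains \<delta> \<rho> K N where "0 < \<delta>" "0 < \<rho>" "\<rho> \<le> \<rho>0" "0 < K"
    "\<And>n w \<mu> \<gamma>. rip_steps M conn f h g R \<gamma>0 n w \<mu> \<gamma> \<Longrightarrow> fst (w 0) \<in> fst c \<Longrightarrow> err (w 0) < \<delta> \<Longrightarrow>
      (\<forall>k\<le>n. fst (w k) \<in> fst c \<and> err (w k) < \<rho> \<longrightarrow> \<mu> k \<le> \<tau> k * err (w k) + Q * (err (w k))\<^sup>2) \<Longrightarrow>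
      (\<forall>k\<le>n. fst (w k) \<in> fst c \<and> err (w k) < \<rho>) \<and>
      (\<forall>k<n. err (w (Suc k)) \<le> (1 - \<gamma> k) * err (w k) + K * ((err (w k))\<^sup>2 + \<mu> k) \<and>
        (N \<le> k \<longrightarrow> err (w (Suc k)) \<le> (1 - \<gamma>0 / 2) * err (w k)))"
proof -
  obtain r K where r: "0 < r" "r \<le> 1" "0 < K"
    and step: "\<And>w w' \<mu> \<Delta> \<gamma>. fst w \<in> fst c \<Longrightarrow> err w \<le> r \<Longrightarrow> nonneg_zs w \<Longrightarrow>
        0 \<le> \<mu> \<Longrightarrow> \<mu> \<le> r \<Longrightarrow> newton_direction M conn f h g w \<mu> \<Delta> \<Longrightarrow> 0 \<le> \<gamma> \<Longrightarrow> \<gamma> \<le> 1 \<Longrightarrow>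
        w' = kkt_retraction R w (step_size w \<Delta> \<gamma> *\<^sub>R \<Delta>) \<Longrightarrow>
        fst w' \<in> fst c \<and> nonneg_zs w' \<and> err w' \<le> (1 - \<gamma>) * err w + K * ((err w)\<^sup>2 + \<mu>)"
    by (rule local_step[OF R c x A]) (rule that; unfold err_def; assumption)
  obtain T where T: "\<And>k. \<tau> k \<le> T"
  proof -
    have "Bseq \<tau>" using convergent_imp_Bseq[OF convergentI[OF \<tau>(1)]] .
    then obtain T where "\<And>k. norm (\<tau> k) \<le> T" by (auto simp: Bseq_def)
    then show thesis using that[of T] by (metis abs_le_D1 real_norm_def)
  qed
  have T0: "0 \<le> T" using T[of 0] \<tau>(2)[of 0] by simp
  have "\<forall>\<^sub>F k in sequentially. \<tau> k < \<gamma>0 / (4 * K)"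
    using \<tau>(1) \<gamma>0 r by (intro order_tendstoD(2)) auto
  \<comment> \<open>Budget for the contraction from step \<open>N\<close> on: of the guaranteed gain
    \<open>\<gamma>0\<close>, one quarter pays for the part of \<open>\<mu>\<close> that is linear
    in the error and one quarter, through \<open>\<rho>\<close>, for the quadratic terms. Half is
    left.\<close>
  then obtain N where N: "\<And>k. N \<le> k \<Longrightarrow> \<tau> k < \<gamma>0 / (4 * K)" by (auto simp: eventually_sequentially)
  \<comment> \<open>Worst growth in one step, from \<open>1 - \<gamma> k \<le> 1\<close>,
    \<open>\<mu> k \<le> (T + Q) * e\<close> and \<open>e\<^sup>2 \<le> e\<close>.\<close>
  define G where "G = 1 + K * (1 + Q + T)"
  have G: "1 \<le> G" using r Q T0 by (simp add: G_def)
  \<comment> \<open>The second entry keeps the error and \<open>\<mu> k\<close> within the radius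
    \<open>r\<close> of \<open>local_step\<close>; the third is the quadratic share of the
    budget.\<close>
  define \<rho> where "\<rho> = min \<rho>0 (min (r / (1 + T + Q)) (\<gamma>0 / (4 * (K * (1 + Q)))))"
  have \<rho>: "0 < \<rho>" "\<rho> \<le> \<rho>0" using \<rho>0 r T0 Q \<gamma>0 by (auto simp: \<rho>_def add_pos_nonneg)
  have \<rho>1: "(1 + T + Q) * t \<le> r" if "t < \<rho>" for t
  proof -
    have "t \<le> r / (1 + T + Q)" using that by (simp add: \<rho>_def)
    then show ?thesis using T0 Q by (simp add: pos_le_divide_eq mult.commute)
  qed
  have \<rho>2: "K * (1 + Q) * t \<le> \<gamma>0 / 4" if "t < \<rho>" for t
  proof -
    have "t \<le> \<gamma>0 / (4 * (K * (1 + Q)))" using that by (simp add: \<rho>_def)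
    moreover have "0 < 4 * (K * (1 + Q))" using r Q by simp
    ultimately have "t * (4 * (K * (1 + Q))) \<le> \<gamma>0" by (simp only: pos_le_divide_eq)
    then show ?thesis by (simp add: mult_ac)
  qed
  have err0: "0 \<le> err w" for w by (simp add: err_def)
  show thesis
  \<comment> \<open>Before step \<open>N\<close> the error may grow by the factor \<open>G\<close>
    each time; dividing by \<open>G ^ N\<close> pays for all of it in advance.\<close>
  proof (rule that[of "\<rho> / G ^ N" \<rho> K N])
    show "0 < \<rho> / G ^ N" using \<rho> G by simp
    fix n and w :: "nat \<Rightarrow> ('a, 'l, 'm) kkt_point" and \<mu> \<gamma> :: "nat \<Rightarrow> real"
    assume rip: "rip_steps M conn f h g R \<gamma>0 n w \<mu> \<gamma>" and w0: "fst (w 0) \<in> fst c" "err (w 0) < \<rho> / G ^ N"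
      and \<mu>le: "\<forall>k\<le>n. fst (w k) \<in> fst c \<and> err (w k) < \<rho> \<longrightarrow> \<mu> k \<le> \<tau> k * err (w k) + Q * (err (w k))\<^sup>2"
    have \<mu>0: "0 < \<mu> k" if "k \<le> n" for k
      using rip that by (cases k) (auto simp: rip_steps_def)
    have G0: "G ^ min k N * err (w 0) < \<rho>" for k
    proof -
      have "G ^ min k N * err (w 0) \<le> G ^ N * err (w 0)"
        using G err0 by (intro mult_right_mono power_increasing) auto
      also have "\<dots> < \<rho>" using w0(2) G by (simp add: pos_less_divide_eq mult.commute)
      finally show ?thesis .
    qed
    have one: "fst (w (Suc k)) \<in> fst c \<and> nonneg_zs (w (Suc k)) \<and>
        err (w (Suc k)) \<le> (1 - \<gamma> k) * err (w k) + K * ((err (w k))\<^sup>2 + \<mu> k) \<and>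
        err (w (Suc k)) \<le> G * err (w k) \<and> (N \<le> k \<longrightarrow> err (w (Suc k)) \<le> (1 - \<gamma>0 / 2) * err (w k))"
      if k: "k < n" and wk: "fst (w k) \<in> fst c" "nonneg_zs (w k)" "err (w k) < \<rho>" for k
    proof -
      let ?e = "err (w k)"
      have gk: "\<gamma>0 \<le> \<gamma> k" "\<gamma> k \<le> 1"
        and "\<exists>\<Delta>. newton_direction M conn f h g (w k) (\<mu> k) \<Delta> \<and>
             w (Suc k) = kkt_retraction R (w k) (step_size (w k) \<Delta> (\<gamma> k) *\<^sub>R \<Delta>)"
        using rip k by (auto simp: rip_steps_def)
      then obtain \<Delta> where \<Delta>: "newton_direction M conn f h g (w k) (\<mu> k) \<Delta>"
        "w (Suc k) = kkt_retraction R (w k) (step_size (w k) \<Delta> (\<gamma> k) *\<^sub>R \<Delta>)" by blast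
      have er: "(1 + T + Q) * ?e \<le> r" using \<rho>1[OF wk(3)] .
      have e_r: "?e \<le> r"
      proof -
        have "?e \<le> (1 + T + Q) * ?e" using err0 T0 Q by (simp add: distrib_right)
        then show ?thesis using er by simp
      qed
      then have e1: "?e \<le> 1" using r by simp
      have e2: "?e\<^sup>2 \<le> ?e" using e1 err0 by (simp add: power2_eq_square mult_left_le)
      have \<mu>k: "\<mu> k \<le> \<tau> k * ?e + Q * ?e\<^sup>2" using \<mu>le k wk by simp
      have "\<tau> k * ?e + Q * ?e\<^sup>2 \<le> T * ?e + Q * ?e"
        using T e2 Q err0 by (intro add_mono mult_left_mono mult_right_mono) auto
      then have \<mu>T: "\<mu> k \<le> T * ?e + Q * ?e" using \<mu>k by simp
      then have "\<mu> k \<le> r" using er err0[of "w k"] by (simp add: distrib_right)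
      from step[OF wk(1) e_r wk(2) _ this \<Delta>(1) _ gk(2) \<Delta>(2)] \<mu>0[of k] k gk \<gamma>0
      have st: "fst (w (Suc k)) \<in> fst c" "nonneg_zs (w (Suc k))"
        "err (w (Suc k)) \<le> (1 - \<gamma> k) * ?e + K * (?e\<^sup>2 + \<mu> k)" by auto
      have "err (w (Suc k)) \<le> G * ?e"
      proof -
        have "(1 - \<gamma> k) * ?e \<le> 1 * ?e" using gk \<gamma>0 err0 by (intro mult_right_mono) auto
        moreover have "K * (?e\<^sup>2 + \<mu> k) \<le> K * (?e + (T * ?e + Q * ?e))"
          using e2 \<mu>T r by (intro mult_left_mono add_mono) auto
        ultimately show ?thesis using st(3) by (simp add: G_def algebra_simps)
      qed
      moreover have "err (w (Suc k)) \<le> (1 - \<gamma>0 / 2) * ?e" if "N \<le> k"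
      proof -
        have "K * \<tau> k \<le> \<gamma>0 / 4" using N[OF that] r by (simp add: field_simps)
        then have "K * \<tau> k * ?e \<le> \<gamma>0 / 4 * ?e" using err0 by (intro mult_right_mono) auto
        moreover have "K * (1 + Q) * ?e * ?e \<le> \<gamma>0 / 4 * ?e"
          using \<rho>2[OF wk(3)] err0 by (intro mult_right_mono) auto
        moreover have "K * (?e\<^sup>2 + \<mu> k) \<le> K * (?e\<^sup>2 + (\<tau> k * ?e + Q * ?e\<^sup>2))"
          using \<mu>k r by (intro mult_left_mono add_left_mono) auto
        moreover have "(1 - \<gamma> k) * ?e \<le> (1 - \<gamma>0) * ?e" using gk err0 by (intro mult_right_mono) auto
        ultimately show ?thesis using st(3) by (simp add: algebra_simps power2_eq_square)
      qed
      ultimately show ?thesis using st by blast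
    qed
    \<comment> \<open>The exponent \<open>min k N\<close> freezes the growth bound once contraction
      has set in.\<close>
    have inv: "fst (w k) \<in> fst c \<and> nonneg_zs (w k) \<and> err (w k) \<le> G ^ min k N * err (w 0)" if "k \<le> n" for k
      using that
    proof (induction k)
      case 0
      have "nonneg_zs (w 0)"
        using rip by (cases "w 0") (auto simp: rip_steps_def positive_zs_def nonneg_zs_def less_imp_le)
      then show ?case using w0 by simp
    next
      case (Suc k)
      then have IH: "fst (w k) \<in> fst c" "nonneg_zs (w k)" "err (w k) \<le> G ^ min k N * err (w 0)" by auto
      have "err (w k) < \<rho>" using IH(3) G0[of k] by simp
      note o = one[OF _ IH(1,2) this]
      have "err (w (Suc k)) \<le> G ^ min (Suc k) N * err (w 0)"
      proof (cases "N \<le> k")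
        case True
        have "err (w (Suc k)) \<le> (1 - \<gamma>0 / 2) * err (w k)" using o Suc.prems True by simp
        also have "\<dots> \<le> 1 * err (w k)" using \<gamma>0 err0 by (intro mult_right_mono) auto
        finally show ?thesis using IH(3) True by (simp add: min_def split: if_splits)
      next
        case False
        have "err (w (Suc k)) \<le> G * err (w k)" using o Suc.prems by simp
        also have "\<dots> \<le> G * (G ^ min k N * err (w 0))" using IH(3) G by (intro mult_left_mono) auto
        finally show ?thesis using False by (simp add: min_def mult.assoc)
      qed
      then show ?case using o Suc.prems by simp
    qed
    have small: "err (w k) < \<rho>" if "k \<le> n" for k using inv[OF that] G0[of k] by simp
    show "(\<forall>k\<le>n. fst (w k) \<in> fst c \<and> err (w k) < \<rho>) \<and>
      (\<forall>k<n. err (w (Suc k)) \<le> (1 - \<gamma> k) * err (w k) + K * ((err (w k))\<^sup>2 + \<mu> k) \<and>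
        (N \<le> k \<longrightarrow> err (w (Suc k)) \<le> (1 - \<gamma>0 / 2) * err (w k)))"
      using inv small one by simp
  qed (use \<rho> r in auto)
qed

end

lemma eventually_contracting_tendsto_zero:
  fixes e :: "nat \<Rightarrow> real"
  assumes nonneg: "\<And>k. 0 \<le> e k" and q: "0 \<le> q" "q < 1" and step: "\<And>k. N \<le> k \<Longrightarrow> e (Suc k) \<le> q * e k"
  shows "e \<longlonglongrightarrow> 0"
proof -
  have bound: "e (k + N) \<le> q ^ k * e N" for k
  proof (induction k)
    case (Suc k)
    have "e (Suc k + N) \<le> q * e (k + N)" using step[of "k + N"] by simp
    also have "\<dots> \<le> q * (q ^ k * e N)" using Suc q by (intro mult_left_mono) auto
    finally show ?case by (simp add: mult.assoc)
  qed simp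
  have lim: "(\<lambda>k. q ^ k * e N) \<longlonglongrightarrow> 0"
    using LIMSEQ_power_zero[of q] q by (intro tendsto_mult_left_zero) auto
  have "(\<lambda>k. e (k + N)) \<longlonglongrightarrow> 0"
    by (rule tendsto_sandwich[OF _ _ tendsto_const lim]) (simp_all add: nonneg bound)
  then show ?thesis by (rule LIMSEQ_offset)
qed

text \<open>Well-definedness is phrased through finite runs: whatever admissible parameters were
  used so far, the last iterate lies on the manifold and has exactly one Newton direction, so the
  next step is always possible. The disjunction serves both parameter rules at once.\<close>

theorem theorem5p3:
  fixes M :: "('a, 'e::euclidean_space) rmanifold"
    and conn :: "('a, 'e) connection"
    and f :: "'a \<Rightarrow> real"
    and h :: "'a \<Rightarrow> real ^ 'l"
    and g :: "'a \<Rightarrow> real ^ 'm"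
    and R :: "'a \<Rightarrow> 'e \<Rightarrow> 'a"
    and \<gamma>\<^sub>0 :: real
    and ws :: "('a, 'l, 'm) kkt_point"
  assumes "riemannian_manifold M"
    and "connected_space (manifold_topology M)"
    and "complete_manifold M"
    and "levi_civita M conn"
    and "smooth_fun_on M (points M) f"
    and "smooth_fun_on M (points M) h"
    and "smooth_fun_on M (points M) g"
    and "manifold_retraction M R"
    and "0 < \<gamma>\<^sub>0" and "\<gamma>\<^sub>0 < 1"
    and "ws \<in> points (kkt_manifold M)"
    and A1: "kkt_conditions M f h g ws"
    and A2: "licq M h g (fst ws)"
    and A3: "strict_complementarity g ws"
    and A4: "second_order_sufficient M conn f h g ws"
  shows "\<forall>(\<sigma> :: nat \<Rightarrow> real) (C :: real). \<sigma> \<longlonglongrightarrow> 0 \<and> 0 < C \<longrightarrow>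
    (\<exists>\<delta>>0. \<forall>w0\<in>points (kkt_manifold M). positive_zs w0 \<and> riemannian_dist (kkt_manifold M) w0 ws < \<delta> \<longrightarrow>
      (\<forall>n w \<mu> \<gamma>.
         rip_steps M conn f h g R \<gamma>\<^sub>0 n w \<mu> \<gamma> \<and> w 0 = w0 \<and>
         ((\<forall>k\<le>n. \<mu> k \<le> \<sigma> k * kkt_norm M f h g (w k)) \<or> (\<forall>k\<le>n. \<mu> k \<le> C * (kkt_norm M f h g (w k))\<^sup>2))
         \<longrightarrow> w n \<in> points (kkt_manifold M) \<and> (\<exists>!\<Delta>. newton_direction M conn f h g (w n) (\<mu> n) \<Delta>)) \<and>
      (\<forall>w \<mu> \<gamma>.
         rip_run M conn f h g R \<gamma>\<^sub>0 w \<mu> \<gamma> \<and> w 0 = w0 \<and>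
         (\<forall>k. \<mu> k \<le> \<sigma> k * kkt_norm M f h g (w k)) \<and> \<gamma> \<longlonglongrightarrow> 1
         \<longrightarrow> superlinear_convergence (kkt_manifold M) w ws) \<and>
      (\<forall>w \<mu> \<gamma>.
         rip_run M conn f h g R \<gamma>\<^sub>0 w \<mu> \<gamma> \<and> w 0 = w0 \<and>
         (\<forall>k. \<mu> k \<le> C * (kkt_norm M f h g (w k))\<^sup>2) \<and> big_O (\<lambda>k. 1 - \<gamma> k) (\<lambda>k. kkt_norm M f h g (w k))
         \<longrightarrow> quadratic_convergence (kkt_manifold M) w ws))"
proof (intro allI impI, elim conjE)
  fix \<sigma> :: "nat \<Rightarrow> real" and C :: real
  assume \<sigma>: "\<sigma> \<longlonglongrightarrow> 0" and C: "0 < C"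
  interpret riemannian M by (rule riemannian_manifold_imp_riemannian[OF assms(1)])
  interpret kkt_problem M conn f h g
    using assms(4-7) by unfold_locales (simp_all add: levi_civita_def)
  let ?N = "kkt_manifold M :: (('a, 'l, 'm) kkt_point, ('e, 'l, 'm) kkt_point) rmanifold"
  let ?F = "kkt_norm M f h g"
  have pN: "points ?N = points M \<times> UNIV" by (simp only: kkt_manifold_def points_times_euclidean)
  have xs: "fst ws \<in> points M" using assms(11) unfolding pN by auto
  define c where "c = chart_at M (fst ws)"
  have c: "c \<in> charts M" "fst ws \<in> fst c" using chart_at[OF xs] by (auto simp: c_def)
  define err where "err w = norm (point_coord c w - point_coord c ws)" for w :: "('a, 'l, 'm) kkt_point"
  let ?d = "\<lambda>w. riemannian_dist ?N w ws"
  have err0: "0 \<le> err w" for w by (simp add: err_def)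
  obtain r1 K1 where r1: "r1 > 0" "K1 > 0"
    and ex1: "\<And>w \<mu>. fst w \<in> fst c \<Longrightarrow> err w \<le> r1 \<Longrightarrow> \<exists>!\<Delta>. newton_direction M conn f h g w \<mu> \<Delta>"
    and F: "\<And>w. fst w \<in> fst c \<Longrightarrow> err w \<le> r1 \<Longrightarrow> 0 \<le> ?F w \<and> ?F w \<le> K1 * err w"
    by (rule local_newton[OF c A1 A2 A3 A4]) (rule that; unfold err_def; assumption)
  have connN: "connected_space (manifold_topology ?N)"
    unfolding kkt_manifold_def by (rule connected_times_euclidean[OF assms(2)])
  have wsN: "ws \<in> fst (prod_chart c)" using c(2) by (simp add: mem_Times_iff)
  obtain r2 k B where r2: "r2 > 0" "k > 0" "B > 0"
    and dist1: "\<And>w. w \<in> fst (prod_chart c) \<Longrightarrow> norm (snd (prod_chart c) w - snd (prod_chart c) ws) < r2 \<Longrightarrow>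
      k * norm (snd (prod_chart c) w - snd (prod_chart c) ws) \<le> ?d w \<and>
      ?d w \<le> B * norm (snd (prod_chart c) w - snd (prod_chart c) ws)"
    and dist2: "\<And>w. w \<in> points ?N \<Longrightarrow> ?d w < k * r2 \<Longrightarrow>
      w \<in> fst (prod_chart c) \<and> norm (snd (prod_chart c) w - snd (prod_chart c) ws) < r2"
    by (rule product.riemannian_dist_chart[OF connN prod_chart_kkt[OF c(1)] wsN]) (rule that; assumption)
  have dist: "k * err w \<le> ?d w" "?d w \<le> B * err w" if "fst w \<in> fst c" "err w < r2" for w
    using dist1[of w] that unfolding snd_prod_chart_kkt err_def by (simp_all add: mem_Times_iff)
  \<comment> \<open>With \<open>?F w \<le> K1 * err w\<close> both parameter rules fit under
    \<open>\<tau> i * err w + Q * (err w)\<^sup>2\<close>. The absolute value is there because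
    \<open>\<sigma>\<close> may take negative values.\<close>
  define \<tau> where "\<tau> i = \<bar>\<sigma> i\<bar> * K1" for i
  have \<tau>: "\<tau> \<longlonglongrightarrow> 0" "\<And>i. 0 \<le> \<tau> i"
    using tendsto_mult_left_zero[OF tendsto_rabs_zero[OF \<sigma>], of K1] r1 by (auto simp: \<tau>_def[abs_def])
  define Q where "Q = C * K1\<^sup>2"
  have Q: "0 \<le> Q" using C by (simp add: Q_def)
  have \<rho>0: "0 < min r1 r2" using r1 r2 by simp
  obtain \<delta> \<rho> K N where D: "0 < \<delta>" "0 < \<rho>" "\<rho> \<le> min r1 r2" "0 < K"
    and run: "\<And>n w \<mu> \<gamma>. rip_steps M conn f h g R \<gamma>\<^sub>0 n w \<mu> \<gamma> \<Longrightarrow> fst (w 0) \<in> fst c \<Longrightarrow> err (w 0) < \<delta> \<Longrightarrow>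
      (\<forall>k\<le>n. fst (w k) \<in> fst c \<and> err (w k) < \<rho> \<longrightarrow> \<mu> k \<le> \<tau> k * err (w k) + Q * (err (w k))\<^sup>2) \<Longrightarrow>
      (\<forall>k\<le>n. fst (w k) \<in> fst c \<and> err (w k) < \<rho>) \<and>
      (\<forall>k<n. err (w (Suc k)) \<le> (1 - \<gamma> k) * err (w k) + K * ((err (w k))\<^sup>2 + \<mu> k) \<and>
        (N \<le> k \<longrightarrow> err (w (Suc k)) \<le> (1 - \<gamma>\<^sub>0 / 2) * err (w k)))"
    by (rule local_run[OF assms(8) c A1 A2 A3 A4 assms(9,10) \<tau> Q \<rho>0, folded err_def]) (rule that; assumption)
  have Fle: "0 \<le> ?F w" "?F w \<le> K1 * err w" if "fst w \<in> fst c" "err w < \<rho>" for w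
    using F[of w] that D(3) by auto
  have \<mu>1: "m \<le> \<bar>\<sigma> i\<bar> * K1 * err w" if "m \<le> \<sigma> i * ?F w" "fst w \<in> fst c" "err w < \<rho>" for m i w
  proof -
    have "m \<le> \<bar>\<sigma> i\<bar> * ?F w" using that(1) Fle[OF that(2,3)] mult_right_mono[OF abs_ge_self, of "?F w" "\<sigma> i"] by simp
    also have "\<dots> \<le> \<bar>\<sigma> i\<bar> * (K1 * err w)" using Fle[OF that(2,3)] by (intro mult_left_mono) auto
    finally show ?thesis by (simp add: mult.assoc)
  qed
  have \<mu>2: "m \<le> Q * (err w)\<^sup>2" if "m \<le> C * (?F w)\<^sup>2" "fst w \<in> fst c" "err w < \<rho>" for m w
  proof -
    have "C * (?F w)\<^sup>2 \<le> C * (K1 * err w)\<^sup>2"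
      using Fle[OF that(2,3)] C by (intro mult_left_mono power_mono) auto
    then show ?thesis using that(1) by (simp add: Q_def power_mult_distrib mult.assoc)
  qed
  have \<mu>: "m \<le> \<tau> i * err w + Q * (err w)\<^sup>2"
    if "m \<le> \<sigma> i * ?F w \<or> m \<le> C * (?F w)\<^sup>2" "fst w \<in> fst c" "err w < \<rho>" for m i w
    using that(1)
  proof
    assume "m \<le> \<sigma> i * ?F w"
    from \<mu>1[OF this that(2,3)] show ?thesis using Q by (simp add: \<tau>_def add_increasing2)
  next
    assume "m \<le> C * (?F w)\<^sup>2"
    from \<mu>2[OF this that(2,3)] show ?thesis using \<tau>(2)[of i] err0[of w] by (simp add: add_increasing)
  qed
  \<comment> \<open>The first entry places the starting point in the chart; the second turns
    closeness in the Riemannian distance into \<open>err w < \<delta>\<close> by the lower distance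
    estimate.\<close>
  define \<delta>' where "\<delta>' = min (k * r2) (k * \<delta>)"
  have \<delta>': "0 < \<delta>'" using r2 D by (simp add: \<delta>'_def)
  have start: "fst w \<in> fst c" "err w < \<delta>" if "w \<in> points ?N" "?d w < \<delta>'" for w
  proof -
    have "w \<in> fst (prod_chart c) \<and> norm (snd (prod_chart c) w - snd (prod_chart c) ws) < r2"
      using that by (intro dist2) (auto simp: \<delta>'_def)
    then have *: "fst w \<in> fst c" "err w < r2"
      unfolding snd_prod_chart_kkt err_def by (simp_all add: mem_Times_iff)
    then have "k * err w < k * \<delta>" using dist(1)[OF *] that(2) by (simp add: \<delta>'_def)
    then show "fst w \<in> fst c" "err w < \<delta>" using * r2 by simp_all
  qed
  have runs: "(\<forall>k. fst (w k) \<in> fst c \<and> err (w k) < \<rho>) \<and>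
      (\<forall>k. err (w (Suc k)) \<le> (1 - \<gamma> k) * err (w k) + K * ((err (w k))\<^sup>2 + \<mu> k)) \<and>
      (\<lambda>k. err (w k)) \<longlonglongrightarrow> 0 \<and> (\<forall>k. 0 < \<mu> k \<and> \<gamma> k \<le> 1)"
    if rr: "rip_run M conn f h g R \<gamma>\<^sub>0 w \<mu> \<gamma>" and w0: "w 0 \<in> points ?N" "?d (w 0) < \<delta>'"
      and \<mu>b: "\<And>k. \<mu> k \<le> \<sigma> k * ?F (w k) \<or> \<mu> k \<le> C * (?F (w k))\<^sup>2" for w \<mu> \<gamma>
  proof -
    have rs: "rip_steps M conn f h g R \<gamma>\<^sub>0 n w \<mu> \<gamma>" for n using rr by (simp add: rip_run_def)
    have "\<forall>k\<le>n. fst (w k) \<in> fst c \<and> err (w k) < \<rho> \<longrightarrow> \<mu> k \<le> \<tau> k * err (w k) + Q * (err (w k))\<^sup>2" for n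
      using \<mu>[OF \<mu>b] by simp
    note run' = run[OF rs start[OF w0] this]
    have a: "fst (w k) \<in> fst c \<and> err (w k) < \<rho>" for k using run'[of k] by simp
    have b: "err (w (Suc k)) \<le> (1 - \<gamma> k) * err (w k) + K * ((err (w k))\<^sup>2 + \<mu> k)" for k
      using run'[of "Suc k"] by simp
    have "err (w (Suc k)) \<le> (1 - \<gamma>\<^sub>0 / 2) * err (w k)" if "N \<le> k" for k
      using run'[of "Suc k"] that by simp
    then have "(\<lambda>k. err (w k)) \<longlonglongrightarrow> 0"
      by (rule eventually_contracting_tendsto_zero[rotated 3]) (use err0 assms(9,10) in auto)
    moreover have "0 < \<mu> k \<and> \<gamma> k \<le> 1" for k
      using rs[of "Suc k"] by (cases k) (auto simp: rip_steps_def)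
    ultimately show ?thesis using a b by simp
  qed
  have dist_limit: "(\<lambda>k. ?d (w k)) \<longlonglongrightarrow> 0"
    if a: "\<And>k. fst (w k) \<in> fst c \<and> err (w k) < \<rho>" and lim: "(\<lambda>k. err (w k)) \<longlonglongrightarrow> 0" for w
  proof (rule tendsto_sandwich[OF _ _ tendsto_const])
    have d: "k * err (w i) \<le> ?d (w i)" "?d (w i) \<le> B * err (w i)" for i
      using dist[of "w i"] a[of i] D(3) by auto
    show "\<forall>\<^sub>F i in sequentially. 0 \<le> ?d (w i)"
      using d(1) err0 r2 by (intro always_eventually allI) (meson mult_nonneg_nonneg less_imp_le order_trans)
    show "\<forall>\<^sub>F i in sequentially. ?d (w i) \<le> B * err (w i)" using d(2) by simp
    show "(\<lambda>i. B * err (w i)) \<longlonglongrightarrow> 0" using lim by (rule tendsto_mult_right_zero)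
  qed
  show "\<exists>\<delta>>0. \<forall>w0\<in>points ?N. positive_zs w0 \<and> ?d w0 < \<delta> \<longrightarrow>
      (\<forall>n w \<mu> \<gamma>.
         rip_steps M conn f h g R \<gamma>\<^sub>0 n w \<mu> \<gamma> \<and> w 0 = w0 \<and>
         ((\<forall>k\<le>n. \<mu> k \<le> \<sigma> k * ?F (w k)) \<or> (\<forall>k\<le>n. \<mu> k \<le> C * (?F (w k))\<^sup>2))
         \<longrightarrow> w n \<in> points ?N \<and> (\<exists>!\<Delta>. newton_direction M conn f h g (w n) (\<mu> n) \<Delta>)) \<and>
      (\<forall>w \<mu> \<gamma>.
         rip_run M conn f h g R \<gamma>\<^sub>0 w \<mu> \<gamma> \<and> w 0 = w0 \<and>
         (\<forall>k. \<mu> k \<le> \<sigma> k * ?F (w k)) \<and> \<gamma> \<longlonglongrightarrow> 1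
         \<longrightarrow> superlinear_convergence ?N w ws) \<and>
      (\<forall>w \<mu> \<gamma>.
         rip_run M conn f h g R \<gamma>\<^sub>0 w \<mu> \<gamma> \<and> w 0 = w0 \<and>
         (\<forall>k. \<mu> k \<le> C * (?F (w k))\<^sup>2) \<and> big_O (\<lambda>k. 1 - \<gamma> k) (\<lambda>k. ?F (w k))
         \<longrightarrow> quadratic_convergence ?N w ws)"
  proof (intro exI[of _ \<delta>'] conjI \<delta>' ballI impI allI; elim conjE)
    fix w0 n w \<mu> \<gamma>
    assume w0: "w0 \<in> points ?N" "?d w0 < \<delta>'" "w 0 = w0" and rs: "rip_steps M conn f h g R \<gamma>\<^sub>0 n w \<mu> \<gamma>"
      and \<mu>b: "(\<forall>k\<le>n. \<mu> k \<le> \<sigma> k * ?F (w k)) \<or> (\<forall>k\<le>n. \<mu> k \<le> C * (?F (w k))\<^sup>2)"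
    have st: "fst (w 0) \<in> fst c" "err (w 0) < \<delta>" using start[OF w0(1,2)] w0(3) by auto
    have "\<forall>k\<le>n. fst (w k) \<in> fst c \<and> err (w k) < \<rho> \<longrightarrow> \<mu> k \<le> \<tau> k * err (w k) + Q * (err (w k))\<^sup>2"
      using \<mu>b by (auto intro!: \<mu>)
    from run[OF rs st this] have "\<forall>k\<le>n. fst (w k) \<in> fst c \<and> err (w k) < \<rho>" ..
    then have wn: "fst (w n) \<in> fst c" "err (w n) \<le> r1" using D(3) by auto
    show "w n \<in> points ?N" using chart_points[OF c(1) wn(1)] unfolding pN by (simp add: mem_Times_iff)
    show "\<exists>!\<Delta>. newton_direction M conn f h g (w n) (\<mu> n) \<Delta>" by (rule ex1[OF wn])
  next
    fix w0 w \<mu> \<gamma>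
    assume w0: "w0 \<in> points ?N" "?d w0 < \<delta>'" "w 0 = w0" and rr: "rip_run M conn f h g R \<gamma>\<^sub>0 w \<mu> \<gamma>"
      and \<mu>b: "\<forall>k. \<mu> k \<le> \<sigma> k * ?F (w k)" and \<gamma>: "\<gamma> \<longlonglongrightarrow> 1"
    have *: "(\<forall>k. fst (w k) \<in> fst c \<and> err (w k) < \<rho>) \<and>
      (\<forall>k. err (w (Suc k)) \<le> (1 - \<gamma> k) * err (w k) + K * ((err (w k))\<^sup>2 + \<mu> k)) \<and>
      (\<lambda>k. err (w k)) \<longlonglongrightarrow> 0 \<and> (\<forall>k. 0 < \<mu> k \<and> \<gamma> k \<le> 1)"
      by (rule runs[OF rr]) (use w0 \<mu>b in auto)
    then have a: "\<And>i. fst (w i) \<in> fst c \<and> err (w i) < \<rho>"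
      and b: "\<And>i. err (w (Suc i)) \<le> (1 - \<gamma> i) * err (w i) + K * ((err (w i))\<^sup>2 + \<mu> i)"
      and lim: "(\<lambda>i. err (w i)) \<longlonglongrightarrow> 0" and \<mu>0: "\<And>i. 0 < \<mu> i" by auto
    have d: "k * err (w i) \<le> ?d (w i)" "?d (w i) \<le> B * err (w i)" for i
      using dist[of "w i"] a[of i] D(3) by auto
    \<comment> \<open>If the error were 0, the parameter rule would force
      \<open>\<mu> i \<le> 0\<close>. Positive barrier parameters thus keep the iterates off the
      solution, and the quotient in the superlinear rate has a positive denominator.\<close>
    have pos: "0 < err (w i)" for i
    proof (rule ccontr)
      assume "\<not> 0 < err (w i)"
      then have "err (w i) = 0" using err0[of "w i"] by simp
      then have "\<mu> i \<le> 0" using \<mu>1[of "\<mu> i" i "w i"] \<mu>b a[of i] by simp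
      then show False using \<mu>0[of i] by simp
    qed
    have dpos: "0 < ?d (w i)" for i
      using d(1)[of i] pos[of i] r2(2) by (meson mult_pos_pos less_le_trans)
    \<comment> \<open>The error recursion divided by \<open>err (w i)\<close>; the factor
      \<open>B / k\<close> replaces errors by distances in numerator and denominator.\<close>
    define t where "t i = B / k * ((1 - \<gamma> i) + K * (err (w i) + \<tau> i))" for i
    have le: "?d (w (Suc i)) / ?d (w i) \<le> t i" for i
    proof -
      let ?e = "err (w i)" and ?q = "(1 - \<gamma> i) + K * (err (w i) + \<tau> i)"
      have "\<mu> i \<le> \<tau> i * ?e" using \<mu>1[of "\<mu> i" i "w i"] \<mu>b a[of i] by (simp add: \<tau>_def)
      then have "K * (?e\<^sup>2 + \<mu> i) \<le> K * (?e\<^sup>2 + \<tau> i * ?e)" using D(4) by (intro mult_left_mono) auto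
      then have "err (w (Suc i)) \<le> ?q * ?e" using b[of i] by (simp add: algebra_simps power2_eq_square)
      then have "B * err (w (Suc i)) \<le> B * (?q * ?e)" using r2(3) by (intro mult_left_mono) auto
      then have 1: "?d (w (Suc i)) \<le> B * (?q * ?e)" using d(2)[of "Suc i"] by linarith
      have q0: "0 \<le> ?q"
        using * D(4) \<tau>(2)[of i] err0[of "w i"] by (intro add_nonneg_nonneg mult_nonneg_nonneg) auto
      have "?e \<le> ?d (w i) / k" using d(1)[of i] r2(2) by (simp add: pos_le_divide_eq mult.commute)
      then have "B * (?q * ?e) \<le> B * (?q * (?d (w i) / k))"
        using q0 r2(3) by (intro mult_left_mono) auto
      then have "?d (w (Suc i)) \<le> t i * ?d (w i)" using 1 by (simp add: t_def mult_ac)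
      then show ?thesis using dpos[of i] by (simp add: pos_divide_le_eq)
    qed
    have "t \<longlonglongrightarrow> B / k * ((1 - 1) + K * (0 + 0))"
      unfolding t_def by (intro tendsto_intros \<gamma> lim \<tau>)
    then have t0: "t \<longlonglongrightarrow> 0" by simp
    have "(\<lambda>i. ?d (w (Suc i)) / ?d (w i)) \<longlonglongrightarrow> 0"
      by (rule tendsto_sandwich[OF _ _ tendsto_const t0]) (simp_all add: le less_imp_le[OF dpos])
    then show "superlinear_convergence ?N w ws"
      unfolding superlinear_convergence_def little_o_def using dist_limit[OF a lim] dpos by simp
  next
    fix w0 w \<mu> \<gamma>
    assume w0: "w0 \<in> points ?N" "?d w0 < \<delta>'" "w 0 = w0" and rr: "rip_run M conn f h g R \<gamma>\<^sub>0 w \<mu> \<gamma>"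
      and \<mu>b: "\<forall>k. \<mu> k \<le> C * (?F (w k))\<^sup>2" and bO: "big_O (\<lambda>k. 1 - \<gamma> k) (\<lambda>k. ?F (w k))"
    have *: "(\<forall>k. fst (w k) \<in> fst c \<and> err (w k) < \<rho>) \<and>
      (\<forall>k. err (w (Suc k)) \<le> (1 - \<gamma> k) * err (w k) + K * ((err (w k))\<^sup>2 + \<mu> k)) \<and>
      (\<lambda>k. err (w k)) \<longlonglongrightarrow> 0 \<and> (\<forall>k. 0 < \<mu> k \<and> \<gamma> k \<le> 1)"
      by (rule runs[OF rr]) (use w0 \<mu>b in auto)
    then have a: "\<And>i. fst (w i) \<in> fst c \<and> err (w i) < \<rho>"
      and b: "\<And>i. err (w (Suc i)) \<le> (1 - \<gamma> i) * err (w i) + K * ((err (w i))\<^sup>2 + \<mu> i)"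
      and lim: "(\<lambda>i. err (w i)) \<longlonglongrightarrow> 0" by auto
    have d: "k * err (w i) \<le> ?d (w i)" "?d (w i) \<le> B * err (w i)" for i
      using dist[of "w i"] a[of i] D(3) by auto
    obtain C1 where C1: "C1 > 0" "\<forall>\<^sub>F i in sequentially. 1 - \<gamma> i \<le> C1 * ?F (w i)"
      using bO by (auto simp: big_O_def)
    \<comment> \<open>\<open>C1 * K1\<close> stems from \<open>1 - \<gamma> i\<close>,
      \<open>K * (1 + Q)\<close> from the quadratic remainder and \<open>\<mu> i\<close>;
      \<open>B\<close> and \<open>k\<^sup>2\<close> convert errors into distances.\<close>
    define C2 where "C2 = B * (C1 * K1 + K * (1 + Q)) / k\<^sup>2"
    have C2: "C2 > 0" using r2 C1(1) r1(2) D(4) Q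
      by (auto simp: C2_def intro!: divide_pos_pos mult_pos_pos add_pos_pos add_pos_nonneg)
    have "\<forall>\<^sub>F i in sequentially. ?d (w (Suc i)) \<le> C2 * (?d (w i))\<^sup>2"
      using C1(2)
    proof (rule eventually_mono)
      fix i assume i: "1 - \<gamma> i \<le> C1 * ?F (w i)"
      let ?e = "err (w i)"
      have "1 - \<gamma> i \<le> C1 * (K1 * ?e)"
        using i Fle[of "w i"] a[of i] C1(1) by (meson mult_left_mono less_imp_le order_trans)
      then have "(1 - \<gamma> i) * ?e \<le> C1 * (K1 * ?e) * ?e" using err0 by (intro mult_right_mono) auto
      moreover have "K * (?e\<^sup>2 + \<mu> i) \<le> K * (?e\<^sup>2 + Q * ?e\<^sup>2)"
        using \<mu>2[of "\<mu> i" "w i"] \<mu>b a[of i] D(4) by (intro mult_left_mono) auto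
      ultimately have "err (w (Suc i)) \<le> (C1 * K1 + K * (1 + Q)) * ?e\<^sup>2"
        using b[of i] by (simp add: algebra_simps power2_eq_square)
      then have "B * err (w (Suc i)) \<le> B * ((C1 * K1 + K * (1 + Q)) * ?e\<^sup>2)"
        using r2(3) by (intro mult_left_mono) auto
      then have 1: "?d (w (Suc i)) \<le> B * (C1 * K1 + K * (1 + Q)) * ?e\<^sup>2"
        using d(2)[of "Suc i"] by (simp add: mult.assoc)
      have "(k * ?e)\<^sup>2 \<le> (?d (w i))\<^sup>2" using d(1)[of i] err0[of "w i"] r2(2) by (intro power_mono) auto
      then have "?e\<^sup>2 \<le> (?d (w i))\<^sup>2 / k\<^sup>2" using r2(2) by (simp add: pos_le_divide_eq power_mult_distrib mult.commute)
      then have "B * (C1 * K1 + K * (1 + Q)) * ?e\<^sup>2 \<le> B * (C1 * K1 + K * (1 + Q)) * ((?d (w i))\<^sup>2 / k\<^sup>2)"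
        using r2(3) C1(1) r1(2) D(4) Q by (intro mult_left_mono) auto
      then show "?d (w (Suc i)) \<le> C2 * (?d (w i))\<^sup>2" using 1 by (simp add: C2_def)
    qed
    then show "quadratic_convergence ?N w ws"
      unfolding quadratic_convergence_def big_O_def using dist_limit[OF a lim] C2 by blast
  qed
qed

end
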